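(* Let $(K,v_0)$ be a valued field and $x$ transcendental over $K$. For an almost pure extension $(K(x)|K,v)$ of $(K,v_0)$ there are the following three mutually exclusive cases: immediate, value-transcendental, residue-transcendental; and the following assertions hold: 1') The extension $(K(x)|K,v)$ is immediate if and only if $\mathrm{appr}_v(x,K)$ is transcendental immediate. If $\mathrm{appr}_v(x,K)$ is algebraic immediate, then the extension $(K(x)|K,v)$ is value-transcendental. 2) The extension is value-transcendental if and only if $x-b$ is value-transcendental for some $b\in K$, and this holds if and only if $\mathrm{appr}_v(x,K)$ is value-extending. If in addition $v_0K$ is divisible, then the pure extension $v$ to $K(x)$ is uniquely determined by $\mathrm{appr}_v(x,K)$. 3) The extension is residue-transcendental if and only if $d(x-b)$ is residue-transcendental for some $b,d\in K$, and this holds if and only if $\mathrm{appr}_v(x,K)$ is residue-extending. In this case, the pure extension $v$ to $K(x)$ is uniquely determined by $\mathrm{appr}_v(x,K)$. 4') Let $\mathcal V_{ap}$ be the set of all almost pure extensions of $v_0$ to $K(x)$ and $\mathcal A_{ap}$ the set of all almost pure approximation types over $(K,v_0)$. If $v_0K$ is divisible, then the function $\mathcal V_{ap}\to\mathcal A_{ap}$, $v\mapsto\mathrm{appr}_v(x,K)$, is a bijection.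
   Context: Valuations are Krull valuations written additively; $vK$ is the value group, $Kv$ the residue field, $tv$ the residue of $t$, and $\infty$ is larger than all values. Extensions of $v_0$ are identified when they are equivalent over $v_0$ (differ by an order preserving isomorphism of value groups that is the identity on $v_0K$). Balls: for $c\in K$, the closed ball of radius $\gamma\in vK\cup\{\infty\}$ is $B_\gamma(c,K)=\{a\in K\mid v(a-c)\ge\gamma\}$, and the open ball of radius $\gamma\in vK$ is $B^\circ_\gamma(c,K)=\{a\in K\mid v(a-c)>\gamma\}$. Balls are recorded together with their radius and their kind (open/closed). An approximation type $\mathbf A$ over $(K,v)$ is a (possibly empty) collection of closed and open balls in $(K,v)$, any two of which are comparable by inclusion, such that whenever $\mathbf A$ contains a (closed or open) ball with center $c$ and radius $\gamma$, it contains $B_\beta(c,K)$ and $B_\beta^\circ(c,K)$ for all $\beta\in vK$ with $\beta<\gamma$, and whenever it contains $B^\circ_\gamma(c,K)$ it contains $B_\gamma(c,K)$. Its support $\mathrm{supp}\,\mathbf A$ is the set of all $\gamma\in vK\cup\{\infty\}$ such that $\mathbf A$ contains a closed ball of radius $\gamma$; this ball is then unique and denoted $\mathbf A_\gamma$. If $\mathbf A$ contains an open ball of radius $\gamma$, it is unique and denoted $\mathbf A_\gamma^\circ$. Put $\mathbf A_\gamma=\emptyset$, resp. $\mathbf A_\gamma^\circ=\emptyset$, if there is no such ball. $\bigcap\mathbf A$ is the intersection of all balls in $\mathbf A$ (and $\bigcap\emptyset=K$). $\mathbf A$ is trivial if $\infty\in\mathrm{supp}\,\mathbf A$. For an extension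 $(L|K,v)$ of valued fields and $x\in L$, $\mathrm{appr}_v(x,K)$ is the approximation type over $(K,v)$ consisting of all nonempty sets $\{c\in K\mid v(x-c)\ge\gamma\}$, $\gamma\in vK\cup\{\infty\}$ (as closed balls of radius $\gamma$), and all nonempty sets $\{c\in K\mid v(x-c)>\gamma\}$, $\gamma\in vK$ (as open balls of radius $\gamma$). A non-trivial $\mathbf A$ is: immediate if $\mathbf A\neq\emptyset$ and $\bigcap\mathbf A=\emptyset$; value-extending if $\mathbf A_\gamma^\circ\ne\emptyset$ for every $\gamma\in\mathrm{supp}\,\mathbf A$ and $\bigcap\mathbf A\neq\emptyset$ (so the empty type is value-extending); residue-extending if for every $c\in K$ there is $\gamma\in\mathrm{supp}\,\mathbf A$ with $c\in\mathbf A_\gamma\setminus\mathbf A_\gamma^\circ$, and $\bigcap\mathbf A\ne\emptyset$. An immediate $\mathbf A$ is transcendental if for every $f\in K[X]$ there is $\delta\in\mathrm{supp}\,\mathbf A$ such that $vf(c)$ is constant for $c\in\mathbf A_\delta$, and algebraic otherwise. An algebraic completion type over $(K,v)$ is an algebraic immediate approximation type with support equal to $vK$. $\mathbf A$ is pure if it is transcendental immediate, value-extending or residue-extending; it is almost pure if it is pure or an algebraic completion type. An extension $(K(x)|K,v)$ is immediate if $vK(x)=v_0K$ and $K(x)v=Kv_0$ (canonically); value-transcendental if $vK(x)/v_0K$ has rational rank 1 (and then $K(x)v|Kv_0$ is algebraic); residue-transcendental if $K(x)v|Kv_0$ has transcendence degree 1 (and then $vK(x)/v_0K$ is a torsion group).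 An element $t\in K(x)$ is value-transcendental if $vt$ is not a torsion element modulo $v_0K$; residue-transcendental if $vt=0$ and $tv$ is transcendental over $Kv_0$; valuation-transcendental if it is one of the two. The extension $(K(x)|K,v)$ (or $v$) is pure (in $x$) if either $d(x-b)$ is valuation-transcendental for some $b,d\in K$, or $\mathrm{appr}_v(x,K)$ is a transcendental immediate approximation type. It is almost pure (in $x$) if it is pure or $\mathrm{appr}_v(x,K)$ is an algebraic completion type.
   Formalization: In 2), "value-transcendental iff x−b is value-transcendental for some b" is stated only for pure extensions; if appr_v(x,K) is an algebraic completion type the extension is value-transcendental by 1') but no x−b is, so the equivalence always fails there. *)

theory Defs
  imports
    "HOL-Algebra.Finite_Extensions"
    "HOL-Algebra.Generated_Fields"
    "HOL-Algebra.QuotRing"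
    "HOL-Computational_Algebra.Polynomial_Factorial"
begin

section \<open>Krull valuations\<close>

text \<open>
  The value group is a commutative group in the sense of HOL-Algebra, so what is written additively
  on paper (\<open>\<alpha> + \<beta>\<close>, \<open>0\<close>, \<open>n\<alpha>\<close>) appears here as \<open>\<alpha> \<otimes> \<beta>\<close>, \<open>\<one>\<close>, \<open>\<alpha> [^] n\<close>.
  Values live in the option type, with \<open>None\<close> in the role of \<open>\<infinity>\<close>.
\<close>

record ('f, 'g) valuation =
  vgroup :: "'g monoid"
  gle :: "'g \<Rightarrow> 'g \<Rightarrow> bool"
  val :: "'f \<Rightarrow> 'g option"

definition ordered_group :: "'g monoid \<Rightarrow> ('g \<Rightarrow> 'g \<Rightarrow> bool) \<Rightarrow> bool" where
  "ordered_group G leq \<longleftrightarrow>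
     comm_group G \<and>
     (\<forall>a\<in>carrier G. leq a a) \<and>
     (\<forall>a\<in>carrier G. \<forall>b\<in>carrier G. leq a b \<and> leq b a \<longrightarrow> a = b) \<and>
     (\<forall>a\<in>carrier G. \<forall>b\<in>carrier G. \<forall>c\<in>carrier G. leq a b \<and> leq b c \<longrightarrow> leq a c) \<and>
     (\<forall>a\<in>carrier G. \<forall>b\<in>carrier G. leq a b \<or> leq b a) \<and>
     (\<forall>a\<in>carrier G. \<forall>b\<in>carrier G. \<forall>c\<in>carrier G. leq a b \<longrightarrow> leq (c \<otimes>\<^bsub>G\<^esub> a) (c \<otimes>\<^bsub>G\<^esub> b))"

definition vle :: "('f, 'g) valuation \<Rightarrow> 'g option \<Rightarrow> 'g option \<Rightarrow> bool" where
  "vle v a b = (case b of None \<Rightarrow> True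
                | Some h \<Rightarrow> (case a of None \<Rightarrow> False | Some g \<Rightarrow> gle v g h))"

definition vless :: "('f, 'g) valuation \<Rightarrow> 'g option \<Rightarrow> 'g option \<Rightarrow> bool" where
  "vless v a b \<longleftrightarrow> vle v a b \<and> a \<noteq> b"

definition vzero :: "('f, 'g) valuation \<Rightarrow> 'g option" where
  "vzero v = Some \<one>\<^bsub>vgroup v\<^esub>"

text \<open>The last conjunct makes \<open>vgroup v\<close> the value group \<open>vF\<close> itself.\<close>

definition is_valuation :: "('f::field, 'g) valuation \<Rightarrow> bool" where
  "is_valuation v \<longleftrightarrow>
     ordered_group (vgroup v) (gle v) \<and>
     (\<forall>a. val v a = None \<longleftrightarrow> a = 0) \<and>
     (\<forall>a \<alpha>. val v a = Some \<alpha> \<longrightarrow> \<alpha> \<in> carrier (vgroup v)) \<and>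
     (\<forall>a b \<alpha> \<beta>. val v a = Some \<alpha> \<and> val v b = Some \<beta> \<longrightarrow> val v (a * b) = Some (\<alpha> \<otimes>\<^bsub>vgroup v\<^esub> \<beta>)) \<and>
     (\<forall>a b. vle v (val v a) (val v (a + b)) \<or> vle v (val v b) (val v (a + b))) \<and>
     (\<forall>\<alpha>\<in>carrier (vgroup v). \<exists>a. val v a = Some \<alpha>)"

definition divisible_group :: "'g monoid \<Rightarrow> bool" where
  "divisible_group G \<longleftrightarrow>
     (\<forall>n::nat. n > 0 \<longrightarrow> (\<forall>g\<in>carrier G. \<exists>h\<in>carrier G. h [^]\<^bsub>G\<^esub> n = g))"

definition val_ring :: "('f::field, 'g) valuation \<Rightarrow> 'f ring" where
  "val_ring v = \<lparr> carrier = {a. vle v (vzero v) (val v a)},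
                  mult = (*), one = 1, zero = 0, add = (+) \<rparr>"

definition max_ideal :: "('f::field, 'g) valuation \<Rightarrow> 'f set" where
  "max_ideal v = {a. vless v (vzero v) (val v a)}"

definition residue_field :: "('f::field, 'g) valuation \<Rightarrow> 'f set ring" where
  "residue_field v = val_ring v Quot max_ideal v"

definition residue :: "('f::field, 'g) valuation \<Rightarrow> 'f \<Rightarrow> 'f set" where
  "residue v t = max_ideal v +>\<^bsub>val_ring v\<^esub> t"


section \<open>Extensions to the rational function field\<close>

text \<open>\<open>K(x)\<close> is the type \<open>'a poly fract\<close>, with \<open>K\<close> embedded by \<open>const\<close>.\<close>

definition const :: "'a::field \<Rightarrow> 'a poly fract" where
  "const c = to_fract [:c:]"

definition var_x :: "'a::field poly fract" where
  "var_x = to_fract [:0, 1:]"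

text \<open>
  The inclusion of value groups \<open>v\<^sub>0K \<subseteq> vK(x)\<close> is an order embedding \<open>\<iota>\<close>. It is determined by
  \<open>v\<^sub>0\<close> and \<open>v\<close>, and \<open>vemb\<close> below is an explicit description of it.
\<close>

definition extends :: "('a::field, 'g0) valuation \<Rightarrow> ('a poly fract, 'g) valuation \<Rightarrow> bool" where
  "extends v0 v \<longleftrightarrow> is_valuation v \<and>
     (\<exists>\<iota>\<in>hom (vgroup v0) (vgroup v).
        (\<forall>\<alpha>\<in>carrier (vgroup v0). \<forall>\<beta>\<in>carrier (vgroup v0). gle v (\<iota> \<alpha>) (\<iota> \<beta>) \<longleftrightarrow> gle v0 \<alpha> \<beta>) \<and>
        (\<forall>c. val v (const c) = map_option \<iota> (val v0 c)))"

definition vemb :: "('a::field, 'g0) valuation \<Rightarrow> ('a poly fract, 'g) valuation \<Rightarrow> 'g0 \<Rightarrow> 'g" where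
  "vemb v0 v \<gamma> = (THE \<delta>. \<exists>c. val v0 c = Some \<gamma> \<and> val v (const c) = Some \<delta>)"

definition equiv_over ::
  "('a::field, 'g0) valuation \<Rightarrow> ('a poly fract, 'g) valuation \<Rightarrow> ('a poly fract, 'h) valuation \<Rightarrow> bool" where
  "equiv_over v0 v w \<longleftrightarrow>
     (\<exists>\<phi>\<in>iso (vgroup v) (vgroup w).
        (\<forall>\<alpha>\<in>carrier (vgroup v). \<forall>\<beta>\<in>carrier (vgroup v). gle w (\<phi> \<alpha>) (\<phi> \<beta>) \<longleftrightarrow> gle v \<alpha> \<beta>) \<and>
        (\<forall>\<gamma>\<in>carrier (vgroup v0). \<phi> (vemb v0 v \<gamma>) = vemb v0 w \<gamma>) \<and>
        (\<forall>f. val w f = map_option \<phi> (val v f)))"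

definition base_group :: "('a::field, 'g0) valuation \<Rightarrow> ('a poly fract, 'g) valuation \<Rightarrow> 'g set" where
  "base_group v0 v = vemb v0 v ` carrier (vgroup v0)"

definition base_residues :: "('a::field, 'g0) valuation \<Rightarrow> ('a poly fract, 'g) valuation \<Rightarrow> 'a poly fract set set" where
  "base_residues v0 v = (\<lambda>c. residue v (const c)) ` carrier (val_ring v0)"

definition rationally_independent :: "('g, 'm) monoid_scheme \<Rightarrow> 'g set \<Rightarrow> bool" where
  "rationally_independent H B \<longleftrightarrow> B \<subseteq> carrier H \<and>
     (\<forall>S (n :: 'g \<Rightarrow> int). finite S \<and> S \<subseteq> B \<and> finprod H (\<lambda>b. b [^]\<^bsub>H\<^esub> n b) S = \<one>\<^bsub>H\<^esub> \<longrightarrow> (\<forall>b\<in>S. n b = 0))"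

definition has_rational_rank :: "('g, 'm) monoid_scheme \<Rightarrow> nat \<Rightarrow> bool" where
  "has_rational_rank H r \<longleftrightarrow>
     (\<exists>B. finite B \<and> card B = r \<and> rationally_independent H B \<and>
        (\<forall>B'. rationally_independent H B' \<and> B \<subseteq> B' \<longrightarrow> B' = B))"

text \<open>Transcendence degree 1: there is a transcendence basis with exactly one element.\<close>

definition has_trdeg_one :: "('r, 'm) ring_scheme \<Rightarrow> 'r set \<Rightarrow> bool" where
  "has_trdeg_one F k \<longleftrightarrow>
     (\<exists>t\<in>carrier F. ring.transcendental F k t \<and>
        (\<forall>s\<in>carrier F. ring.algebraic F (generate_field F (insert t k)) s))"

definition immediate_ext :: "('a::field, 'g0) valuation \<Rightarrow> ('a poly fract, 'g) valuation \<Rightarrow> bool" where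
  "immediate_ext v0 v \<longleftrightarrow>
     base_group v0 v = carrier (vgroup v) \<and> base_residues v0 v = carrier (residue_field v)"

definition value_transcendental_ext :: "('a::field, 'g0) valuation \<Rightarrow> ('a poly fract, 'g) valuation \<Rightarrow> bool" where
  "value_transcendental_ext v0 v \<longleftrightarrow> has_rational_rank (vgroup v Mod base_group v0 v) 1"

definition residue_transcendental_ext :: "('a::field, 'g0) valuation \<Rightarrow> ('a poly fract, 'g) valuation \<Rightarrow> bool" where
  "residue_transcendental_ext v0 v \<longleftrightarrow> has_trdeg_one (residue_field v) (base_residues v0 v)"

definition value_transcendental ::
  "('a::field, 'g0) valuation \<Rightarrow> ('a poly fract, 'g) valuation \<Rightarrow> 'a poly fract \<Rightarrow> bool" where
  "value_transcendental v0 v t \<longleftrightarrow>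
     (\<exists>\<tau>. val v t = Some \<tau> \<and> (\<forall>n::nat. n > 0 \<longrightarrow> \<tau> [^]\<^bsub>vgroup v\<^esub> n \<notin> base_group v0 v))"

definition residue_transcendental ::
  "('a::field, 'g0) valuation \<Rightarrow> ('a poly fract, 'g) valuation \<Rightarrow> 'a poly fract \<Rightarrow> bool" where
  "residue_transcendental v0 v t \<longleftrightarrow>
     val v t = vzero v \<and> ring.transcendental (residue_field v) (base_residues v0 v) (residue v t)"

definition valuation_transcendental ::
  "('a::field, 'g0) valuation \<Rightarrow> ('a poly fract, 'g) valuation \<Rightarrow> 'a poly fract \<Rightarrow> bool" where
  "valuation_transcendental v0 v t \<longleftrightarrow> value_transcendental v0 v t \<or> residue_transcendental v0 v t"


section \<open>Approximation types\<close>

datatype ball_kind = Closed | Open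

text \<open>A ball is recorded with its kind and radius, as the same set may arise from several of these.\<close>

type_synonym ('a, 'g) ball = "ball_kind \<times> 'g option \<times> 'a set"

definition radii :: "('a, 'g) valuation \<Rightarrow> 'g option set" where
  "radii v = insert None (Some ` carrier (vgroup v))"

definition closed_ball :: "('a::field, 'g) valuation \<Rightarrow> 'g option \<Rightarrow> 'a \<Rightarrow> 'a set" where
  "closed_ball v \<gamma> c = {a. vle v \<gamma> (val v (a - c))}"

definition open_ball :: "('a::field, 'g) valuation \<Rightarrow> 'g option \<Rightarrow> 'a \<Rightarrow> 'a set" where
  "open_ball v \<gamma> c = {a. vless v \<gamma> (val v (a - c))}"

definition closed_balls :: "('a::field, 'g) valuation \<Rightarrow> ('a, 'g) ball set" where
  "closed_balls v = {(Closed, \<gamma>, closed_ball v \<gamma> c) |\<gamma> c. \<gamma> \<in> radii v}"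

definition open_balls :: "('a::field, 'g) valuation \<Rightarrow> ('a, 'g) ball set" where
  "open_balls v = {(Open, \<gamma>, open_ball v \<gamma> c) |\<gamma> c. \<gamma> \<in> Some ` carrier (vgroup v)}"

definition approximation_type :: "('a::field, 'g) valuation \<Rightarrow> ('a, 'g) ball set \<Rightarrow> bool" where
  "approximation_type v A \<longleftrightarrow>
     A \<subseteq> closed_balls v \<union> open_balls v \<and>
     (\<forall>(k, \<gamma>, B)\<in>A. \<forall>(k', \<gamma>', B')\<in>A. B \<subseteq> B' \<or> B' \<subseteq> B) \<and>
     (\<forall>\<gamma> c \<beta>. ((Closed, \<gamma>, closed_ball v \<gamma> c) \<in> A \<or> (Open, \<gamma>, open_ball v \<gamma> c) \<in> A) \<and>
        \<beta> \<in> Some ` carrier (vgroup v) \<and> vless v \<beta> \<gamma> \<longrightarrow>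
        (Closed, \<beta>, closed_ball v \<beta> c) \<in> A \<and> (Open, \<beta>, open_ball v \<beta> c) \<in> A) \<and>
     (\<forall>\<gamma> c. (Open, \<gamma>, open_ball v \<gamma> c) \<in> A \<longrightarrow> (Closed, \<gamma>, closed_ball v \<gamma> c) \<in> A)"

definition supp :: "('a, 'g) ball set \<Rightarrow> 'g option set" where
  "supp A = {\<gamma>. \<exists>B. (Closed, \<gamma>, B) \<in> A}"

definition ball_at :: "('a, 'g) ball set \<Rightarrow> ball_kind \<Rightarrow> 'g option \<Rightarrow> 'a set" where
  "ball_at A k \<gamma> = (if \<exists>B. (k, \<gamma>, B) \<in> A then THE B. (k, \<gamma>, B) \<in> A else {})"

definition Inter_type :: "('a, 'g) ball set \<Rightarrow> 'a set" where
  "Inter_type A = {a. \<forall>(k, \<gamma>, B)\<in>A. a \<in> B}"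

definition trivial_type :: "('a, 'g) ball set \<Rightarrow> bool" where
  "trivial_type A \<longleftrightarrow> None \<in> supp A"

definition immediate_type :: "('a, 'g) ball set \<Rightarrow> bool" where
  "immediate_type A \<longleftrightarrow> \<not> trivial_type A \<and> A \<noteq> {} \<and> Inter_type A = {}"

definition value_extending_type :: "('a, 'g) ball set \<Rightarrow> bool" where
  "value_extending_type A \<longleftrightarrow>
     \<not> trivial_type A \<and> (\<forall>\<gamma>\<in>supp A. ball_at A Open \<gamma> \<noteq> {}) \<and> Inter_type A \<noteq> {}"

definition residue_extending_type :: "('a, 'g) ball set \<Rightarrow> bool" where
  "residue_extending_type A \<longleftrightarrow>
     \<not> trivial_type A \<and> (\<forall>c. \<exists>\<gamma>\<in>supp A. c \<in> ball_at A Closed \<gamma> - ball_at A Open \<gamma>) \<and> Inter_type A \<noteq> {}"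

definition transcendental_immediate_type :: "('a::field, 'g) valuation \<Rightarrow> ('a, 'g) ball set \<Rightarrow> bool" where
  "transcendental_immediate_type v A \<longleftrightarrow> immediate_type A \<and>
     (\<forall>f :: 'a poly. \<exists>\<delta>\<in>supp A. \<exists>\<alpha>. \<forall>c\<in>ball_at A Closed \<delta>. val v (poly f c) = \<alpha>)"

definition algebraic_immediate_type :: "('a::field, 'g) valuation \<Rightarrow> ('a, 'g) ball set \<Rightarrow> bool" where
  "algebraic_immediate_type v A \<longleftrightarrow> immediate_type A \<and> \<not> transcendental_immediate_type v A"

definition algebraic_completion_type :: "('a::field, 'g) valuation \<Rightarrow> ('a, 'g) ball set \<Rightarrow> bool" where
  "algebraic_completion_type v A \<longleftrightarrow>
     algebraic_immediate_type v A \<and> supp A = Some ` carrier (vgroup v)"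

definition pure_type :: "('a::field, 'g) valuation \<Rightarrow> ('a, 'g) ball set \<Rightarrow> bool" where
  "pure_type v A \<longleftrightarrow>
     transcendental_immediate_type v A \<or> value_extending_type A \<or> residue_extending_type A"

definition almost_pure_type :: "('a::field, 'g) valuation \<Rightarrow> ('a, 'g) ball set \<Rightarrow> bool" where
  "almost_pure_type v A \<longleftrightarrow> pure_type v A \<or> algebraic_completion_type v A"

text \<open>\<open>appr v0 v y\<close> is the approximation type of \<open>y\<close> over \<open>(K, v\<^sub>0)\<close> with respect to \<open>v\<close>.\<close>

definition appr ::
  "('a::field, 'g0) valuation \<Rightarrow> ('a poly fract, 'g) valuation \<Rightarrow> 'a poly fract \<Rightarrow> ('a, 'g0) ball set" where
  "appr v0 v y =
     {(Closed, \<gamma>, B) |\<gamma> B. \<gamma> \<in> radii v0 \<and> B \<noteq> {} \<and>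
        B = {c. vle v (map_option (vemb v0 v) \<gamma>) (val v (y - const c))}} \<union>
     {(Open, \<gamma>, B) |\<gamma> B. \<gamma> \<in> Some ` carrier (vgroup v0) \<and> B \<noteq> {} \<and>
        B = {c. vless v (map_option (vemb v0 v) \<gamma>) (val v (y - const c))}}"


section \<open>Pure and almost pure extensions\<close>

definition pure_ext :: "('a::field, 'g0) valuation \<Rightarrow> ('a poly fract, 'g) valuation \<Rightarrow> bool" where
  "pure_ext v0 v \<longleftrightarrow> extends v0 v \<and>
     ((\<exists>b d. valuation_transcendental v0 v (const d * (var_x - const b))) \<or>
      transcendental_immediate_type v0 (appr v0 v var_x))"

definition almost_pure_ext :: "('a::field, 'g0) valuation \<Rightarrow> ('a poly fract, 'g) valuation \<Rightarrow> bool" where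
  "almost_pure_ext v0 v \<longleftrightarrow>
     pure_ext v0 v \<or> (extends v0 v \<and> algebraic_completion_type v0 (appr v0 v var_x))"

definition ext_equiv ::
  "('a::field, 'g0) valuation \<Rightarrow> (('a poly fract, 'g) valuation \<times> ('a poly fract, 'g) valuation) set" where
  "ext_equiv v0 = {(v, w). extends v0 v \<and> extends v0 w \<and> equiv_over v0 v w}"

text \<open>
  A set of extensions has to fix a type for the elements of the value groups. Cosets of the unit
  group of the valuation ring are subsets of \<open>K(x)\<close>, so \<open>'a poly fract set\<close> is large enough:
  see the lemma \<open>extends_canonical\<close> below.
\<close>

definition almost_pure_extensions ::
  "('a::field, 'g0) valuation \<Rightarrow> ('a poly fract, 'a poly fract set) valuation set set" where
  "almost_pure_extensions v0 = {v. almost_pure_ext v0 v} // ext_equiv v0"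

definition almost_pure_types :: "('a::field, 'g0) valuation \<Rightarrow> ('a, 'g0) ball set set" where
  "almost_pure_types v0 = {A. approximation_type v0 A \<and> almost_pure_type v0 A}"

lemma vemb_eq:
  assumes "is_valuation v0" "\<forall>c. val v (const c) = map_option \<iota> (val v0 c)" "\<gamma> \<in> carrier (vgroup v0)"
  shows "vemb v0 v \<gamma> = \<iota> \<gamma>"
proof -
  obtain c where "val v0 c = Some \<gamma>"
    using assms(1,3) unfolding is_valuation_def by blast
  then show ?thesis
    unfolding vemb_def using assms(2) by (intro the_equality) auto
qed

lemma extends_canonical:
  fixes v0 :: "('a::field, 'g0) valuation" and v :: "('a poly fract, 'g) valuation"
  assumes v0: "is_valuation v0" and ext: "extends v0 v"
  shows "\<exists>w :: ('a poly fract, 'a poly fract set) valuation. extends v0 w \<and> equiv_over v0 v w"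
proof -
  define G where "G = vgroup v"
  define h where "h = (\<lambda>\<gamma>. {f. val v f = Some \<gamma>})"
  define k where "k = the_inv_into (carrier G) h"
  define H where "H = \<lparr>carrier = h ` carrier G, monoid.mult = (\<lambda>x y. h (k x \<otimes>\<^bsub>G\<^esub> k y)), one = h \<one>\<^bsub>G\<^esub>\<rparr>"
  define w where "w = \<lparr>vgroup = H, gle = (\<lambda>x y. gle v (k x) (k y)), val = (\<lambda>f. map_option h (val v f))\<rparr>"
  have "is_valuation v" using ext by (simp add: extends_def)
  note vv = this[unfolded is_valuation_def, folded G_def]
  have og: "ordered_group G (gle v)"
    and v0_iff: "\<forall>a. val v a = None \<longleftrightarrow> a = 0"
    and v_in': "\<forall>a \<alpha>. val v a = Some \<alpha> \<longrightarrow> \<alpha> \<in> carrier G"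
    and vmult': "\<forall>a b \<alpha> \<beta>. val v a = Some \<alpha> \<and> val v b = Some \<beta> \<longrightarrow> val v (a * b) = Some (\<alpha> \<otimes>\<^bsub>G\<^esub> \<beta>)"
    and vadd: "\<forall>a b. vle v (val v a) (val v (a + b)) \<or> vle v (val v b) (val v (a + b))"
    and surj: "\<forall>\<alpha>\<in>carrier G. \<exists>a. val v a = Some \<alpha>"
    by (insert vv, (elim conjE, assumption)+)
  note v_in = v_in'[rule_format] and vmult = vmult'[rule_format, OF conjI]
  interpret G: comm_group G using og by (simp add: ordered_group_def)
  have inj: "inj_on h (carrier G)"
  proof (rule inj_onI)
    fix \<alpha> \<beta> assume "\<alpha> \<in> carrier G" "\<beta> \<in> carrier G" "h \<alpha> = h \<beta>"
    moreover obtain a where "val v a = Some \<alpha>" using surj \<open>\<alpha> \<in> carrier G\<close> by blast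
    ultimately show "\<alpha> = \<beta>" unfolding h_def by force
  qed
  have k[simp]: "k (h \<alpha>) = \<alpha>" if "\<alpha> \<in> carrier G" for \<alpha>
    unfolding k_def using inj that by (rule the_inv_into_f_f)
  have H_sel[simp]: "carrier H = h ` carrier G" "\<one>\<^bsub>H\<^esub> = h \<one>\<^bsub>G\<^esub>"
      "x \<otimes>\<^bsub>H\<^esub> y = h (k x \<otimes>\<^bsub>G\<^esub> k y)" for x y
    by (simp_all add: H_def)
  have w_sel[simp]: "vgroup w = H" "gle w x y = gle v (k x) (k y)" "val w f = map_option h (val v f)" for x y f
    by (simp_all add: w_def)
  have "group H"
  proof (rule groupI)
    fix x assume "x \<in> carrier H"
    then show "\<exists>y\<in>carrier H. y \<otimes>\<^bsub>H\<^esub> x = \<one>\<^bsub>H\<^esub>" by (auto intro!: bexI[of _ "inv\<^bsub>G\<^esub> _"])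
  qed (auto simp: G.m_assoc)
  then have cH: "comm_group H"
    by (rule group.group_comm_groupI) (auto simp: G.m_comm)
  have ogH: "ordered_group H (gle w)"
  proof -
    note o = og[unfolded ordered_group_def]
    have k_in: "k x \<in> carrier G" "h (k x) = x" if "x \<in> carrier H" for x
      using that by auto
    have kH: "k (x \<otimes>\<^bsub>H\<^esub> y) = k x \<otimes>\<^bsub>G\<^esub> k y" if "x \<in> carrier H" "y \<in> carrier H" for x y
      using k_in[OF that(1)] k_in[OF that(2)] by simp
    show ?thesis
      unfolding ordered_group_def w_sel
    proof (intro conjI ballI impI)
      fix x y assume "x \<in> carrier H" "y \<in> carrier H" "gle v (k x) (k y) \<and> gle v (k y) (k x)"
      then have "k x = k y" using o k_in(1) by blast
      then show "x = y" using k_in(2) \<open>x \<in> carrier H\<close> \<open>y \<in> carrier H\<close> by metis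
    next
      fix x y z assume xyz: "x \<in> carrier H" "y \<in> carrier H" "z \<in> carrier H" "gle v (k x) (k y)"
      then show "gle v (k (z \<otimes>\<^bsub>H\<^esub> x)) (k (z \<otimes>\<^bsub>H\<^esub> y))"
        using o k_in(1) by (simp only: kH)
    qed (use o k_in(1) cH in \<open>blast+\<close>)
  qed
  have vle_w: "vle w (val w a) (val w b) = vle v (val v a) (val v b)" for a b
    by (cases "val v a"; cases "val v b") (simp_all add: vle_def k[OF v_in])
  have hom: "h \<in> hom G H" by (auto simp: hom_def)
  have ww: "is_valuation w"
    unfolding is_valuation_def vle_w
  proof (intro conjI allI impI ballI)
    fix a b \<alpha> \<beta> assume "val w a = Some \<alpha> \<and> val w b = Some \<beta>"
    then obtain \<alpha>' \<beta>' where "val v a = Some \<alpha>'" "val v b = Some \<beta>'" "\<alpha> = h \<alpha>'" "\<beta> = h \<beta>'"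
      by auto
    then show "val w (a * b) = Some (\<alpha> \<otimes>\<^bsub>vgroup w\<^esub> \<beta>)"
      by (simp add: vmult k[OF v_in])
  next
    fix \<alpha> assume "\<alpha> \<in> carrier (vgroup w)"
    then show "\<exists>a. val w a = Some \<alpha>" using surj by fastforce
  next
    show "ordered_group (vgroup w) (gle w)" using ogH by simp
  qed (use v0_iff vadd v_in in auto)
  obtain \<iota> where \<iota>: "\<iota> \<in> hom (vgroup v0) G"
      "\<And>\<alpha> \<beta>. \<alpha> \<in> carrier (vgroup v0) \<Longrightarrow> \<beta> \<in> carrier (vgroup v0) \<Longrightarrow> gle v (\<iota> \<alpha>) (\<iota> \<beta>) \<longleftrightarrow> gle v0 \<alpha> \<beta>"
      "\<forall>c. val v (const c) = map_option \<iota> (val v0 c)"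
    using ext unfolding extends_def G_def by blast
  have \<iota>_in: "\<iota> \<alpha> \<in> carrier G" if "\<alpha> \<in> carrier (vgroup v0)" for \<alpha>
    using \<iota>(1) that by (auto simp: hom_def)
  have w_const: "\<forall>c. val w (const c) = map_option (h \<circ> \<iota>) (val v0 c)"
    by (simp add: \<iota>(3) option.map_comp)
  have "h \<circ> \<iota> \<in> hom (vgroup v0) (vgroup w)"
    using \<iota>(1) hom by (auto intro: hom_compose)
  then have "extends v0 w"
    unfolding extends_def using ww w_const \<iota>(2) \<iota>_in by (intro conjI bexI[of _ "h \<circ> \<iota>"]) auto
  moreover have "equiv_over v0 v w"
    unfolding equiv_over_def
  proof (intro bexI[of _ h] conjI ballI allI)
    show "h \<in> iso (vgroup v) (vgroup w)"
      using hom inj by (simp add: iso_def bij_betw_def flip: G_def)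
    show "h (vemb v0 v \<gamma>) = vemb v0 w \<gamma>" if "\<gamma> \<in> carrier (vgroup v0)" for \<gamma>
      using vemb_eq[OF v0 \<iota>(3) that] vemb_eq[OF v0 w_const that] by simp
  qed (simp_all flip: G_def)
  ultimately show ?thesis by blast
qed

end

theory Submission
  imports Defs
begin

text \<open>
  A valuation \<open>v\<close> is handled through the relation \<open>v a \<le> v b\<close> on the field (\<open>field_valuation\<close>). An
  extension of \<open>v\<^sub>0\<close> to \<open>K(x)\<close> is then a relation that restricts to the given one on \<open>K\<close>, two extensions
  are equivalent iff they are the same relation (\<open>equiv_over_iff\<close>), and every such relation comes from
  a valuation (\<open>field_valuation_realised\<close>). The approximation type of \<open>x\<close> records the comparisons of
  \<open>v (x - c)\<close> with \<open>v\<^sub>0K\<close>. For each of the four kinds of almost pure extensions this information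
  suffices to compute \<open>v\<close> completely, and the computation also shows what the value group
  and the residue field are.

  If some \<open>t = x - b\<close> is value-transcendental, the terms of a polynomial in \<open>t\<close> have distinct values. If
  \<open>d t\<close> is residue-transcendental, no cancellation can occur among the terms of least value. In both
  cases \<open>v\<close> is monomial: the value of a polynomial in \<open>t\<close> is the least value of its terms. So \<open>v\<close> is
  determined by the value of \<open>t\<close>. In the residue-transcendental case it lies in \<open>v\<^sub>0K\<close> and is the
  largest radius of the approximation type. In the value-transcendental case only the cut that it
  induces in \<open>v\<^sub>0K\<close> is known, which determines all comparisons with \<open>n v(t)\<close> when \<open>v\<^sub>0K\<close> is
  divisible. Conversely, a value in \<open>v\<^sub>0K\<close> or a cut of \<open>v\<^sub>0K\<close> defines an order on monomials
  (\<open>gauss_cone\<close>, \<open>cut_cone\<close>), and by Gauss's lemma (\<open>least_mult\<close>) the least value of the terms is a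
  valuation.

  For an immediate type the intersection of the balls is empty. If the type is transcendental, the value
  of every nonzero polynomial \<open>g\<close> is constant on a small ball, and \<open>g(x) / g(c)\<close> is a one-unit for
  all \<open>c\<close> in that ball (\<open>near_if_all_stable\<close>, Kaplansky's theorem). If the type is an algebraic
  completion type, \<open>x\<close> is a limit of elements of \<open>K\<close>. A polynomial without constant
  values on small balls tends to \<open>0\<close> (\<open>unstable_null\<close>). These polynomials form the ideal generated by
  some \<open>f\<close>, and for the others \<open>g(x) / g(c)\<close> is again a one-unit, by continuity. In both cases
  \<open>v (r(x) / s(x)) \<ge> 0\<close> can be tested on the points of small balls (\<open>le_eq_dense_le\<close>), and this test
  defines a valuation for every type of these two kinds (\<open>valuation_extension_dense_le\<close>). In the
  transcendental case the extension is immediate. In the other case \<open>v f(x)\<close> exceeds all of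
  \<open>v\<^sub>0K\<close>, and \<open>v\<^sub>0K\<close> together with \<open>v f(x)\<close> generates the value group, while the residue field does
  not grow.

  As the four kinds of approximation types exclude each other, the equivalences of the theorem
  follow, and the bijection combines uniqueness (\<open>almost_pure_unique\<close>) with existence
  (\<open>almost_pure_type_realised\<close>).
\<close>

section \<open>Valuations as divisibility preorders\<close>

text \<open>The relation \<open>le a b\<close> stands for \<open>v a \<le> v b\<close>. It determines \<open>v\<close> up to equivalence, it needs
  no symbol for \<open>\<infinity>\<close>, and values are added by multiplying elements of the field.\<close>

locale field_valuation =
  fixes le :: "'f::field \<Rightarrow> 'f \<Rightarrow> bool"
  assumes total: "le a b \<or> le b a"
    and trans: "le a b \<Longrightarrow> le b c \<Longrightarrow> le a c"
    and mult: "le a b \<Longrightarrow> le (c * a) (c * b)"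
    and add: "le c a \<Longrightarrow> le c b \<Longrightarrow> le c (a + b)"
    and zero: "le a 0"
    and zero_D: "le 0 a \<Longrightarrow> a = 0"
begin

abbreviation lt where "lt a b \<equiv> \<not> le b a"
abbreviation eqv where "eqv a b \<equiv> le a b \<and> le b a"

lemma refl [simp]: "le a a"
  using total by blast

lemma lt_imp_le: "lt a b \<Longrightarrow> le a b"
  using total by blast

lemma lt_nonzero: "lt a b \<Longrightarrow> a \<noteq> 0"
  using zero by auto

lemma le_nonzero: "le a b \<Longrightarrow> b \<noteq> 0 \<Longrightarrow> a \<noteq> 0"
  using zero_D by auto

lemma zero_iff [simp]: "le 0 a \<longleftrightarrow> a = 0"
  using zero_D zero by auto

text \<open>One of \<open>1\<close> and \<open>-1\<close> is below the other, and multiplying by \<open>-1\<close> exchanges them.\<close>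

lemma le_one_minus: "le 1 (-1)"
  using total[of 1 "-1"] mult[of "-1" 1 "-1"] by auto

lemma minus_right [simp]: "le a (- b) \<longleftrightarrow> le a b"
  using mult[OF le_one_minus, of b] mult[OF le_one_minus, of "-b"] trans[of a b "-b"] trans[of a "-b" b] by auto

lemma minus_left [simp]: "le (- a) b \<longleftrightarrow> le a b"
  using mult[OF le_one_minus, of a] mult[OF le_one_minus, of "-a"] trans[of "-a" a b] trans[of a "-a" b] by auto

lemma diff: "le c a \<Longrightarrow> le c b \<Longrightarrow> le c (a - b)"
  using add[of c a "- b"] by simp

lemma minus_commute: "le c (a - b) \<longleftrightarrow> le c (b - a)" "le (a - b) c \<longleftrightarrow> le (b - a) c"
  using minus_right[of c "a - b"] minus_left[of "a - b" c] by auto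

lemma mult_cancel [simp]: "c \<noteq> 0 \<Longrightarrow> le (c * a) (c * b) \<longleftrightarrow> le a b"
  using mult[of a b c] mult[of "c * a" "c * b" "inverse c"]
  by (auto simp flip: mult.assoc)

lemma mult_cancel_right [simp]: "c \<noteq> 0 \<Longrightarrow> le (a * c) (b * c) \<longleftrightarrow> le a b"
  using mult_cancel[of c a b] by (simp add: mult.commute)

lemma divide_cancel [simp]: "c \<noteq> 0 \<Longrightarrow> le (a / c) (b / c) \<longleftrightarrow> le a b"
  using mult_cancel_right[of "inverse c" a b] by (simp add: divide_inverse)

lemma mult_mono: "le a b \<Longrightarrow> le c d \<Longrightarrow> le (a * c) (b * d)"
  using mult[of a b c] mult[of c d b] trans[of "a * c" "b * c" "b * d"] by (simp add: mult.commute)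

lemma le_divide_iff: "c \<noteq> 0 \<Longrightarrow> le a (b / c) \<longleftrightarrow> le (a * c) b"
  using mult_cancel_right[of c a "b / c"] by simp

lemma divide_le_iff: "c \<noteq> 0 \<Longrightarrow> le (a / c) b \<longleftrightarrow> le a (b * c)"
  using mult_cancel_right[of c "a / c" b] by simp

lemma mult_lt_le: "lt a b \<Longrightarrow> le c d \<Longrightarrow> c \<noteq> 0 \<Longrightarrow> lt (a * c) (b * d)"
  using mult_cancel_right[of c b a] mult[of c d b] trans by blast

lemma mult_le_lt: "le a b \<Longrightarrow> lt c d \<Longrightarrow> a \<noteq> 0 \<Longrightarrow> lt (a * c) (b * d)"
  using mult_lt_le[where a = c and b = d and c = a and d = b] by (simp add: mult.commute)

lemma add_lt: "lt c a \<Longrightarrow> lt c b \<Longrightarrow> lt c (a + b)"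
proof
  assume "lt c a" "lt c b" "le (a + b) c"
  then have "le a b \<Longrightarrow> le a c" "le b a \<Longrightarrow> le b c"
    using add[of a a b] add[of b a b] trans[of _ "a + b" c] by auto
  with \<open>lt c a\<close> \<open>lt c b\<close> show False using total by blast
qed

lemma diff_lt: "lt c a \<Longrightarrow> lt c b \<Longrightarrow> lt c (a - b)"
  using add_lt[where a = a and b = "- b"] by simp

lemma sum_le: "(\<And>i. i \<in> S \<Longrightarrow> le m (f i)) \<Longrightarrow> le m (sum f S)"
  by (induction S rule: infinite_finite_induct) (auto simp: zero add)

lemma sum_lt: "m \<noteq> 0 \<Longrightarrow> (\<And>i. i \<in> S \<Longrightarrow> lt m (f i)) \<Longrightarrow> lt m (sum f S)"
proof (induction S rule: infinite_finite_induct)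
  case (insert x S)
  have "lt m (f x)" "lt m (sum f S)" using insert by auto
  then show ?case using insert.hyps add_lt by simp
qed auto

lemma add_eqv: "lt a b \<Longrightarrow> eqv (a + b) a"
proof -
  assume ab: "lt a b"
  then have "le a (a + b)" using add lt_imp_le by simp
  moreover have "le (a + b) a"
  proof (rule ccontr)
    assume "lt a (a + b)"
    with ab have "lt a (a + b - b)" using diff_lt by blast
    then show False by simp
  qed
  ultimately show ?thesis by blast
qed

lemma diff_eqv: "lt b (a - b) \<Longrightarrow> eqv a b"
  using add_eqv[where a = b and b = "a - b"] by simp

lemma diff_eqv': "lt a b \<Longrightarrow> eqv (a - b) a"
  using add_eqv[where b = "- b"] by simp

lemma power_mono: "le a b \<Longrightarrow> le (a ^ n) (b ^ n)"
  by (induction n) (auto intro: mult_mono)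

lemma power_strict_mono: "lt a b \<Longrightarrow> n > 0 \<Longrightarrow> lt (a ^ n) (b ^ n)"
proof (induction n)
  case (Suc n)
  have "lt (a * a ^ n) (b * b ^ n)"
    using Suc.prems lt_nonzero[where a = a and b = b] lt_imp_le[where a = a and b = b] power_mono[of a b n]
    by (intro mult_lt_le) auto
  then show ?case by simp
qed auto

lemma power_le_iff: "n > 0 \<Longrightarrow> le (a ^ n) (b ^ n) \<longleftrightarrow> le a b"
  using power_mono power_strict_mono by blast

lemma finite_min:
  assumes "finite S" "S \<noteq> {}"
  shows "\<exists>i\<in>S. \<forall>j\<in>S. le (f i) (f j)"
  using assms
proof (induction S rule: finite_ne_induct)
  case (insert x S)
  then obtain i where "i \<in> S" "\<forall>j\<in>S. le (f i) (f j)" by blast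
  then show ?case using total[of "f i" "f x"] trans by (metis insert_iff refl)
qed simp

text \<open>\<open>near u w\<close> means \<open>v (u / w - 1) > 0\<close>. Then \<open>u\<close> and \<open>w\<close> agree in value, and their quotient has
  residue \<open>1\<close>; as one-units form a group, leading terms can be multiplied and divided.\<close>

abbreviation near where "near u w \<equiv> lt w (u - w)"

lemma near_refl: "w \<noteq> 0 \<Longrightarrow> near w w"
  by simp

lemma near_nonzero: "near u w \<Longrightarrow> u \<noteq> 0" "near u w \<Longrightarrow> w \<noteq> 0"
  using diff_eqv[of u w] lt_nonzero[where a = w and b = "u - w"] le_nonzero by auto

lemma near_mult: "near u w \<Longrightarrow> near u' w' \<Longrightarrow> near (u * u') (w * w')"
proof -
  assume a: "near u w" "near u' w'"
  have "u * u' - w * w' = (u - w) * u' + w * (u' - w')" by (simp add: algebra_simps)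
  moreover have "lt (w * w') ((u - w) * u')"
    using mult_lt_le[OF a(1), where c = w' and d = u'] diff_eqv[OF a(2)] near_nonzero[OF a(2)] by blast
  moreover have "lt (w * w') (w * (u' - w'))"
    using mult_le_lt[OF refl, where c = w' and d = "u' - w'" and a = w] a near_nonzero[OF a(1)] by blast
  ultimately show ?thesis using add_lt by simp
qed

lemma near_divide: "near u w \<Longrightarrow> near u' w' \<Longrightarrow> near (u / u') (w / w')"
proof -
  assume a: "near u w" "near u' w'"
  note nz = near_nonzero[OF a(1)] near_nonzero[OF a(2)]
  have "near (1 / u') (1 / w')"
  proof -
    have "1 / u' - 1 / w' = (w' - u') / (u' * w')" using nz by (simp add: field_simps)
    moreover have "lt u' (w' - u')"
      using a(2) diff_eqv[OF a(2)] trans minus_commute(2)[of u' w' u'] minus_commute(2)[of u' w' w']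
      by blast
    then have "lt (u' / (u' * w')) ((w' - u') / (u' * w'))"
      using nz divide_cancel[of "u' * w'" "w' - u'" u'] by simp
    moreover have "u' / (u' * w') = 1 / w'" using nz by simp
    ultimately show ?thesis by simp
  qed
  from near_mult[OF a(1) this] show ?thesis by simp
qed

end

section \<open>Krull valuations versus divisibility preorders\<close>

definition vrel :: "('f::field, 'g) valuation \<Rightarrow> 'f \<Rightarrow> 'f \<Rightarrow> bool" where
  "vrel v a b = vle v (val v a) (val v b)"

lemma is_valuationD:
  assumes "is_valuation v"
  shows "ordered_group (vgroup v) (gle v)"
    and "val v a = None \<longleftrightarrow> a = 0"
    and "val v a = Some \<alpha> \<Longrightarrow> \<alpha> \<in> carrier (vgroup v)"
    and "val v a = Some \<alpha> \<Longrightarrow> val v b = Some \<beta> \<Longrightarrow> val v (a * b) = Some (\<alpha> \<otimes>\<^bsub>vgroup v\<^esub> \<beta>)"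
    and "vle v (val v a) (val v (a + b)) \<or> vle v (val v b) (val v (a + b))"
    and "\<alpha> \<in> carrier (vgroup v) \<Longrightarrow> \<exists>a. val v a = Some \<alpha>"
proof -
  have "ordered_group (vgroup v) (gle v)"
    and "\<forall>a. val v a = None \<longleftrightarrow> a = 0"
    and "\<forall>a \<alpha>. val v a = Some \<alpha> \<longrightarrow> \<alpha> \<in> carrier (vgroup v)"
    and "\<forall>a b \<alpha> \<beta>. val v a = Some \<alpha> \<and> val v b = Some \<beta> \<longrightarrow> val v (a * b) = Some (\<alpha> \<otimes>\<^bsub>vgroup v\<^esub> \<beta>)"
    and "\<forall>a b. vle v (val v a) (val v (a + b)) \<or> vle v (val v b) (val v (a + b))"
    and "\<forall>\<alpha>\<in>carrier (vgroup v). \<exists>a. val v a = Some \<alpha>"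
    by (insert assms[unfolded is_valuation_def], (elim conjE, assumption)+)
  note * = this
  show "ordered_group (vgroup v) (gle v)"
    and "val v a = None \<longleftrightarrow> a = 0"
    and "val v a = Some \<alpha> \<Longrightarrow> \<alpha> \<in> carrier (vgroup v)"
    and "val v a = Some \<alpha> \<Longrightarrow> val v b = Some \<beta> \<Longrightarrow> val v (a * b) = Some (\<alpha> \<otimes>\<^bsub>vgroup v\<^esub> \<beta>)"
    and "vle v (val v a) (val v (a + b)) \<or> vle v (val v b) (val v (a + b))"
    and "\<alpha> \<in> carrier (vgroup v) \<Longrightarrow> \<exists>a. val v a = Some \<alpha>"
    using * by simp_all
qed

lemma ordered_groupD:
  assumes "ordered_group G leq"
  shows "comm_group G"
    and "a \<in> carrier G \<Longrightarrow> leq a a"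
    and "a \<in> carrier G \<Longrightarrow> b \<in> carrier G \<Longrightarrow> leq a b \<Longrightarrow> leq b a \<Longrightarrow> a = b"
    and "a \<in> carrier G \<Longrightarrow> b \<in> carrier G \<Longrightarrow> c \<in> carrier G \<Longrightarrow> leq a b \<Longrightarrow> leq b c \<Longrightarrow> leq a c"
    and "a \<in> carrier G \<Longrightarrow> b \<in> carrier G \<Longrightarrow> leq a b \<or> leq b a"
    and "a \<in> carrier G \<Longrightarrow> b \<in> carrier G \<Longrightarrow> c \<in> carrier G \<Longrightarrow> leq a b \<Longrightarrow> leq (c \<otimes>\<^bsub>G\<^esub> a) (c \<otimes>\<^bsub>G\<^esub> b)"
  using assms unfolding ordered_group_def by blast+

lemma vle_simps [simp]: "vle v a None" "vle v None (Some h) \<longleftrightarrow> False" "vle v (Some g) (Some h) \<longleftrightarrow> gle v g h"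
  by (simp_all add: vle_def)

lemma val_0: "is_valuation v \<Longrightarrow> val v 0 = None"
  by (simp add: is_valuationD)

lemma val_SomeE:
  assumes "is_valuation v" "a \<noteq> 0"
  obtains \<alpha> where "val v a = Some \<alpha>" "\<alpha> \<in> carrier (vgroup v)"
  using is_valuationD(2,3)[OF assms(1)] assms(2) by (meson not_None_eq)

lemma val_1:
  assumes v: "is_valuation v"
  shows "val v 1 = Some \<one>\<^bsub>vgroup v\<^esub>"
proof -
  interpret G: comm_group "vgroup v" using ordered_groupD(1)[OF is_valuationD(1)[OF v]] .
  obtain \<alpha> where \<alpha>: "val v 1 = Some \<alpha>" "\<alpha> \<in> carrier (vgroup v)" using val_SomeE[OF v, of 1] by auto
  have "\<alpha> \<otimes>\<^bsub>vgroup v\<^esub> \<alpha> = \<alpha>" using is_valuationD(4)[OF v \<alpha>(1) \<alpha>(1)] \<alpha>(1) by simp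
  then show ?thesis using \<alpha> by simp
qed

lemma val_power:
  assumes v: "is_valuation v" and a: "val v a = Some \<alpha>"
  shows "val v (a ^ n) = Some (\<alpha> [^]\<^bsub>vgroup v\<^esub> (n::nat))"
proof -
  interpret G: comm_group "vgroup v" using ordered_groupD(1)[OF is_valuationD(1)[OF v]] .
  show ?thesis
  proof (induction n)
    case (Suc n)
    show ?case using is_valuationD(4)[OF v Suc a] by (simp add: mult.commute)
  qed (simp add: val_1[OF v])
qed

lemma val_inverse:
  assumes v: "is_valuation v" and a: "val v a = Some \<alpha>"
  shows "val v (inverse a) = Some (inv\<^bsub>vgroup v\<^esub> \<alpha>)"
proof -
  interpret G: comm_group "vgroup v" using ordered_groupD(1)[OF is_valuationD(1)[OF v]] .
  have a0: "a \<noteq> 0" using a val_0[OF v] by auto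
  then obtain \<beta> where \<beta>: "val v (inverse a) = Some \<beta>" "\<beta> \<in> carrier (vgroup v)"
    using val_SomeE[OF v, of "inverse a"] by auto
  have "\<beta> \<otimes>\<^bsub>vgroup v\<^esub> \<alpha> = \<one>\<^bsub>vgroup v\<^esub>"
    using is_valuationD(4)[OF v \<beta>(1) a] val_1[OF v] a0 by simp
  then show ?thesis using \<beta> G.inv_equality is_valuationD(3)[OF v a] by simp
qed

lemma vle_refl:
  assumes v: "is_valuation v"
  shows "vle v (val v a) (val v a)"
  using ordered_groupD(2)[OF is_valuationD(1)[OF v]] is_valuationD(3)[OF v]
  by (cases "val v a") auto

lemma field_valuation_vrel:
  assumes v: "is_valuation v"
  shows "field_valuation (vrel v)"
proof
  note og = ordered_groupD[OF is_valuationD(1)[OF v]] and in_G = is_valuationD(3)[OF v]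
  fix a b c
  show "vrel v a b \<or> vrel v b a"
    using og(5) in_G unfolding vrel_def by (cases "val v a"; cases "val v b") auto
  show tr: "vrel v a b \<Longrightarrow> vrel v b c \<Longrightarrow> vrel v a c" for a b c
    unfolding vrel_def
    by (cases "val v a"; cases "val v b"; cases "val v c") (simp_all, meson og(4) in_G)
  show "vrel v a 0" "vrel v 0 a \<Longrightarrow> a = 0"
    using is_valuationD(2)[OF v, of a] by (cases "val v a"; simp add: vrel_def val_0[OF v])+
  show "vrel v (c * a) (c * b)" if ab: "vrel v a b"
  proof (cases "b = 0 \<or> c = 0")
    case False
    then have "a \<noteq> 0"
      using ab is_valuationD(2)[OF v, of b] by (cases "val v b") (auto simp: vrel_def val_0[OF v])
    then obtain \<alpha> \<beta> \<gamma> where "val v a = Some \<alpha>" "val v b = Some \<beta>" "val v c = Some \<gamma>"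
      using val_SomeE[OF v] False by metis
    then show ?thesis
      using ab og(6) in_G by (simp add: vrel_def is_valuationD(4)[OF v])
  qed (auto simp: vrel_def val_0[OF v])
  show "vrel v c a \<Longrightarrow> vrel v c b \<Longrightarrow> vrel v c (a + b)"
    using is_valuationD(5)[OF v, of a b] tr unfolding vrel_def by blast
qed

lemma vrel_eqv_iff:
  assumes v: "is_valuation v"
  shows "vrel v a b \<and> vrel v b a \<longleftrightarrow> val v a = val v b"
proof
  note og = ordered_groupD[OF is_valuationD(1)[OF v]] and in_G = is_valuationD(3)[OF v]
  show "vrel v a b \<and> vrel v b a \<Longrightarrow> val v a = val v b"
    using og(3) in_G unfolding vrel_def by (cases "val v a"; cases "val v b") auto
  show "val v a = val v b \<Longrightarrow> vrel v a b \<and> vrel v b a"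
    using vle_refl[OF v] unfolding vrel_def by metis
qed

lemma vless_iff:
  assumes v: "is_valuation v"
  shows "vless v (val v a) (val v b) \<longleftrightarrow> \<not> vrel v b a"
proof -
  interpret field_valuation "vrel v" using field_valuation_vrel[OF v] .
  show ?thesis
    unfolding vless_def using vrel_eqv_iff[OF v, of a b] total[of a b] by (auto simp: vrel_def)
qed

lemma carrier_val_ring: "is_valuation v \<Longrightarrow> carrier (val_ring v) = {a. vrel v 1 a}"
  by (simp add: val_ring_def vrel_def val_1 vzero_def)

lemma max_ideal_eq: "is_valuation v \<Longrightarrow> max_ideal v = {a. \<not> vrel v a 1}"
  using vless_iff[of v 1] by (simp add: max_ideal_def val_1 vzero_def)

text \<open>The values are the classes of equidivisible nonzero elements, multiplied through
  representatives. They are subsets of the field, hence of the type that the sets of extensions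
  are built on.\<close>

lemma field_valuation_realised:
  fixes le :: "'f::field \<Rightarrow> 'f \<Rightarrow> bool"
  assumes "field_valuation le"
  obtains v :: "('f, 'f set) valuation" where "is_valuation v" "vrel v = le"
proof -
  interpret field_valuation le using assms .
  define cl where "cl = (\<lambda>a. {b. eqv a b})"
  define rep where "rep = (\<lambda>A :: 'f set. SOME a. a \<noteq> 0 \<and> A = cl a)"
  define G where "G = \<lparr>carrier = cl ` {a. a \<noteq> 0}, monoid.mult = (\<lambda>A B. cl (rep A * rep B)), one = cl 1\<rparr>"
  define v where "v = \<lparr>vgroup = G, gle = (\<lambda>A B. le (rep A) (rep B)),
                       val = (\<lambda>a. if a = 0 then None else Some (cl a))\<rparr>"
  have cl_eq: "cl a = cl b \<longleftrightarrow> eqv a b" for a b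
    unfolding cl_def using trans refl by blast
  have rep: "rep (cl a) \<noteq> 0" "eqv (rep (cl a)) a" if "a \<noteq> 0" for a
  proof -
    have "rep (cl a) \<noteq> 0 \<and> cl a = cl (rep (cl a))"
      unfolding rep_def by (rule someI[of _ a]) (simp add: that)
    then show "rep (cl a) \<noteq> 0" "eqv (rep (cl a)) a" using cl_eq by auto
  qed
  have le_rep: "le (rep (cl a)) (rep (cl b)) \<longleftrightarrow> le a b" if "a \<noteq> 0" "b \<noteq> 0" for a b
    using rep[OF that(1)] rep[OF that(2)] trans by blast
  have G_sel[simp]: "carrier G = cl ` {a. a \<noteq> 0}" "\<one>\<^bsub>G\<^esub> = cl 1" by (simp_all add: G_def)
  have G_mult[simp]: "cl a \<otimes>\<^bsub>G\<^esub> cl b = cl (a * b)" if "a \<noteq> 0" "b \<noteq> 0" for a b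
    using rep[OF that(1)] rep[OF that(2)] mult_mono by (simp add: G_def cl_eq)
  have "group G"
  proof (rule groupI)
    fix x assume "x \<in> carrier G"
    then obtain a where "x = cl a" "a \<noteq> 0" by auto
    then show "\<exists>y\<in>carrier G. y \<otimes>\<^bsub>G\<^esub> x = \<one>\<^bsub>G\<^esub>"
      by (intro bexI[of _ "cl (inverse a)"]) auto
  qed (auto simp: mult.assoc)
  then have cG: "comm_group G"
    by (rule group.group_comm_groupI) (auto simp: mult.commute)
  have vle_v: "vle v (val v a) (val v b) \<longleftrightarrow> le a b" for a b
    by (auto simp: v_def vle_def le_rep zero)
  have og: "ordered_group G (gle v)"
    unfolding ordered_group_def
  proof (intro conjI ballI impI)
    fix x y z assume "x \<in> carrier G" "y \<in> carrier G" "z \<in> carrier G" "gle v x y"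
    then show "gle v (z \<otimes>\<^bsub>G\<^esub> x) (z \<otimes>\<^bsub>G\<^esub> y)"
      by (auto simp: v_def le_rep)
  next
    fix x y z assume "x \<in> carrier G" "y \<in> carrier G" "z \<in> carrier G" "gle v x y \<and> gle v y z"
    then obtain a b c where "x = cl a" "y = cl b" "z = cl c" "a \<noteq> 0" "b \<noteq> 0" "c \<noteq> 0" by auto
    then show "gle v x z"
      using \<open>gle v x y \<and> gle v y z\<close> trans[of a b c] by (simp add: v_def le_rep)
  next
    fix x y assume "x \<in> carrier G" "y \<in> carrier G"
    then obtain a b where "x = cl a" "y = cl b" "a \<noteq> 0" "b \<noteq> 0" by auto
    then show "gle v x y \<or> gle v y x"
      using total[of a b] by (simp add: v_def le_rep)
  next
    fix x y assume xy: "x \<in> carrier G" "y \<in> carrier G" and "gle v x y \<and> gle v y x"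
    moreover from xy obtain a b where "x = cl a" "y = cl b" "a \<noteq> 0" "b \<noteq> 0" by auto
    ultimately show "x = y"
      by (simp del: G_sel add: v_def le_rep cl_eq)
  qed (use cG in \<open>auto simp: v_def\<close>)
  have "is_valuation v"
    unfolding is_valuation_def vle_v
  proof (intro conjI)
    show "\<forall>a b. le a (a + b) \<or> le b (a + b)"
      using total add refl by metis
  qed (use og in \<open>auto simp: v_def split: if_splits\<close>)
  moreover have "vrel v = le"
    by (intro ext) (simp add: vrel_def vle_v)
  ultimately show thesis using that by blast
qed

section \<open>Extensions and their equivalence\<close>

lemma const_1 [simp]: "const 1 = 1"
  by (simp add: const_def flip: one_pCons)

lemma const_simps [simp]: "const 0 = 0" "const (a + b) = const a + const b"
  "const (a - b) = const a - const b" "const (- a) = - const a" "const (a * b) = const a * const b"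
  "const a = const b \<longleftrightarrow> a = b" "const a = 0 \<longleftrightarrow> a = 0"
  by (simp_all add: const_def flip: to_fract_add to_fract_diff to_fract_uminus to_fract_mult)

lemma const_inverse [simp]: "const (inverse a) = inverse (const a)"
proof (cases "a = 0")
  case False
  then have "const (inverse a) * const a = 1" by (simp flip: const_simps(5))
  then show ?thesis using False by (simp add: field_simps)
qed simp

lemma const_divide [simp]: "const (a / b) = const a / const b"
  by (simp add: divide_inverse)

lemma const_power [simp]: "const (a ^ n) = const a ^ n"
  by (induction n) auto

locale valuation_extension =
  K: field_valuation le0 + L: field_valuation le
  for le0 :: "'a::field \<Rightarrow> 'a \<Rightarrow> bool" and le :: "'a poly fract \<Rightarrow> 'a poly fract \<Rightarrow> bool" +
  assumes const_le [simp]: "le (const a) (const b) \<longleftrightarrow> le0 a b"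

lemma extends_vrel:
  assumes "extends v0 v" and v0: "is_valuation v0"
  shows "vrel v (const a) (const b) \<longleftrightarrow> vrel v0 a b"
proof -
  from assms obtain \<iota> where "\<forall>\<alpha>\<in>carrier (vgroup v0). \<forall>\<beta>\<in>carrier (vgroup v0). gle v (\<iota> \<alpha>) (\<iota> \<beta>) \<longleftrightarrow> gle v0 \<alpha> \<beta>"
    "\<forall>c. val v (const c) = map_option \<iota> (val v0 c)"
    unfolding extends_def by blast
  then show ?thesis
    using is_valuationD(3)[OF v0, of a] is_valuationD(3)[OF v0, of b] unfolding vrel_def
    by (cases "val v0 a"; cases "val v0 b") auto
qed

text \<open>As every radius in \<open>v\<^sub>0K\<close> is the value of some \<open>c\<close> in \<open>K\<close>, this equation removes the embedding of
  value groups: the image of that radius is the value of \<open>const c\<close>.\<close>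

lemma vemb_val:
  assumes v0: "is_valuation v0" and "extends v0 v"
  shows "map_option (vemb v0 v) (val v0 c) = val v (const c)"
proof -
  from assms obtain \<iota> where \<iota>: "\<forall>c. val v (const c) = map_option \<iota> (val v0 c)"
    unfolding extends_def by blast
  show ?thesis
    using vemb_eq[OF v0 \<iota>] is_valuationD(3)[OF v0, of c] \<iota> by (cases "val v0 c") auto
qed

text \<open>A map of fields that preserves and reflects divisibility induces the map of value groups:
  a value is determined by any element that has it.\<close>

lemma value_group_map:
  assumes v: "is_valuation v" and w: "is_valuation w"
    and j_0: "j 0 = 0" and j_mult: "\<And>a b. j (a * b) = j a * j b"
    and j_le: "\<And>a b. vrel w (j a) (j b) \<longleftrightarrow> vrel v a b"
  obtains \<iota> where "\<iota> \<in> hom (vgroup v) (vgroup w)"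
    "\<And>\<alpha> \<beta>. \<alpha> \<in> carrier (vgroup v) \<Longrightarrow> \<beta> \<in> carrier (vgroup v) \<Longrightarrow> gle w (\<iota> \<alpha>) (\<iota> \<beta>) \<longleftrightarrow> gle v \<alpha> \<beta>"
    "\<And>c. val w (j c) = map_option \<iota> (val v c)"
proof -
  define r where "r = (\<lambda>\<gamma>. SOME c. val v c = Some \<gamma>)"
  define \<iota> where "\<iota> = (\<lambda>\<gamma>. the (val w (j (r \<gamma>))))"
  have r: "val v (r \<gamma>) = Some \<gamma>" if "\<gamma> \<in> carrier (vgroup v)" for \<gamma>
    unfolding r_def by (rule someI_ex) (rule is_valuationD(6)[OF v that])
  have val_eq: "val w (j a) = val w (j b) \<longleftrightarrow> val v a = val v b" for a b
    using vrel_eqv_iff[OF v, of a b] vrel_eqv_iff[OF w, of "j a" "j b"] by (simp add: j_le)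
  have j0: "j c = 0 \<longleftrightarrow> c = 0" for c
    using val_eq[of c 0] is_valuationD(2)[OF v, of c] is_valuationD(2)[OF w, of "j c"]
    by (simp add: j_0 val_0[OF v] val_0[OF w])
  have \<iota>: "val w (j c) = map_option \<iota> (val v c)" for c
  proof (cases "val v c")
    case None
    then show ?thesis using is_valuationD(2)[OF v, of c] j0[of c] val_0[OF w] by simp
  next
    case (Some \<gamma>)
    then have "\<gamma> \<in> carrier (vgroup v)" by (rule is_valuationD(3)[OF v])
    from r[OF this] Some have "val w (j c) = val w (j (r \<gamma>))" using val_eq[of c "r \<gamma>"] by simp
    moreover have "c \<noteq> 0" using Some val_0[OF v] by auto
    ultimately show ?thesis
      using val_SomeE[OF w, of "j c"] j0[of c] Some unfolding \<iota>_def by fastforce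
  qed
  have "\<iota> \<in> hom (vgroup v) (vgroup w)"
  proof (intro homI)
    fix x assume "x \<in> carrier (vgroup v)"
    then show "\<iota> x \<in> carrier (vgroup w)" using \<iota>[of "r x"] r is_valuationD(3)[OF w] by simp
    fix y assume "y \<in> carrier (vgroup v)"
    with \<open>x \<in> carrier (vgroup v)\<close>
    have xy: "val v (r x) = Some x" "val v (r y) = Some y" using r by auto
    then have "val v (r x * r y) = Some (x \<otimes>\<^bsub>vgroup v\<^esub> y)"
      by (rule is_valuationD(4)[OF v])
    moreover have "val w (j (r x) * j (r y)) = Some (\<iota> x \<otimes>\<^bsub>vgroup w\<^esub> \<iota> y)"
      by (rule is_valuationD(4)[OF w]) (simp_all add: \<iota> xy)
    ultimately show "\<iota> (x \<otimes>\<^bsub>vgroup v\<^esub> y) = \<iota> x \<otimes>\<^bsub>vgroup w\<^esub> \<iota> y"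
      using \<iota>[of "r x * r y"] by (simp add: j_mult)
  qed
  moreover have "gle w (\<iota> \<alpha>) (\<iota> \<beta>) \<longleftrightarrow> gle v \<alpha> \<beta>"
    if "\<alpha> \<in> carrier (vgroup v)" "\<beta> \<in> carrier (vgroup v)" for \<alpha> \<beta>
    using j_le[of "r \<alpha>" "r \<beta>"] by (simp add: vrel_def \<iota> r that)
  ultimately show thesis using that \<iota> by blast
qed

lemma extends_iff:
  assumes v0: "is_valuation v0"
  shows "extends v0 v \<longleftrightarrow> is_valuation v \<and> (\<forall>a b. vrel v (const a) (const b) \<longleftrightarrow> vrel v0 a b)"
proof (intro iffI conjI allI)
  assume a: "is_valuation v \<and> (\<forall>a b. vrel v (const a) (const b) \<longleftrightarrow> vrel v0 a b)"
  then have v: "is_valuation v" by blast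
  obtain \<iota> where "\<iota> \<in> hom (vgroup v0) (vgroup v)"
    "\<And>\<alpha> \<beta>. \<alpha> \<in> carrier (vgroup v0) \<Longrightarrow> \<beta> \<in> carrier (vgroup v0) \<Longrightarrow> gle v (\<iota> \<alpha>) (\<iota> \<beta>) \<longleftrightarrow> gle v0 \<alpha> \<beta>"
    "\<And>c. val v (const c) = map_option \<iota> (val v0 c)"
    using value_group_map[OF v0 v, of const] a const_simps(1,5) by metis
  then show "extends v0 v" unfolding extends_def using v by blast
qed (use extends_vrel[OF _ v0] in \<open>auto simp: extends_def\<close>)

lemma valuation_extensionI:
  assumes "is_valuation v0" "extends v0 v"
  shows "valuation_extension (vrel v0) (vrel v)"
  using assms field_valuation_vrel[of v0] field_valuation_vrel[of v] extends_iff[of v0 v]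
  unfolding valuation_extension_def valuation_extension_axioms_def by auto

text \<open>The isomorphism of value groups is the map of value groups induced by the identity of
  \<open>K(x)\<close>. It fixes \<open>v\<^sub>0K\<close> because it sends \<open>v f\<close> to \<open>w f\<close> for constant \<open>f\<close> as well.\<close>

lemma equiv_over_iff:
  assumes v0: "is_valuation v0" and v: "extends v0 v" and w: "extends v0 w"
  shows "equiv_over v0 v w \<longleftrightarrow> vrel v = vrel w"
proof
  have vv: "is_valuation v" and ww: "is_valuation w" using v w by (auto simp: extends_def)
  note in_G = is_valuationD(3)[OF vv]
  assume "equiv_over v0 v w"
  then obtain \<phi> where "\<forall>\<alpha>\<in>carrier (vgroup v). \<forall>\<beta>\<in>carrier (vgroup v). gle w (\<phi> \<alpha>) (\<phi> \<beta>) \<longleftrightarrow> gle v \<alpha> \<beta>"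
    "\<forall>f. val w f = map_option \<phi> (val v f)"
    unfolding equiv_over_def by blast
  then have "vrel v a b \<longleftrightarrow> vrel w a b" for a b
    using in_G unfolding vrel_def by (cases "val v a"; cases "val v b") auto
  then show "vrel v = vrel w" by blast
next
  have vv: "is_valuation v" and ww: "is_valuation w" using v w by (auto simp: extends_def)
  assume eq: "vrel v = vrel w"
  obtain \<phi> where hom: "\<phi> \<in> hom (vgroup v) (vgroup w)"
    and le: "\<And>\<alpha> \<beta>. \<alpha> \<in> carrier (vgroup v) \<Longrightarrow> \<beta> \<in> carrier (vgroup v) \<Longrightarrow> gle w (\<phi> \<alpha>) (\<phi> \<beta>) \<longleftrightarrow> gle v \<alpha> \<beta>"
    and \<phi>: "\<And>f. val w f = map_option \<phi> (val v f)"
    using value_group_map[OF vv ww, of "\<lambda>f. f"] eq by metis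
  note ogv = ordered_groupD[OF is_valuationD(1)[OF vv]] and ogw = ordered_groupD[OF is_valuationD(1)[OF ww]]
  have "bij_betw \<phi> (carrier (vgroup v)) (carrier (vgroup w))"
  proof (rule bij_betw_imageI)
    show "inj_on \<phi> (carrier (vgroup v))"
    proof (rule inj_onI)
      fix x y assume xy: "x \<in> carrier (vgroup v)" "y \<in> carrier (vgroup v)" "\<phi> x = \<phi> y"
      have "gle w (\<phi> x) (\<phi> x)" using ogw(2) hom xy(1) by (auto simp: hom_def)
      then show "x = y" using ogv(3)[OF xy(1,2)] le xy by metis
    qed
    show "\<phi> ` carrier (vgroup v) = carrier (vgroup w)"
    proof
      show "\<phi> ` carrier (vgroup v) \<subseteq> carrier (vgroup w)" using hom by (auto simp: hom_def)
      show "carrier (vgroup w) \<subseteq> \<phi> ` carrier (vgroup v)"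
      proof
        fix y assume "y \<in> carrier (vgroup w)"
        then obtain f where "val w f = Some y" using is_valuationD(6)[OF ww] by blast
        then show "y \<in> \<phi> ` carrier (vgroup v)" using \<phi>[of f] is_valuationD(3)[OF vv, of f] by auto
      qed
    qed
  qed
  then have "\<phi> \<in> iso (vgroup v) (vgroup w)" using hom by (simp add: iso_def)
  moreover have "\<phi> (vemb v0 v \<gamma>) = vemb v0 w \<gamma>" if "\<gamma> \<in> carrier (vgroup v0)" for \<gamma>
  proof -
    obtain c where c: "val v0 c = Some \<gamma>" using is_valuationD(6)[OF v0 \<open>\<gamma> \<in> _\<close>] by blast
    show ?thesis
      using vemb_val[OF v0 v, of c] vemb_val[OF v0 w, of c] \<phi>[of "const c"] c
      by (metis option.inject option.simps(9))
  qed
  ultimately show "equiv_over v0 v w"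
    unfolding equiv_over_def using \<phi> le by blast
qed

lemma extension_realised:
  fixes le :: "'a::field poly fract \<Rightarrow> 'a poly fract \<Rightarrow> bool"
  assumes v0: "is_valuation v0" and "valuation_extension (vrel v0) le"
  obtains v :: "('a poly fract, 'a poly fract set) valuation" where "extends v0 v" "vrel v = le"
proof -
  interpret valuation_extension "vrel v0" le by fact
  from field_valuation_realised[OF L.field_valuation_axioms] obtain v :: "('a poly fract, 'a poly fract set) valuation"
    where "is_valuation v" "vrel v = le" .
  then show thesis using that extends_iff[OF v0, of v] by simp
qed

section \<open>Evaluating polynomials over K in K(x)\<close>

definition peval :: "'a::field poly \<Rightarrow> 'a poly fract \<Rightarrow> 'a poly fract" where
  "peval p s = poly (map_poly const p) s"

lemma peval_0 [simp]: "peval 0 s = 0"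
  by (simp add: peval_def)

lemma peval_pCons [simp]: "peval (pCons a p) s = const a + s * peval p s"
  by (simp add: peval_def map_poly_pCons)

lemma peval_1 [simp]: "peval 1 s = 1"
  by (simp add: one_pCons del: pCons_one)

lemma peval_add [simp]: "peval (p + q) s = peval p s + peval q s"
proof -
  have "map_poly const (p + q) = map_poly const p + map_poly const q"
    by (intro poly_eqI) (simp add: coeff_map_poly)
  then show ?thesis by (simp add: peval_def)
qed

lemma peval_smult [simp]: "peval (smult c p) s = const c * peval p s"
  by (induction p) (simp_all add: algebra_simps)

lemma peval_mult [simp]: "peval (p * q) s = peval p s * peval q s"
  by (induction p) (simp_all add: algebra_simps)

lemma peval_monom [simp]: "peval (monom c n) s = const c * s ^ n"
  by (induction n) (simp_all add: monom_0 monom_Suc algebra_simps)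

lemma peval_pcompose: "peval (pcompose p q) s = peval p (peval q s)"
  by (induction p) (simp_all add: pcompose_pCons)

lemma peval_const [simp]: "peval p (const c) = const (poly p c)"
  by (induction p) simp_all

lemma peval_var_x: "peval p var_x = to_fract p"
proof (induction p)
  case (pCons a p)
  have "pCons a p = [:a:] + [:0, 1:] * p" by simp
  then show ?case
    using pCons.IH by (simp add: const_def var_x_def flip: to_fract_add to_fract_mult)
qed simp

lemma peval_altdef: "peval p s = (\<Sum>i\<le>degree p. const (coeff p i) * s ^ i)"
proof -
  have "degree (map_poly const p) = degree p" by (rule degree_map_poly) simp
  then show ?thesis by (simp add: peval_def poly_altdef coeff_map_poly)
qed

lemma to_fract_shift: "to_fract g = peval (pcompose g [:b, 1:]) (var_x - const b)"
  by (simp add: peval_pcompose flip: peval_var_x)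

lemma peval_shift: "peval g (var_x - const b) = to_fract (pcompose g [:- b, 1:])"
  by (simp add: peval_pcompose flip: peval_var_x)

section \<open>The value group of an extension\<close>

lemma base_group_eq:
  assumes v0: "is_valuation v0" and v: "extends v0 v"
  shows "base_group v0 v = {\<alpha>. \<exists>c. val v (const c) = Some \<alpha>}"
proof -
  have vv: "is_valuation v" using v by (simp add: extends_def)
  show ?thesis
  proof (intro equalityI subsetI)
    fix \<alpha> assume "\<alpha> \<in> base_group v0 v"
    then obtain \<gamma> where "\<gamma> \<in> carrier (vgroup v0)" "\<alpha> = vemb v0 v \<gamma>"
      unfolding base_group_def by auto
    moreover from this obtain c where "val v0 c = Some \<gamma>" using is_valuationD(6)[OF v0] by blast
    ultimately show "\<alpha> \<in> {\<alpha>. \<exists>c. val v (const c) = Some \<alpha>}"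
      using vemb_val[OF v0 v, of c] by (auto intro!: exI[of _ c])
  next
    fix \<alpha> assume "\<alpha> \<in> {\<alpha>. \<exists>c. val v (const c) = Some \<alpha>}"
    then obtain c where c: "val v (const c) = Some \<alpha>" by blast
    then obtain \<gamma> where "val v0 c = Some \<gamma>" "vemb v0 v \<gamma> = \<alpha>"
      using vemb_val[OF v0 v, of c] by (cases "val v0 c") auto
    then show "\<alpha> \<in> base_group v0 v"
      unfolding base_group_def using is_valuationD(3)[OF v0, of c] by auto
  qed
qed

lemma subgroup_base_group:
  assumes v0: "is_valuation v0" and v: "extends v0 v"
  shows "subgroup (base_group v0 v) (vgroup v)"
proof -
  have vv: "is_valuation v" using v by (simp add: extends_def)
  interpret G: comm_group "vgroup v" using ordered_groupD(1)[OF is_valuationD(1)[OF vv]] .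
  show ?thesis
    unfolding base_group_eq[OF assms]
  proof (rule G.subgroupI)
    show "{\<alpha>. \<exists>c. val v (const c) = Some \<alpha>} \<subseteq> carrier (vgroup v)"
      using is_valuationD(3)[OF vv] by blast
    have "val v (const 1) = Some \<one>\<^bsub>vgroup v\<^esub>" using val_1[OF vv] by simp
    then show "{\<alpha>. \<exists>c. val v (const c) = Some \<alpha>} \<noteq> {}" by blast
    fix a assume "a \<in> {\<alpha>. \<exists>c. val v (const c) = Some \<alpha>}"
    then obtain c where c: "val v (const c) = Some a" by blast
    show "inv\<^bsub>vgroup v\<^esub> a \<in> {\<alpha>. \<exists>c. val v (const c) = Some \<alpha>}"
      using val_inverse[OF vv c] by (auto intro!: exI[of _ "inverse c"])
    fix b assume "b \<in> {\<alpha>. \<exists>c. val v (const c) = Some \<alpha>}"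
    then obtain d where d: "val v (const d) = Some b" by blast
    show "a \<otimes>\<^bsub>vgroup v\<^esub> b \<in> {\<alpha>. \<exists>c. val v (const c) = Some \<alpha>}"
      using is_valuationD(4)[OF vv c d] by (auto intro!: exI[of _ "c * d"])
  qed
qed

lemma value_transcendental_iff:
  assumes v0: "is_valuation v0" and v: "extends v0 v"
  shows "value_transcendental v0 v t \<longleftrightarrow>
    t \<noteq> 0 \<and> (\<forall>n>0. \<forall>c. \<not> (vrel v (t ^ n) (const c) \<and> vrel v (const c) (t ^ n)))"
proof -
  have vv: "is_valuation v" using v by (simp add: extends_def)
  have "(\<forall>c. val v (t ^ n) \<noteq> val v (const c)) \<longleftrightarrow> \<tau> [^]\<^bsub>vgroup v\<^esub> n \<notin> base_group v0 v"
    if "val v t = Some \<tau>" for \<tau> and n :: nat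
    unfolding base_group_eq[OF assms] val_power[OF vv that] by (auto simp: eq_commute)
  then show ?thesis
    unfolding vrel_eqv_iff[OF vv] value_transcendental_def
    using is_valuationD(2)[OF vv, of t] by (cases "val v t") auto
qed

lemma base_group_eq_carrier_iff:
  fixes v :: "('a::field poly fract, 'g) valuation"
  assumes v0: "is_valuation v0" and v: "extends v0 v"
  shows "base_group v0 v = carrier (vgroup v) \<longleftrightarrow>
    (\<forall>u. u \<noteq> 0 \<longrightarrow> (\<exists>c. vrel v u (const c) \<and> vrel v (const c) u))"
proof -
  have vv: "is_valuation v" using v by (simp add: extends_def)
  show ?thesis
    unfolding vrel_eqv_iff[OF vv] base_group_eq[OF assms]
  proof (intro iffI allI impI)
    fix u :: "'a poly fract"
    assume a: "{\<alpha>. \<exists>c. val v (const c) = Some \<alpha>} = carrier (vgroup v)" "u \<noteq> 0"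
    then obtain \<alpha> where "val v u = Some \<alpha>" "\<alpha> \<in> carrier (vgroup v)" using val_SomeE[OF vv] by blast
    moreover from this a obtain c where "val v (const c) = Some \<alpha>" by blast
    ultimately show "\<exists>c. val v u = val v (const c)" by metis
  next
    assume a: "\<forall>u :: 'a poly fract. u \<noteq> 0 \<longrightarrow> (\<exists>c. val v u = val v (const c))"
    show "{\<alpha>. \<exists>c. val v (const c) = Some \<alpha>} = carrier (vgroup v)"
    proof (intro equalityI subsetI)
      fix \<alpha> assume "\<alpha> \<in> carrier (vgroup v)"
      then obtain u where u: "val v u = Some \<alpha>" using is_valuationD(6)[OF vv] by blast
      then have "u \<noteq> 0" using val_0[OF vv] by auto
      then show "\<alpha> \<in> {\<alpha>. \<exists>c. val v (const c) = Some \<alpha>}" using a u by force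
    qed (use is_valuationD(3)[OF vv] in blast)
  qed
qed

lemma rationally_independentD:
  assumes "rationally_independent H B"
  shows "B \<subseteq> carrier H"
    and "finite S \<Longrightarrow> S \<subseteq> B \<Longrightarrow> finprod H (\<lambda>b. b [^]\<^bsub>H\<^esub> (n b :: int)) S = \<one>\<^bsub>H\<^esub> \<Longrightarrow> b \<in> S \<Longrightarrow> n b = 0"
  using assms[unfolded rationally_independent_def] by simp_all

lemma (in comm_group) trivial_rational_rank:
  assumes "carrier G = {\<one>}"
  shows "\<not> has_rational_rank G 1"
proof
  assume "has_rational_rank G 1"
  then obtain B where cB: "card B = 1" and rB: "rationally_independent G B"
    unfolding has_rational_rank_def by blast
  from cB obtain b where b: "B = {b}" by (rule card_1_singletonE)
  have "b = \<one>" using rationally_independentD(1)[OF rB] assms b by simp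
  then show False using rationally_independentD(2)[OF rB, of "{\<one>}" "\<lambda>_. 1" \<one>] b by simp
qed

text \<open>A relation \<open>g w^n = w^m\<close> gives \<open>g\<close> the exponent \<open>1\<close>, so no independent set
  contains anything besides \<open>w\<close>.\<close>

lemma (in comm_group) rational_rank_one:
  assumes w: "w \<in> carrier G" "\<And>n::nat. n > 0 \<Longrightarrow> w [^] n \<noteq> \<one>"
    and gen: "\<And>g. g \<in> carrier G \<Longrightarrow> \<exists>(n::nat) (m::nat). g \<otimes> w [^] n = w [^] m"
  shows "has_rational_rank G 1"
  unfolding has_rational_rank_def
proof (intro exI conjI allI impI)
  have w_int: "n = 0" if n: "w [^] (n::int) = \<one>" for n
  proof (cases n rule: int_cases2)
    case (nonneg k)
    then have "w [^] k = \<one>" using n int_pow_int[of G w k] by metis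
    then show ?thesis using w(2)[of k] nonneg by (cases "k = 0") auto
  next
    case (nonpos k)
    then have "inv (w [^] k) = \<one>" using n int_pow_neg_int[OF w(1), of k] by metis
    then have "w [^] k = \<one>" using inv_inv[of "w [^] k"] w(1) by (metis inv_one nat_pow_closed)
    then show ?thesis using w(2)[of k] nonpos by (cases "k = 0") auto
  qed
  show "finite {w}" "card {w} = 1" by simp_all
  show "rationally_independent G {w}"
    unfolding rationally_independent_def
  proof (intro conjI allI impI)
    fix S and n :: "'a \<Rightarrow> int"
    assume S: "finite S \<and> S \<subseteq> {w} \<and> (\<Otimes>b\<in>S. b [^] n b) = \<one>"
    show "\<forall>b\<in>S. n b = 0"
    proof (cases "S = {}")
      case False
      then have "S = {w}" using S by blast
      then show ?thesis using S w(1) w_int by simp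
    qed simp
  qed (use w in simp)
  fix B' assume B': "rationally_independent G B' \<and> {w} \<subseteq> B'"
  show "B' = {w}"
  proof (rule ccontr)
    assume "B' \<noteq> {w}"
    then obtain b where b: "b \<in> B'" "b \<noteq> w" using B' by blast
    then have b_in: "b \<in> carrier G" using B' rationally_independentD(1)[of G B'] by blast
    obtain n m :: nat where nm: "b \<otimes> w [^] n = w [^] m" using gen[OF b_in] by blast
    define N where "N = (\<lambda>c. if c = b then 1 else int n - int m)"
    have "(\<Otimes>c\<in>{b, w}. c [^] N c) = b \<otimes> (w [^] (int n - int m))"
      using b b_in w(1) by (simp add: N_def)
    also have "\<dots> = \<one>"
    proof -
      have "w [^] (int n - int m) = w [^] n \<otimes> inv (w [^] m)"
        using w(1) by (simp add: int_pow_diff int_pow_int)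
      then show ?thesis using nm b_in w(1) by (simp flip: m_assoc)
    qed
    finally have "N b = 0"
      by (intro rationally_independentD(2)[OF conjunct1[OF B'], of "{b, w}"]) (use B' b in auto)
    then show False by (simp add: N_def)
  qed
qed

text \<open>The powers of \<open>t\<close> stand on both sides so that all exponents can be natural numbers.\<close>

lemma value_transcendental_extI:
  assumes v0: "is_valuation v0" and v: "extends v0 v" and t: "value_transcendental v0 v t"
    and gen: "\<And>u. u \<noteq> 0 \<Longrightarrow> \<exists>c m n. vrel v (u * t ^ n) (const c * t ^ m) \<and> vrel v (const c * t ^ m) (u * t ^ n)"
  shows "value_transcendental_ext v0 v"
proof -
  let ?G = "vgroup v" and ?H = "base_group v0 v"
  let ?Q = "?G Mod ?H"
  have vv: "is_valuation v" using v by (simp add: extends_def)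
  interpret G: comm_group "?G" using ordered_groupD(1)[OF is_valuationD(1)[OF vv]] .
  have sub: "subgroup (?H) (?G)" using subgroup_base_group[OF v0 v] .
  interpret N: normal "?H" "?G"
    using sub by (simp add: G.normal_iff_subgroup)
  interpret Q: comm_group "?Q" using G.abelian_FactGroup[OF sub] .
  obtain \<tau> where \<tau>: "val v t = Some \<tau>" "\<And>n::nat. n > 0 \<Longrightarrow> \<tau> [^]\<^bsub>?G\<^esub> n \<notin> ?H"
    using t unfolding value_transcendental_def by blast
  have \<tau>_in: "\<tau> \<in> carrier (?G)" using is_valuationD(3)[OF vv \<tau>(1)] .
  have Q_carrier: "?H #>\<^bsub>?G\<^esub> g \<in> carrier (?Q)"
    if "g \<in> carrier (?G)" for g
    using that by (simp add: carrier_FactGroup)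
  have Q_mult: "(?H #>\<^bsub>?G\<^esub> g) \<otimes>\<^bsub>?Q\<^esub> (?H #>\<^bsub>?G\<^esub> h)
      = ?H #>\<^bsub>?G\<^esub> (g \<otimes>\<^bsub>?G\<^esub> h)"
    if "g \<in> carrier (?G)" "h \<in> carrier (?G)" for g h
    using that by (simp add: N.rcos_sum)
  show ?thesis
    unfolding value_transcendental_ext_def
  proof (rule Q.rational_rank_one[of "?H #>\<^bsub>?G\<^esub> \<tau>"])
    show "?H #>\<^bsub>?G\<^esub> \<tau> \<in> carrier (?Q)"
      using Q_carrier[OF \<tau>_in] .
    fix n :: nat assume "n > 0"
    have "?H #>\<^bsub>?G\<^esub> (\<tau> [^]\<^bsub>?G\<^esub> n) \<noteq> ?H"
      using \<tau>(2)[OF \<open>n > 0\<close>] G.coset_join1[OF _ _ sub] \<tau>_in N.subset by blast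
    then show "(?H #>\<^bsub>?G\<^esub> \<tau>) [^]\<^bsub>?Q\<^esub> n \<noteq> \<one>\<^bsub>?Q\<^esub>"
      by (simp add: N.FactGroup_pow \<tau>_in)
  next
    fix Y assume "Y \<in> carrier (?Q)"
    then obtain g where g: "g \<in> carrier (?G)" "Y = ?H #>\<^bsub>?G\<^esub> g"
      by (auto simp: carrier_FactGroup)
    obtain u where u: "val v u = Some g" using is_valuationD(6)[OF vv g(1)] by blast
    then have "u \<noteq> 0" using val_0[OF vv] by auto
    then obtain c m n where "val v (u * t ^ n) = val v (const c * t ^ m)"
      using gen[of u] unfolding vrel_eqv_iff[OF vv] by blast
    moreover have ug: "val v (u * t ^ n) = Some (g \<otimes>\<^bsub>?G\<^esub> \<tau> [^]\<^bsub>?G\<^esub> n)"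
      using is_valuationD(4)[OF vv u val_power[OF vv \<tau>(1)]] .
    ultimately have "val v (const c * t ^ m) = Some (g \<otimes>\<^bsub>?G\<^esub> \<tau> [^]\<^bsub>?G\<^esub> n)" by simp
    then have "const c * t ^ m \<noteq> 0" using is_valuationD(2)[OF vv, of "const c * t ^ m"] by simp
    then obtain \<gamma> where c: "val v (const c) = Some \<gamma>" "\<gamma> \<in> carrier (?G)"
      using val_SomeE[OF vv, of "const c"] by auto
    have eq: "g \<otimes>\<^bsub>?G\<^esub> \<tau> [^]\<^bsub>?G\<^esub> n = \<gamma> \<otimes>\<^bsub>?G\<^esub> \<tau> [^]\<^bsub>?G\<^esub> m"
      using is_valuationD(4)[OF vv c(1) val_power[OF vv \<tau>(1), of m]] ug
        \<open>val v (u * t ^ n) = val v (const c * t ^ m)\<close> by simp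
    have \<gamma>: "\<gamma> \<in> ?H" using c(1) unfolding base_group_eq[OF v0 v] by blast
    have "?H #>\<^bsub>?G\<^esub> (g \<otimes>\<^bsub>?G\<^esub> \<tau> [^]\<^bsub>?G\<^esub> n)
        = ?H #>\<^bsub>?G\<^esub> (\<tau> [^]\<^bsub>?G\<^esub> m)"
      unfolding eq using \<tau>_in c(2) \<gamma> N.rcos_const sub
      by (simp add: G.coset_mult_assoc[symmetric] N.subset)
    then have "Y \<otimes>\<^bsub>?Q\<^esub> (?H #>\<^bsub>?G\<^esub> \<tau>) [^]\<^bsub>?Q\<^esub> n =
        (?H #>\<^bsub>?G\<^esub> \<tau>) [^]\<^bsub>?Q\<^esub> m"
      using g \<tau>_in by (simp add: N.FactGroup_pow Q_mult del: mult_FactGroup)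
    then show "\<exists>(n::nat) (m::nat). Y \<otimes>\<^bsub>?Q\<^esub> (?H #>\<^bsub>?G\<^esub> \<tau>) [^]\<^bsub>?Q\<^esub> n =
        (?H #>\<^bsub>?G\<^esub> \<tau>) [^]\<^bsub>?Q\<^esub> m"
      by blast
  qed
qed

lemma not_value_transcendental_ext:
  assumes v0: "is_valuation v0" and v: "extends v0 v" and eq: "base_group v0 v = carrier (vgroup v)"
  shows "\<not> value_transcendental_ext v0 v"
proof -
  have vv: "is_valuation v" using v by (simp add: extends_def)
  interpret G: comm_group "vgroup v" using ordered_groupD(1)[OF is_valuationD(1)[OF vv]] .
  have sub: "subgroup (carrier (vgroup v)) (vgroup v)" by (rule G.subgroup_self)
  interpret Q: comm_group "vgroup v Mod carrier (vgroup v)" using G.abelian_FactGroup[OF sub] .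
  have "carrier (vgroup v Mod carrier (vgroup v)) = {\<one>\<^bsub>vgroup v Mod carrier (vgroup v)\<^esub>}"
    using G.coset_join2[OF _ sub] G.one_closed by (auto simp: carrier_FactGroup image_iff)
  then show ?thesis
    unfolding value_transcendental_ext_def eq by (rule Q.trivial_rational_rank)
qed

section \<open>The residue field\<close>

lemma val_ring_simps [simp]:
  "x \<otimes>\<^bsub>val_ring v\<^esub> y = x * y" "x \<oplus>\<^bsub>val_ring v\<^esub> y = x + y" "\<one>\<^bsub>val_ring v\<^esub> = 1" "\<zero>\<^bsub>val_ring v\<^esub> = 0"
  by (simp_all add: val_ring_def)

lemma cring_val_ring:
  assumes v: "is_valuation v"
  shows "cring (val_ring v)"
proof -
  interpret field_valuation "vrel v" using field_valuation_vrel[OF v] .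
  note [simp] = carrier_val_ring[OF v]
  show ?thesis
  proof (intro cringI abelian_groupI comm_monoidI)
    fix x y assume "x \<in> carrier (val_ring v)" "y \<in> carrier (val_ring v)"
    then show "x \<otimes>\<^bsub>val_ring v\<^esub> y \<in> carrier (val_ring v)"
      using mult_mono[of 1 x 1 y] by simp
  next
    fix x assume "x \<in> carrier (val_ring v)"
    then show "\<exists>y\<in>carrier (val_ring v). y \<oplus>\<^bsub>val_ring v\<^esub> x = \<zero>\<^bsub>val_ring v\<^esub>"
      by (intro bexI[of _ "- x"]) simp_all
  qed (simp_all add: zero add algebra_simps)
qed

lemma val_ring_diff:
  assumes v: "is_valuation v" and x: "x \<in> carrier (val_ring v)" "y \<in> carrier (val_ring v)"
  shows "x \<ominus>\<^bsub>val_ring v\<^esub> y = x - y"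
proof -
  interpret field_valuation "vrel v" using field_valuation_vrel[OF v] .
  interpret R: cring "val_ring v" using cring_val_ring[OF v] .
  have "\<ominus>\<^bsub>val_ring v\<^esub> y = - y"
    by (rule R.minus_equality) (use x in \<open>simp_all add: carrier_val_ring[OF v]\<close>)
  then show ?thesis by (simp add: R.minus_eq)
qed

lemma maximalideal_max_ideal:
  assumes v: "is_valuation v"
  shows "maximalideal (max_ideal v) (val_ring v)"
proof -
  interpret field_valuation "vrel v" using field_valuation_vrel[OF v] .
  interpret R: cring "val_ring v" using cring_val_ring[OF v] .
  note [simp] = carrier_val_ring[OF v] max_ideal_eq[OF v]
  have id: "ideal (max_ideal v) (val_ring v)"
  proof (rule idealI[OF R.ring_axioms])
    show "subgroup (max_ideal v) (add_monoid (val_ring v))"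
    proof (rule R.add.subgroupI)
      show "max_ideal v \<subseteq> carrier (val_ring v)" using lt_imp_le by auto
      have "0 \<in> max_ideal v" by simp
      then show "max_ideal v \<noteq> {}" by blast
      fix a assume a: "a \<in> max_ideal v"
      then have "\<ominus>\<^bsub>val_ring v\<^esub> a = - a"
        by (intro R.minus_equality) (use lt_imp_le in simp_all)
      then show "\<ominus>\<^bsub>val_ring v\<^esub> a \<in> max_ideal v" using a by simp
      fix b assume "b \<in> max_ideal v"
      then show "a \<oplus>\<^bsub>val_ring v\<^esub> b \<in> max_ideal v" using a add_lt by simp
    qed
    fix a x assume "a \<in> max_ideal v" "x \<in> carrier (val_ring v)"
    then show "x \<otimes>\<^bsub>val_ring v\<^esub> a \<in> max_ideal v"
      using mult_le_lt[where a = 1 and b = x and c = 1 and d = a] by simp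
    then show "a \<otimes>\<^bsub>val_ring v\<^esub> x \<in> max_ideal v" by (simp add: mult.commute)
  qed
  show ?thesis
  proof (rule maximalidealI[OF id])
    have "1 \<in> carrier (val_ring v)" "1 \<notin> max_ideal v" by simp_all
    then show "carrier (val_ring v) \<noteq> max_ideal v" by blast
    fix J assume J: "ideal J (val_ring v)" "max_ideal v \<subseteq> J" "J \<subseteq> carrier (val_ring v)"
    interpret J: ideal J "val_ring v" by fact
    show "J = max_ideal v \<or> J = carrier (val_ring v)"
    proof (cases "J = max_ideal v")
      case False
      then obtain u where u: "u \<in> J" "vrel v u 1" "vrel v 1 u" using J(2,3) by auto
      then have u0: "u \<noteq> 0" by auto
      then have "vrel v 1 (1 / u)" using le_divide_iff[of u 1 1] u(2) by simp
      then have "(1 / u) \<otimes>\<^bsub>val_ring v\<^esub> u \<in> J" using J.I_l_closed[OF u(1), of "1 / u"] by simp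
      then have "1 \<in> J" using u0 by simp
      then show ?thesis using J.one_imp_carrier by simp
    qed simp
  qed
qed

lemma field_residue_field: "is_valuation v \<Longrightarrow> field (residue_field v)"
  unfolding residue_field_def
  using maximalideal.quotient_is_field[OF maximalideal_max_ideal cring_val_ring] by blast

lemma residue_hom:
  assumes v: "is_valuation v"
  shows "ring_hom_ring (val_ring v) (residue_field v) (residue v)"
proof -
  interpret I: maximalideal "max_ideal v" "val_ring v" using maximalideal_max_ideal[OF v] .
  show ?thesis
    using I.rcos_ring_hom_ring unfolding residue_field_def residue_def by (simp add: eta_contract_eq)
qed

lemma carrier_residue_field: "carrier (residue_field v) = residue v ` carrier (val_ring v)"
  by (auto simp: residue_field_def residue_def FactRing_def A_RCOSETS_def' )

lemma residue_eq_iff: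
  assumes v: "is_valuation v" and "vrel v 1 a" "vrel v 1 b"
  shows "residue v a = residue v b \<longleftrightarrow> \<not> vrel v (a - b) 1"
proof -
  interpret I: maximalideal "max_ideal v" "val_ring v" using maximalideal_max_ideal[OF v] .
  show ?thesis
    using I.quotient_eq_iff_same_a_r_cos[OF I.ideal_axioms, of a b] assms
      val_ring_diff[OF v, of a b]
    by (simp add: residue_def carrier_val_ring[OF v] max_ideal_eq[OF v])
qed

lemma residue_zero_iff:
  assumes v: "is_valuation v" and "vrel v 1 a"
  shows "residue v a = \<zero>\<^bsub>residue_field v\<^esub> \<longleftrightarrow> \<not> vrel v a 1"
proof -
  interpret field_valuation "vrel v" using field_valuation_vrel[OF v] .
  interpret H: ring_hom_ring "val_ring v" "residue_field v" "residue v" using residue_hom[OF v] .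
  show ?thesis using residue_eq_iff[OF assms, of 0] H.hom_zero zero by simp
qed

lemma base_residues_eq:
  assumes v0: "is_valuation v0" and v: "extends v0 v"
  shows "base_residues v0 v = {residue v (const c) |c. vrel v0 1 c}"
  unfolding base_residues_def carrier_val_ring[OF v0] by blast

lemma subring_base_residues:
  assumes v0: "is_valuation v0" and v: "extends v0 v"
  shows "subring (base_residues v0 v) (residue_field v)"
proof -
  have vv: "is_valuation v" using v by (simp add: extends_def)
  interpret E: valuation_extension "vrel v0" "vrel v" using valuation_extensionI[OF v0 v] .
  interpret F: field "residue_field v" using field_residue_field[OF vv] .
  interpret H: ring_hom_ring "val_ring v" "residue_field v" "residue v" using residue_hom[OF vv] .
  have in_ring: "const c \<in> carrier (val_ring v)" if "vrel v0 1 c" for c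
    using E.const_le[of 1 c] that by (simp add: carrier_val_ring[OF vv])
  show ?thesis
    unfolding base_residues_eq[OF assms]
  proof (rule F.subringI)
    show "{residue v (const c) |c. vrel v0 1 c} \<subseteq> carrier (residue_field v)"
      using in_ring by auto
    show "\<one>\<^bsub>residue_field v\<^esub> \<in> {residue v (const c) |c. vrel v0 1 c}"
    proof (intro CollectI exI conjI)
      show "\<one>\<^bsub>residue_field v\<^esub> = residue v (const 1)" using H.hom_one by simp
    qed simp
    fix h assume "h \<in> {residue v (const c) |c. vrel v0 1 c}"
    then obtain c where c: "vrel v0 1 c" "h = residue v (const c)" by blast
    have "\<ominus>\<^bsub>val_ring v\<^esub> const c = - const c"
      using val_ring_diff[OF vv H.R.zero_closed in_ring[OF c(1)]] in_ring[OF c(1)] by (simp add: H.R.minus_eq)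
    then have "\<ominus>\<^bsub>residue_field v\<^esub> h = residue v (const (- c))"
      using H.hom_a_inv[OF in_ring[OF c(1)]] c(2) by simp
    then show "\<ominus>\<^bsub>residue_field v\<^esub> h \<in> {residue v (const c) |c. vrel v0 1 c}"
      using c(1) by (intro CollectI exI[of _ "- c"]) simp
    fix g assume "g \<in> {residue v (const c) |c. vrel v0 1 c}"
    then obtain d where d: "vrel v0 1 d" "g = residue v (const d)" by blast
    show "h \<otimes>\<^bsub>residue_field v\<^esub> g \<in> {residue v (const c) |c. vrel v0 1 c}"
      using H.hom_mult[OF in_ring in_ring, OF c(1) d(1)] c d E.K.mult_mono[of 1 c 1 d]
      by (intro CollectI exI[of _ "c * d"]) simp
    show "h \<oplus>\<^bsub>residue_field v\<^esub> g \<in> {residue v (const c) |c. vrel v0 1 c}"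
      using H.hom_add[OF in_ring in_ring, OF c(1) d(1)] c d E.K.add[of 1 c d]
      by (intro CollectI exI[of _ "c + d"]) simp
  qed
qed

lemma base_residues_eq_carrier_iff:
  assumes v0: "is_valuation v0" and v: "extends v0 v"
  shows "base_residues v0 v = carrier (residue_field v) \<longleftrightarrow>
    (\<forall>u. vrel v 1 u \<longrightarrow> (\<exists>c. vrel v0 1 c \<and> \<not> vrel v (u - const c) 1))"
proof -
  have vv: "is_valuation v" using v by (simp add: extends_def)
  interpret E: valuation_extension "vrel v0" "vrel v" using valuation_extensionI[OF v0 v] .
  have in_ring: "const c \<in> carrier (val_ring v) \<longleftrightarrow> vrel v0 1 c" for c
    using E.const_le[of 1 c] by (simp add: carrier_val_ring[OF vv])
  have eq: "residue v u = residue v (const c) \<longleftrightarrow> \<not> vrel v (u - const c) 1"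
    if "vrel v 1 u" "vrel v0 1 c" for u c
    using residue_eq_iff[OF vv that(1), of "const c"] in_ring[of c] that(2) by (simp add: carrier_val_ring[OF vv])
  have "base_residues v0 v \<subseteq> carrier (residue_field v)"
    using in_ring by (auto simp: base_residues_eq[OF assms] carrier_residue_field)
  then have "base_residues v0 v = carrier (residue_field v) \<longleftrightarrow>
      carrier (residue_field v) \<subseteq> base_residues v0 v"
    by blast
  also have "\<dots> \<longleftrightarrow> (\<forall>u. vrel v 1 u \<longrightarrow> residue v u \<in> base_residues v0 v)"
    by (simp add: carrier_residue_field carrier_val_ring[OF vv] image_subset_iff)
  also have "\<dots> \<longleftrightarrow> (\<forall>u. vrel v 1 u \<longrightarrow> (\<exists>c. vrel v0 1 c \<and> residue v u = residue v (const c)))"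
    by (simp add: base_residues_eq[OF assms] conj_commute)
  also have "\<dots> \<longleftrightarrow> (\<forall>u. vrel v 1 u \<longrightarrow> (\<exists>c. vrel v0 1 c \<and> \<not> vrel v (u - const c) 1))"
    using eq by (simp cong: conj_cong imp_cong)
  finally show ?thesis .
qed

text \<open>Polynomials over the residue field are lists with the leading coefficient first, so a list
  \<open>cs\<close> of lifts to \<open>K\<close> corresponds to the polynomial \<open>Poly (rev cs)\<close>.\<close>

lemma residue_peval:
  assumes v0: "is_valuation v0" and v: "extends v0 v" and s: "vrel v 1 s"
    and cs: "\<And>c. c \<in> set cs \<Longrightarrow> vrel v0 1 c"
  shows "vrel v 1 (peval (Poly (rev cs)) s)"
    and "ring.eval (residue_field v) (map (\<lambda>c. residue v (const c)) cs) (residue v s)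
       = residue v (peval (Poly (rev cs)) s)"
proof -
  have vv: "is_valuation v" using v by (simp add: extends_def)
  interpret E: valuation_extension "vrel v0" "vrel v" using valuation_extensionI[OF v0 v] .
  interpret F: field "residue_field v" using field_residue_field[OF vv] .
  interpret H: ring_hom_ring "val_ring v" "residue_field v" "residue v" using residue_hom[OF vv] .
  have in_ring: "const c \<in> carrier (val_ring v) \<longleftrightarrow> vrel v0 1 c" for c
    using E.const_le[of 1 c] by (simp add: carrier_val_ring[OF vv])
  have s_in: "s \<in> carrier (val_ring v)" using s by (simp add: carrier_val_ring[OF vv])
  have pow: "s [^]\<^bsub>val_ring v\<^esub> (n::nat) = s ^ n" for n
    by (induction n) (simp_all add: mult.commute)
  have *: "vrel v 1 (peval (Poly (rev cs)) s) \<and>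
    F.eval (map (\<lambda>c. residue v (const c)) cs) (residue v s) = residue v (peval (Poly (rev cs)) s)"
    using cs
  proof (induction cs)
    case Nil
    then show ?case using H.hom_zero E.L.zero by simp
  next
    case (Cons a cs)
    have "Poly (rev (a # cs)) = Poly (rev cs) + monom a (length cs)"
      by (simp add: Poly_append mult_monom flip: monom_0)
    then have eq: "peval (Poly (rev (a # cs))) s = peval (Poly (rev cs)) s + const a * s ^ length cs"
      by simp
    have a: "const a \<in> carrier (val_ring v)" using Cons.prems in_ring by simp
    have IH: "peval (Poly (rev cs)) s \<in> carrier (val_ring v)"
      "F.eval (map (\<lambda>c. residue v (const c)) cs) (residue v s) = residue v (peval (Poly (rev cs)) s)"
      using Cons by (auto simp: carrier_val_ring[OF vv])
    have sn: "s ^ n \<in> carrier (val_ring v)" for n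
      using H.R.nat_pow_closed[OF s_in] by (simp add: pow)
    have asn: "const a * s ^ n \<in> carrier (val_ring v)" for n
      using H.R.m_closed[OF a sn] by simp
    have "residue v s [^]\<^bsub>residue_field v\<^esub> n = residue v (s ^ n)" for n :: nat
      using H.hom_nat_pow[OF s_in, of n] by (simp add: pow)
    then have "residue v (const a) \<otimes>\<^bsub>residue_field v\<^esub> (residue v s [^]\<^bsub>residue_field v\<^esub> length cs)
        = residue v (const a * s ^ length cs)"
      using H.hom_mult[OF a sn] by simp
    then have "F.eval (map (\<lambda>c. residue v (const c)) (a # cs)) (residue v s) =
        residue v (const a * s ^ length cs) \<oplus>\<^bsub>residue_field v\<^esub> residue v (peval (Poly (rev cs)) s)"
      using IH(2) by simp
    also have "\<dots> = residue v (const a * s ^ length cs + peval (Poly (rev cs)) s)"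
      using H.hom_add[OF asn IH(1)] by simp
    finally show ?case
      using H.R.add.m_closed[OF asn IH(1), of "length cs"] eq
      by (simp add: carrier_val_ring[OF vv] add.commute)
  qed
  then show "vrel v 1 (peval (Poly (rev cs)) s)"
    and "ring.eval (residue_field v) (map (\<lambda>c. residue v (const c)) cs) (residue v s)
       = residue v (peval (Poly (rev cs)) s)" by blast+
qed

text \<open>A polynomial relation for the residue of \<open>s\<close> is the reduction of a polynomial \<open>p\<close> with integral
  coefficients and \<open>v (p s) > 0\<close>, and the reduction vanishes iff all coefficients of \<open>p\<close> have positive
  value. This turns transcendence over \<open>Kv\<^sub>0\<close> into a statement about values.\<close>

lemma residue_transcendental_iff:
  assumes v0: "is_valuation v0" and v: "extends v0 v"
  shows "residue_transcendental v0 v s \<longleftrightarrow> vrel v 1 s \<and> vrel v s 1 \<and>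
    (\<forall>p. (\<forall>i. vrel v0 1 (coeff p i)) \<and> \<not> vrel v (peval p s) 1 \<longrightarrow> (\<forall>i. \<not> vrel v0 (coeff p i) 1))"
proof (cases "vrel v 1 s \<and> vrel v s 1")
  case True
  have vv: "is_valuation v" using v by (simp add: extends_def)
  interpret E: valuation_extension "vrel v0" "vrel v" using valuation_extensionI[OF v0 v] .
  interpret F: field "residue_field v" using field_residue_field[OF vv] .
  interpret H: ring_hom_ring "val_ring v" "residue_field v" "residue v" using residue_hom[OF vv] .
  define r where "r = (\<lambda>c. residue v (const c))"
  have k: "base_residues v0 v = r ` {c. vrel v0 1 c}"
    unfolding base_residues_eq[OF assms] r_def by blast
  have r0: "r c = \<zero>\<^bsub>residue_field v\<^esub> \<longleftrightarrow> \<not> vrel v0 c 1" if "vrel v0 1 c" for c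
    using residue_zero_iff[OF vv, of "const c"] that E.const_le[of 1 c] E.const_le[of c 1] by (simp add: r_def)
  have s_in: "residue v s \<in> carrier (residue_field v)"
    using True by (auto simp: carrier_residue_field carrier_val_ring[OF vv])
  have eval0: "F.eval (map r cs) (residue v s) = \<zero>\<^bsub>residue_field v\<^esub> \<longleftrightarrow> \<not> vrel v (peval (Poly (rev cs)) s) 1"
    if "\<And>c. c \<in> set cs \<Longrightarrow> vrel v0 1 c" for cs
    using residue_peval[OF v0 v conjunct1[OF True], of cs] that
      residue_zero_iff[OF vv, of "peval (Poly (rev cs)) s"]
    unfolding r_def by simp
  have "F.transcendental (base_residues v0 v) (residue v s) \<longleftrightarrow>
    (\<forall>p. (\<forall>i. vrel v0 1 (coeff p i)) \<and> \<not> vrel v (peval p s) 1 \<longrightarrow> (\<forall>i. \<not> vrel v0 (coeff p i) 1))"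
  proof (intro iffI allI impI)
    fix p i
    assume tr: "F.transcendental (base_residues v0 v) (residue v s)"
      and p: "(\<forall>i. vrel v0 1 (coeff p i)) \<and> \<not> vrel v (peval p s) 1"
    define cs where "cs = rev (coeffs p)"
    have cs: "vrel v0 1 c" if "c \<in> set cs" for c
    proof -
      have "c \<in> set (coeffs p)" using that by (simp add: cs_def)
      then obtain i where "c = coeff p i" by (auto simp: coeffs_def split: if_splits)
      then show ?thesis using p by simp
    qed
    \<comment> \<open>The leading coefficients of \<open>p\<close> may have residue zero, so the list has to be normalized.\<close>
    let ?q = "F.normalize (map r cs)"
    have car: "set (map r cs) \<subseteq> base_residues v0 v" using cs by (auto simp: k)
    have "F.eval (map r cs) (residue v s) = \<zero>\<^bsub>residue_field v\<^esub>"
      using eval0[of cs] cs p by (simp add: cs_def)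
    then have "F.eval ?q (residue v s) = \<zero>\<^bsub>residue_field v\<^esub>"
      using F.eval_normalize[OF _ s_in, of "map r cs"] car subringE(1)[OF subring_base_residues[OF assms]]
      by auto
    moreover have "?q \<in> carrier (univ_poly (residue_field v) (base_residues v0 v))"
      using F.normalize_gives_polynomial[OF car] by (simp add: univ_poly_carrier)
    ultimately have "?q = []"
      using F.eval_transcendental[of "base_residues v0 v" "residue v s" ?q] tr by (simp add: over_def)
    then have q0: "set (map r cs) \<subseteq> {\<zero>\<^bsub>residue_field v\<^esub>}"
      using F.normalize_trick[of "map r cs"] by (metis append_Nil2 set_replicate_conv_if set_empty order_refl empty_subsetI)
    show "\<not> vrel v0 (coeff p i) 1"
    proof (cases "coeff p i = 0")
      case False
      then have "coeff p i \<in> set cs"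
        unfolding cs_def using coeff_in_coeffs[of p i] le_degree[of p i] by fastforce
      then show ?thesis using q0 r0 cs by auto
    qed simp
  next
    assume crit: "\<forall>p. (\<forall>i. vrel v0 1 (coeff p i)) \<and> \<not> vrel v (peval p s) 1 \<longrightarrow> (\<forall>i. \<not> vrel v0 (coeff p i) 1)"
    show "F.transcendental (base_residues v0 v) (residue v s)"
    proof (rule ccontr)
      assume "F.algebraic (base_residues v0 v) (residue v s)"
      then obtain q where q: "q \<in> carrier (univ_poly (residue_field v) (base_residues v0 v))" "q \<noteq> []"
        "F.eval q (residue v s) = \<zero>\<^bsub>residue_field v\<^esub>"
        using F.algebraicE[OF subring_base_residues[OF assms] s_in] by (auto simp: over_def)
      then have "polynomial\<^bsub>residue_field v\<^esub> (base_residues v0 v) q" by (simp add: univ_poly_carrier)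
      then have qk: "set q \<subseteq> r ` {c. vrel v0 1 c}" and lead: "hd q \<noteq> \<zero>\<^bsub>residue_field v\<^esub>"
        using q(2) unfolding polynomial_def k by auto
      from qk have "q \<in> map r ` lists {c. vrel v0 1 c}"
        unfolding lists_image[symmetric] by (simp add: lists_eq_set)
      then obtain cs where cs: "q = map r cs" "set cs \<subseteq> {c. vrel v0 1 c}"
        unfolding lists_eq_set by blast
      have ne: "cs \<noteq> []" using cs q by auto
      have int: "vrel v0 1 (coeff (Poly (rev cs)) i)" for i
        using cs(2) nth_mem[of i "rev cs"] E.K.zero by (auto simp: nth_default_def)
      have "\<not> vrel v (peval (Poly (rev cs)) s) 1"
        using eval0[of cs] cs q(3) by auto
      then have "\<not> vrel v0 (coeff (Poly (rev cs)) (length cs - 1)) 1"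
        using crit int by blast
      moreover have "coeff (Poly (rev cs)) (length cs - 1) = hd cs"
        using ne by (simp add: nth_default_def rev_nth hd_conv_nth)
      ultimately have "r (hd cs) = \<zero>\<^bsub>residue_field v\<^esub>"
        using r0[of "hd cs"] subsetD[OF cs(2) hd_in_set[OF ne]] by simp
      then show False using lead cs ne by (simp add: hd_map)
    qed
  qed
  moreover have "val v s = vzero v"
    using True vrel_eqv_iff[OF vv, of 1 s] val_1[OF vv] by (simp add: vzero_def)
  ultimately show ?thesis
    unfolding residue_transcendental_def using True by simp
next
  case False
  have vv: "is_valuation v" using v by (simp add: extends_def)
  have "val v s \<noteq> vzero v"
    using False vrel_eqv_iff[OF vv, of 1 s] val_1[OF vv] by (auto simp: vzero_def)
  then show ?thesis using False by (auto simp: residue_transcendental_def)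
qed

lemma not_residue_transcendental_ext:
  assumes v0: "is_valuation v0" and v: "extends v0 v"
    and eq: "base_residues v0 v = carrier (residue_field v)"
  shows "\<not> residue_transcendental_ext v0 v"
proof -
  have vv: "is_valuation v" using v by (simp add: extends_def)
  interpret F: field "residue_field v" using field_residue_field[OF vv] .
  show ?thesis
    using F.algebraic_self[OF subring_base_residues[OF v0 v]] eq
    unfolding residue_transcendental_ext_def has_trdeg_one_def by (auto simp: over_def)
qed

lemma residue_transcendental_not_base:
  assumes v0: "is_valuation v0" and v: "extends v0 v" and s: "residue_transcendental v0 v s"
  shows "base_residues v0 v \<noteq> carrier (residue_field v)"
proof
  assume eq: "base_residues v0 v = carrier (residue_field v)"
  have vv: "is_valuation v" using v by (simp add: extends_def)
  interpret F: field "residue_field v" using field_residue_field[OF vv] .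
  have "vrel v 1 s" using s residue_transcendental_iff[OF v0 v] by blast
  then have "residue v s \<in> base_residues v0 v"
    unfolding eq by (auto simp: carrier_residue_field carrier_val_ring[OF vv])
  then show False
    using F.algebraic_self[OF subring_base_residues[OF v0 v]] s
    by (auto simp: over_def residue_transcendental_def)
qed

text \<open>The hypothesis writes every residue as a quotient of polynomials in the residue of \<open>s\<close>. So the
  residue field is generated by this one residue over \<open>Kv\<^sub>0\<close>.\<close>

lemma residue_transcendental_extI:
  assumes v0: "is_valuation v0" and v: "extends v0 v" and s: "residue_transcendental v0 v s"
    and gen: "\<And>u. vrel v 1 u \<Longrightarrow> \<exists>p q. (\<forall>i. vrel v0 1 (coeff p i)) \<and> (\<forall>i. vrel v0 1 (coeff q i)) \<and>
      vrel v (peval q s) 1 \<and> \<not> vrel v (u * peval q s - peval p s) 1"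
  shows "residue_transcendental_ext v0 v"
proof -
  have vv: "is_valuation v" using v by (simp add: extends_def)
  interpret E: valuation_extension "vrel v0" "vrel v" using valuation_extensionI[OF v0 v] .
  interpret F: field "residue_field v" using field_residue_field[OF vv] .
  interpret H: ring_hom_ring "val_ring v" "residue_field v" "residue v" using residue_hom[OF vv] .
  have s1: "vrel v 1 s" and tr: "F.transcendental (base_residues v0 v) (residue v s)"
    using s residue_transcendental_iff[OF v0 v] by (auto simp: residue_transcendental_def)
  have s_in: "residue v s \<in> carrier (residue_field v)"
    using s1 by (auto simp: carrier_residue_field carrier_val_ring[OF vv])
  have sub: "insert (residue v s) (base_residues v0 v) \<subseteq> carrier (residue_field v)"
    using s_in subringE(1)[OF subring_base_residues[OF v0 v]] by blast
  let ?G = "generate_field (residue_field v) (insert (residue v s) (base_residues v0 v))"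
  have sf: "subfield ?G (residue_field v)" using F.generate_field_is_subfield[OF sub] .
  note G = subringE[OF subfieldE(1)[OF sf]]
  have in_ring: "const c \<in> carrier (val_ring v) \<longleftrightarrow> vrel v0 1 c" for c
    using E.const_le[of 1 c] by (simp add: carrier_val_ring[OF vv])
  have pG: "peval p s \<in> carrier (val_ring v) \<and> residue v (peval p s) \<in> ?G"
    if "\<forall>i. vrel v0 1 (coeff p i)" for p
    using that
  proof (induction p)
    case 0
    then show ?case using G(2) H.hom_zero H.R.zero_closed by simp
  next
    case (pCons a p)
    have "vrel v0 1 a" using pCons.prems by (metis coeff_pCons_0)
    then have a: "const a \<in> carrier (val_ring v)" "residue v (const a) \<in> ?G"
      using in_ring base_residues_eq[OF v0 v] by (auto intro!: generate_field.incl)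
    have "\<forall>i. vrel v0 1 (coeff p i)" using pCons.prems by (metis coeff_pCons_Suc)
    then have p: "peval p s \<in> carrier (val_ring v)" "residue v (peval p s) \<in> ?G" using pCons.IH by auto
    have s': "s \<in> carrier (val_ring v)" "residue v s \<in> ?G"
      using s1 by (auto simp: carrier_val_ring[OF vv] intro: generate_field.incl)
    have sp: "s * peval p s \<in> carrier (val_ring v)" "residue v (s * peval p s) \<in> ?G"
      using H.hom_mult[OF s'(1) p(1)] H.R.m_closed[OF s'(1) p(1)] G(6)[OF s'(2) p(2)] by simp_all
    show ?case
      using H.hom_add[OF a(1) sp(1)] H.R.add.m_closed[OF a(1) sp(1)] G(7)[OF a(2) sp(2)] by simp
  qed
  have all: "y \<in> ?G" if "y \<in> carrier (residue_field v)" for y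
  proof -
    from that obtain u where u: "vrel v 1 u" "y = residue v u"
      by (auto simp: carrier_residue_field carrier_val_ring[OF vv])
    obtain p q where p: "\<forall>i. vrel v0 1 (coeff p i)" and q: "\<forall>i. vrel v0 1 (coeff q i)"
      and q1: "vrel v (peval q s) 1" and near: "\<not> vrel v (u * peval q s - peval p s) 1"
      using gen[OF u(1)] by blast
    have uq: "u * peval q s \<in> carrier (val_ring v)"
      using H.R.m_closed[of u "peval q s"] pG[OF q] u(1) by (simp add: carrier_val_ring[OF vv])
    have u_in: "u \<in> carrier (val_ring v)" using u(1) by (simp add: carrier_val_ring[OF vv])
    have "residue v (u * peval q s) = residue v (peval p s)"
      using residue_eq_iff[OF vv, of "u * peval q s" "peval p s"] uq pG[OF p] near
      by (simp add: carrier_val_ring[OF vv])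
    then have eq: "y \<otimes>\<^bsub>residue_field v\<^esub> residue v (peval q s) = residue v (peval p s)"
      using H.hom_mult[OF u_in conjunct1[OF pG[OF q]]] u(2) by simp
    have q_in: "residue v (peval q s) \<in> carrier (residue_field v)"
      using pG[OF q] by (auto simp: carrier_residue_field)
    have q0: "residue v (peval q s) \<noteq> \<zero>\<^bsub>residue_field v\<^esub>"
      using residue_zero_iff[OF vv, of "peval q s"] pG[OF q] q1 by (simp add: carrier_val_ring[OF vv])
    then have inv: "inv\<^bsub>residue_field v\<^esub> residue v (peval q s) \<in> ?G"
      using pG[OF q] by (intro generate_field.m_inv) auto
    have "y = residue v (peval p s) \<otimes>\<^bsub>residue_field v\<^esub> inv\<^bsub>residue_field v\<^esub> residue v (peval q s)"
      using eq q_in q0 that F.field_Units by (simp flip: eq add: F.m_assoc)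
    then show ?thesis using G(6)[OF _ inv] pG[OF p] by simp
  qed
  show ?thesis
    unfolding residue_transcendental_ext_def has_trdeg_one_def
  proof (intro bexI[OF _ s_in] conjI ballI tr)
    fix y assume "y \<in> carrier (residue_field v)"
    then show "F.algebraic ?G y"
      using F.algebraic_self[OF subfieldE(1)[OF sf] all] by (simp add: over_def)
  qed
qed

section \<open>Approximation types by centres and radii\<close>

text \<open>Radii are given by elements \<open>e\<close> of \<open>K\<close>, the radius \<open>\<infinity>\<close> by \<open>0\<close>, and every element \<open>c\<close> of a ball is a
  centre of it. For the approximation type of \<open>y\<close> the two relations become \<open>v e \<le> v (y - c)\<close> and
  \<open>v e < v (y - c)\<close>; an arbitrary approximation type prescribes these inequalities for an ideal
  element.\<close>

definition closed_at :: "('a::field, 'g) valuation \<Rightarrow> ('a, 'g) ball set \<Rightarrow> 'a \<Rightarrow> 'a \<Rightarrow> bool" where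
  "closed_at v0 A e c \<longleftrightarrow> (Closed, val v0 e, closed_ball v0 (val v0 e) c) \<in> A"

definition open_at :: "('a::field, 'g) valuation \<Rightarrow> ('a, 'g) ball set \<Rightarrow> 'a \<Rightarrow> 'a \<Rightarrow> bool" where
  "open_at v0 A e c \<longleftrightarrow> (Open, val v0 e, open_ball v0 (val v0 e) c) \<in> A"

lemma closed_ball_eq: "closed_ball v0 (val v0 e) c = {a. vrel v0 e (a - c)}"
  by (simp add: closed_ball_def vrel_def)

lemma open_ball_eq: "is_valuation v0 \<Longrightarrow> open_ball v0 (val v0 e) c = {a. \<not> vrel v0 (a - c) e}"
  by (simp add: open_ball_def vless_iff)

lemma Some_carrier_eq:
  assumes v0: "is_valuation v0"
  shows "Some ` carrier (vgroup v0) = val v0 ` {e. e \<noteq> 0}"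
proof (intro equalityI subsetI)
  fix \<gamma> assume "\<gamma> \<in> Some ` carrier (vgroup v0)"
  then obtain \<alpha> where \<alpha>: "\<alpha> \<in> carrier (vgroup v0)" "\<gamma> = Some \<alpha>" by blast
  then obtain e where "val v0 e = Some \<alpha>" using is_valuationD(6)[OF v0] by blast
  moreover from this have "e \<noteq> 0" using val_0[OF v0] by auto
  ultimately show "\<gamma> \<in> val v0 ` {e. e \<noteq> 0}" using \<alpha> by (intro image_eqI[of _ _ e]) simp_all
next
  fix \<gamma> assume "\<gamma> \<in> val v0 ` {e. e \<noteq> 0}"
  then obtain e where "e \<noteq> 0" "\<gamma> = val v0 e" by blast
  moreover from \<open>e \<noteq> 0\<close> obtain \<alpha> where "val v0 e = Some \<alpha>" "\<alpha> \<in> carrier (vgroup v0)" by (rule val_SomeE[OF v0])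
  ultimately show "\<gamma> \<in> Some ` carrier (vgroup v0)" by simp
qed

lemma radii_eq: "is_valuation v0 \<Longrightarrow> radii v0 = range (val v0)"
proof -
  assume v0: "is_valuation v0"
  have "range (val v0) = insert (val v0 0) (val v0 ` {e. e \<noteq> 0})" by auto
  then show ?thesis unfolding radii_def Some_carrier_eq[OF v0] by (simp add: val_0[OF v0])
qed

locale approx =
  fixes v0 :: "('a::field, 'g) valuation" and A :: "('a, 'g) ball set"
  assumes v0: "is_valuation v0" and A: "approximation_type v0 A"
begin

sublocale K: field_valuation "vrel v0"
  using field_valuation_vrel[OF v0] .

abbreviation "le0 \<equiv> vrel v0"
abbreviation "cl \<equiv> closed_at v0 A"
abbreviation "op \<equiv> open_at v0 A"

lemma in_A:
  shows "(Closed, \<gamma>, B) \<in> A \<Longrightarrow> \<exists>e c. \<gamma> = val v0 e \<and> B = closed_ball v0 (val v0 e) c"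
    and "(Open, \<gamma>, B) \<in> A \<Longrightarrow> \<exists>e c. e \<noteq> 0 \<and> \<gamma> = val v0 e \<and> B = open_ball v0 (val v0 e) c"
proof -
  have *: "A \<subseteq> closed_balls v0 \<union> open_balls v0" using A unfolding approximation_type_def by (rule conjunct1)
  show "\<exists>e c. \<gamma> = val v0 e \<and> B = closed_ball v0 (val v0 e) c" if "(Closed, \<gamma>, B) \<in> A"
    using subsetD[OF * that] radii_eq[OF v0] by (auto simp: closed_balls_def open_balls_def)
  show "\<exists>e c. e \<noteq> 0 \<and> \<gamma> = val v0 e \<and> B = open_ball v0 (val v0 e) c" if "(Open, \<gamma>, B) \<in> A"
    using subsetD[OF * that] Some_carrier_eq[OF v0] by (auto simp: closed_balls_def open_balls_def)
qed

lemma comparable: "(k, \<gamma>, B) \<in> A \<Longrightarrow> (k', \<gamma>', B') \<in> A \<Longrightarrow> B \<subseteq> B' \<or> B' \<subseteq> B"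
proof -
  have "\<forall>(k, \<gamma>, B)\<in>A. \<forall>(k', \<gamma>', B')\<in>A. B \<subseteq> B' \<or> B' \<subseteq> B"
    using A unfolding approximation_type_def by (elim conjE)
  then show "(k, \<gamma>, B) \<in> A \<Longrightarrow> (k', \<gamma>', B') \<in> A \<Longrightarrow> B \<subseteq> B' \<or> B' \<subseteq> B" by fast
qed

lemma open_at_nonzero: "op e c \<Longrightarrow> e \<noteq> 0"
proof
  assume "op e c" "e = 0"
  then obtain e' where "e' \<noteq> 0" "val v0 0 = val v0 e'"
    using in_A(2) unfolding open_at_def by blast
  then show False using val_0[OF v0] is_valuationD(2)[OF v0, of e'] by simp
qed

lemma closed_ball_cong: "le0 e (a - c) \<Longrightarrow> closed_ball v0 (val v0 e) a = closed_ball v0 (val v0 e) c"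
  unfolding closed_ball_eq using K.add[of e _ "a - c"] K.diff[of e _ "a - c"] by force

lemma open_ball_cong: "K.lt e (a - c) \<Longrightarrow> open_ball v0 (val v0 e) a = open_ball v0 (val v0 e) c"
  unfolding open_ball_eq[OF v0]
  using K.add_lt[where c = e and b = "a - c"] K.diff_lt[where c = e and b = "a - c"] by force

lemma closed_at_iff:
  assumes "cl e c"
  shows "cl e a \<longleftrightarrow> le0 e (a - c)"
proof
  assume "cl e a"
  with assms have "closed_ball v0 (val v0 e) c \<subseteq> closed_ball v0 (val v0 e) a \<or>
      closed_ball v0 (val v0 e) a \<subseteq> closed_ball v0 (val v0 e) c"
    unfolding closed_at_def by (rule comparable)
  moreover have "c \<in> closed_ball v0 (val v0 e) c" "a \<in> closed_ball v0 (val v0 e) a"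
    by (simp_all add: closed_ball_eq K.zero)
  ultimately have "c \<in> closed_ball v0 (val v0 e) a \<or> a \<in> closed_ball v0 (val v0 e) c" by blast
  then show "le0 e (a - c)" using K.minus_commute(1)[of e a c] by (simp add: closed_ball_eq)
next
  assume "le0 e (a - c)"
  then show "cl e a" using assms closed_ball_cong unfolding closed_at_def by simp
qed

lemma open_at_iff:
  assumes "op e c"
  shows "op e a \<longleftrightarrow> K.lt e (a - c)"
proof
  note e0 = open_at_nonzero[OF assms]
  assume "op e a"
  with assms have "open_ball v0 (val v0 e) c \<subseteq> open_ball v0 (val v0 e) a \<or>
      open_ball v0 (val v0 e) a \<subseteq> open_ball v0 (val v0 e) c"
    unfolding open_at_def by (rule comparable)
  moreover have "c \<in> open_ball v0 (val v0 e) c" "a \<in> open_ball v0 (val v0 e) a"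
    using e0 by (simp_all add: open_ball_eq[OF v0])
  ultimately have "c \<in> open_ball v0 (val v0 e) a \<or> a \<in> open_ball v0 (val v0 e) c" by blast
  then show "K.lt e (a - c)" using K.minus_commute(2)[of a c e] by (simp add: open_ball_eq[OF v0])
next
  assume "K.lt e (a - c)"
  then show "op e a" using assms open_ball_cong unfolding open_at_def by simp
qed

lemma open_imp_closed: "op e c \<Longrightarrow> cl e c"
proof -
  have "\<forall>\<gamma> c. (Open, \<gamma>, open_ball v0 \<gamma> c) \<in> A \<longrightarrow> (Closed, \<gamma>, closed_ball v0 \<gamma> c) \<in> A"
    using A unfolding approximation_type_def by (elim conjE)
  then show "op e c \<Longrightarrow> cl e c" unfolding open_at_def closed_at_def by blast
qed

lemma smaller_radius:
  assumes "cl f c \<or> op f c" "K.lt e f"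
  shows "cl e c" "op e c"
proof -
  have *: "\<forall>\<gamma> c \<beta>. ((Closed, \<gamma>, closed_ball v0 \<gamma> c) \<in> A \<or> (Open, \<gamma>, open_ball v0 \<gamma> c) \<in> A) \<and>
        \<beta> \<in> Some ` carrier (vgroup v0) \<and> vless v0 \<beta> \<gamma> \<longrightarrow>
        (Closed, \<beta>, closed_ball v0 \<beta> c) \<in> A \<and> (Open, \<beta>, open_ball v0 \<beta> c) \<in> A"
    using A unfolding approximation_type_def by (elim conjE)
  have "val v0 e \<in> Some ` carrier (vgroup v0)"
    unfolding Some_carrier_eq[OF v0] using K.lt_nonzero[OF assms(2)] by blast
  moreover have "vless v0 (val v0 e) (val v0 f)" using assms(2) vless_iff[OF v0] by simp
  ultimately show "cl e c" "op e c"
    using *[rule_format, of "val v0 f" c "val v0 e"] assms(1) unfolding closed_at_def open_at_def by blast+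
qed

lemma closed_at_mono: "cl f c \<Longrightarrow> le0 e f \<Longrightarrow> cl e c"
proof (cases "le0 f e")
  case True
  assume "cl f c" "le0 e f"
  then have "val v0 e = val v0 f" using True vrel_eqv_iff[OF v0, of e f] by simp
  then show ?thesis using \<open>cl f c\<close> by (simp add: closed_at_def)
next
  case False
  assume "cl f c"
  then show ?thesis using smaller_radius(1) False by blast
qed

lemma open_at_mono: "op f c \<Longrightarrow> le0 e f \<Longrightarrow> op e c"
proof (cases "le0 f e")
  case True
  assume "op f c" "le0 e f"
  then have "val v0 e = val v0 f" using True vrel_eqv_iff[OF v0, of e f] by simp
  then show ?thesis using \<open>op f c\<close> by (simp add: open_at_def)
next
  case False
  assume "op f c"
  then show ?thesis using smaller_radius(2) False by blast
qed

lemma mem_ball_at_Closed: "c \<in> ball_at A Closed (val v0 e) \<longleftrightarrow> cl e c"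
proof (cases "\<exists>B. (Closed, val v0 e, B) \<in> A")
  case True
  then obtain f a where fa: "(Closed, val v0 e, closed_ball v0 (val v0 f) a) \<in> A" "val v0 e = val v0 f"
    using in_A(1) by blast
  then have ea: "cl e a" by (simp add: closed_at_def)
  have uniq: "B = closed_ball v0 (val v0 e) a" if "(Closed, val v0 e, B) \<in> A" for B
  proof -
    from in_A(1)[OF that] obtain e' c where "val v0 e = val v0 e'" "B = closed_ball v0 (val v0 e') c" by blast
    then have B: "B = closed_ball v0 (val v0 e) c" by simp
    with that have "cl e c" by (simp add: closed_at_def)
    then show ?thesis unfolding B using closed_at_iff[OF ea] closed_ball_cong by blast
  qed
  have "(THE B. (Closed, val v0 e, B) \<in> A) = closed_ball v0 (val v0 e) a"
    using uniq ea unfolding closed_at_def by (rule the_equality[rotated])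
  then have "ball_at A Closed (val v0 e) = closed_ball v0 (val v0 e) a"
    using True by (simp add: ball_at_def)
  then show ?thesis using closed_at_iff[OF ea] by (simp add: closed_ball_eq)
qed (auto simp: ball_at_def closed_at_def)

lemma mem_ball_at_Open: "c \<in> ball_at A Open (val v0 e) \<longleftrightarrow> op e c"
proof (cases "\<exists>B. (Open, val v0 e, B) \<in> A")
  case True
  then obtain f a where fa: "(Open, val v0 e, open_ball v0 (val v0 f) a) \<in> A" "val v0 e = val v0 f"
    using in_A(2) by blast
  then have ea: "op e a" by (simp add: open_at_def)
  have uniq: "B = open_ball v0 (val v0 e) a" if "(Open, val v0 e, B) \<in> A" for B
  proof -
    from in_A(2)[OF that] obtain e' c where "val v0 e = val v0 e'" "B = open_ball v0 (val v0 e') c" by blast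
    then have B: "B = open_ball v0 (val v0 e) c" by simp
    with that have "op e c" by (simp add: open_at_def)
    then show ?thesis unfolding B using open_at_iff[OF ea] open_ball_cong by blast
  qed
  have "(THE B. (Open, val v0 e, B) \<in> A) = open_ball v0 (val v0 e) a"
    using uniq ea unfolding open_at_def by (rule the_equality[rotated])
  then have "ball_at A Open (val v0 e) = open_ball v0 (val v0 e) a"
    using True by (simp add: ball_at_def)
  then show ?thesis using open_at_iff[OF ea] by (simp add: open_ball_eq[OF v0])
qed (auto simp: ball_at_def open_at_def)

lemma mem_supp: "val v0 e \<in> supp A \<longleftrightarrow> (\<exists>c. cl e c)"
proof
  assume "val v0 e \<in> supp A"
  then obtain B where "(Closed, val v0 e, B) \<in> A" unfolding supp_def by blast
  moreover from in_A(1)[OF this] obtain e' c where "val v0 e = val v0 e'" "B = closed_ball v0 (val v0 e') c"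
    by blast
  ultimately show "\<exists>c. cl e c" unfolding closed_at_def by metis
qed (auto simp: supp_def closed_at_def)

lemma supp_val: "\<gamma> \<in> supp A \<Longrightarrow> \<exists>e. \<gamma> = val v0 e"
  using in_A(1) unfolding supp_def by blast

lemma mem_Inter_type:
  "a \<in> Inter_type A \<longleftrightarrow> (\<forall>e c. cl e c \<longrightarrow> cl e a) \<and> (\<forall>e c. op e c \<longrightarrow> op e a)"
proof
  assume a: "a \<in> Inter_type A"
  have "cl e a" if "cl e c" for e c
  proof -
    have "a \<in> closed_ball v0 (val v0 e) c" using a that unfolding Inter_type_def closed_at_def by fast
    then show ?thesis using closed_at_iff[OF that] by (simp add: closed_ball_eq)
  qed
  moreover have "op e a" if "op e c" for e c
  proof -
    have "a \<in> open_ball v0 (val v0 e) c" using a that unfolding Inter_type_def open_at_def by fast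
    then show ?thesis using open_at_iff[OF that] by (simp add: open_ball_eq[OF v0])
  qed
  ultimately show "(\<forall>e c. cl e c \<longrightarrow> cl e a) \<and> (\<forall>e c. op e c \<longrightarrow> op e a)" by blast
next
  assume a: "(\<forall>e c. cl e c \<longrightarrow> cl e a) \<and> (\<forall>e c. op e c \<longrightarrow> op e a)"
  have "a \<in> B" if X: "(k, \<gamma>, B) \<in> A" for k \<gamma> B
  proof (cases k)
    case Closed
    then obtain e c where ec: "\<gamma> = val v0 e" "B = closed_ball v0 (val v0 e) c" using in_A(1) X by blast
    then have "cl e c" using X Closed by (simp add: closed_at_def)
    with a have "le0 e (a - c)" using closed_at_iff by blast
    then show ?thesis by (simp add: ec closed_ball_eq)
  next
    case Open
    then obtain e c where ec: "\<gamma> = val v0 e" "B = open_ball v0 (val v0 e) c" using in_A(2) X by blast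
    then have "op e c" using X Open by (simp add: open_at_def)
    with a have "K.lt e (a - c)" using open_at_iff by blast
    then show ?thesis by (simp add: ec open_ball_eq[OF v0])
  qed
  then show "a \<in> Inter_type A" unfolding Inter_type_def by blast
qed

lemma trivial_type_iff: "trivial_type A \<longleftrightarrow> (\<exists>c. cl 0 c)"
  using mem_supp[of 0] val_0[OF v0] by (simp add: trivial_type_def)

lemma value_extending_iff:
  "value_extending_type A \<longleftrightarrow> \<not> trivial_type A \<and> (\<forall>e c. cl e c \<longrightarrow> (\<exists>a. op e a)) \<and> Inter_type A \<noteq> {}"
proof -
  have "(\<forall>\<gamma>\<in>supp A. ball_at A Open \<gamma> \<noteq> {}) \<longleftrightarrow> (\<forall>e c. cl e c \<longrightarrow> (\<exists>a. op e a))"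
    using mem_supp supp_val mem_ball_at_Open by (metis all_not_in_conv)
  then show ?thesis by (simp add: value_extending_type_def)
qed

lemma residue_extending_iff:
  "residue_extending_type A \<longleftrightarrow> \<not> trivial_type A \<and> (\<forall>c. \<exists>e. cl e c \<and> \<not> op e c) \<and> Inter_type A \<noteq> {}"
proof -
  have "(\<exists>\<gamma>\<in>supp A. c \<in> ball_at A Closed \<gamma> - ball_at A Open \<gamma>) \<longleftrightarrow> (\<exists>e. cl e c \<and> \<not> op e c)" for c
  proof
    assume "\<exists>\<gamma>\<in>supp A. c \<in> ball_at A Closed \<gamma> - ball_at A Open \<gamma>"
    then show "\<exists>e. cl e c \<and> \<not> op e c"
      using supp_val mem_ball_at_Closed mem_ball_at_Open by (metis DiffD1 DiffD2)
  next
    assume "\<exists>e. cl e c \<and> \<not> op e c"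
    then show "\<exists>\<gamma>\<in>supp A. c \<in> ball_at A Closed \<gamma> - ball_at A Open \<gamma>"
      using mem_supp mem_ball_at_Closed mem_ball_at_Open by (metis DiffI)
  qed
  then show ?thesis by (simp add: residue_extending_type_def)
qed

lemma transcendental_immediate_iff:
  "transcendental_immediate_type v0 A \<longleftrightarrow> immediate_type A \<and>
    (\<forall>f. \<exists>e c. cl e c \<and> (\<forall>c'. cl e c' \<longrightarrow> K.eqv (poly f c') (poly f c)))"
proof -
  have "(\<exists>\<delta>\<in>supp A. \<exists>\<alpha>. \<forall>c\<in>ball_at A Closed \<delta>. val v0 (poly f c) = \<alpha>) \<longleftrightarrow>
    (\<exists>e c. cl e c \<and> (\<forall>c'. cl e c' \<longrightarrow> K.eqv (poly f c') (poly f c)))" for f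
  proof
    assume "\<exists>\<delta>\<in>supp A. \<exists>\<alpha>. \<forall>c\<in>ball_at A Closed \<delta>. val v0 (poly f c) = \<alpha>"
    then obtain \<delta> \<alpha> where \<delta>: "\<delta> \<in> supp A" "\<forall>c\<in>ball_at A Closed \<delta>. val v0 (poly f c) = \<alpha>" by blast
    from supp_val[OF \<delta>(1)] obtain e where e: "\<delta> = val v0 e" by blast
    from \<delta>(1) obtain c where c: "cl e c" unfolding e mem_supp by blast
    have "K.eqv (poly f c') (poly f c)" if "cl e c'" for c'
      using \<delta>(2) c that unfolding e vrel_eqv_iff[OF v0] by (simp add: mem_ball_at_Closed)
    then show "\<exists>e c. cl e c \<and> (\<forall>c'. cl e c' \<longrightarrow> K.eqv (poly f c') (poly f c))" using c by blast
  next
    assume "\<exists>e c. cl e c \<and> (\<forall>c'. cl e c' \<longrightarrow> K.eqv (poly f c') (poly f c))"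
    then obtain e c where ec: "cl e c" "\<And>c'. cl e c' \<Longrightarrow> val v0 (poly f c') = val v0 (poly f c)"
      unfolding vrel_eqv_iff[OF v0] by blast
    then have "val v0 e \<in> supp A" using mem_supp by blast
    then show "\<exists>\<delta>\<in>supp A. \<exists>\<alpha>. \<forall>c\<in>ball_at A Closed \<delta>. val v0 (poly f c) = \<alpha>"
      using ec(2) by (intro bexI[of _ "val v0 e"]) (auto simp: mem_ball_at_Closed)
  qed
  then show ?thesis by (simp add: transcendental_immediate_type_def)
qed

lemma supp_full: "supp A = Some ` carrier (vgroup v0) \<Longrightarrow> e \<noteq> 0 \<Longrightarrow> \<exists>c. cl e c"
  unfolding Some_carrier_eq[OF v0] using mem_supp[of e] by auto

end

lemma approx_eqI:
  assumes "approx v0 A" "approx v0 B"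
    and "\<And>e c. closed_at v0 A e c \<longleftrightarrow> closed_at v0 B e c"
    and "\<And>e c. e \<noteq> 0 \<Longrightarrow> open_at v0 A e c \<longleftrightarrow> open_at v0 B e c"
  shows "A = B"
proof -
  have *: "A \<subseteq> B" if "approx v0 A"
    and cl: "\<And>e c. closed_at v0 A e c \<Longrightarrow> closed_at v0 B e c"
    and op: "\<And>e c. e \<noteq> 0 \<Longrightarrow> open_at v0 A e c \<Longrightarrow> open_at v0 B e c" for A B
  proof
    interpret approx v0 A by fact
    fix Z assume Z: "Z \<in> A"
    obtain k \<gamma> Y where Y: "Z = (k, \<gamma>, Y)" by (metis surj_pair)
    show "Z \<in> B"
    proof (cases k)
      case Closed
      then show ?thesis using in_A(1)[of \<gamma> Y] Z cl unfolding Y closed_at_def by blast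
    next
      case Open
      then show ?thesis using in_A(2)[of \<gamma> Y] Z op unfolding Y open_at_def by blast
    qed
  qed
  show ?thesis using *[of A B] *[of B A] assms by blast
qed

section \<open>The approximation type of an element\<close>

context
  fixes v0 :: "('a::field, 'g0) valuation" and v :: "('a poly fract, 'g) valuation"
  assumes v0: "is_valuation v0" and v: "extends v0 v"
begin

interpretation valuation_extension "vrel v0" "vrel v"
  using valuation_extensionI[OF v0 v] .

lemma vle_vemb:
  "vle v (map_option (vemb v0 v) (val v0 e)) (val v u) \<longleftrightarrow> vrel v (const e) u"
  "vless v (map_option (vemb v0 v) (val v0 e)) (val v u) \<longleftrightarrow> \<not> vrel v u (const e)"
  using v unfolding vemb_val[OF v0 v] by (auto simp: vrel_def[symmetric] vless_iff extends_def)

lemma appr_mem_iff: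
  "(Closed, \<gamma>, B) \<in> appr v0 v y \<longleftrightarrow>
    (\<exists>e. \<gamma> = val v0 e \<and> B \<noteq> {} \<and> B = {c. vrel v (const e) (y - const c)})"
  "(Open, \<gamma>, B) \<in> appr v0 v y \<longleftrightarrow>
    (\<exists>e. e \<noteq> 0 \<and> \<gamma> = val v0 e \<and> B \<noteq> {} \<and> B = {c. \<not> vrel v (y - const c) (const e)})"
  unfolding appr_def radii_eq[OF v0] Some_carrier_eq[OF v0] by (auto simp: vle_vemb)

lemma appr_closed_ball:
  assumes "vrel v (const e) (y - const c)"
  shows "{a. vrel v (const e) (y - const a)} = closed_ball v0 (val v0 e) c"
  unfolding closed_ball_eq
proof (intro Collect_cong iffI)
  fix a
  assume "vrel v (const e) (y - const a)"
  from L.diff[OF assms this] have "vrel v (const e) (const (a - c))" by simp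
  then show "vrel v0 e (a - c)" by (simp only: const_le not_False_eq_True)
next
  fix a
  assume "vrel v0 e (a - c)"
  then have "vrel v (const e) (const (a - c))" by (simp only: const_le not_False_eq_True)
  from L.diff[OF assms this] show "vrel v (const e) (y - const a)" by simp
qed

lemma appr_open_ball:
  assumes "\<not> vrel v (y - const c) (const e)"
  shows "{a. \<not> vrel v (y - const a) (const e)} = open_ball v0 (val v0 e) c"
  unfolding open_ball_eq[OF v0]
proof (intro Collect_cong iffI)
  fix a
  assume "\<not> vrel v (y - const a) (const e)"
  from L.diff_lt[OF assms this] have "\<not> vrel v (const (a - c)) (const e)" by simp
  then show "\<not> vrel v0 (a - c) e" by (simp only: const_le not_False_eq_True)
next
  fix a
  assume "\<not> vrel v0 (a - c) e"
  then have "\<not> vrel v (const (a - c)) (const e)" by (simp only: const_le not_False_eq_True)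
  from L.diff_lt[OF assms this] show "\<not> vrel v (y - const a) (const e)" by simp
qed

lemma val_eq_vrel: "val v0 e = val v0 f \<Longrightarrow> vrel v (const e) u \<longleftrightarrow> vrel v (const f) u"
  "val v0 e = val v0 f \<Longrightarrow> vrel v u (const e) \<longleftrightarrow> vrel v u (const f)"
proof -
  assume "val v0 e = val v0 f"
  then have "vrel v0 e f \<and> vrel v0 f e" by (simp add: vrel_eqv_iff[OF v0])
  then have "vrel v (const e) (const f)" "vrel v (const f) (const e)" by auto
  then show "vrel v (const e) u \<longleftrightarrow> vrel v (const f) u" "vrel v u (const e) \<longleftrightarrow> vrel v u (const f)"
    using L.trans by blast+
qed

lemma closed_at_appr: "closed_at v0 (appr v0 v y) e c \<longleftrightarrow> vrel v (const e) (y - const c)"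
proof
  assume "closed_at v0 (appr v0 v y) e c"
  then obtain f where f: "val v0 e = val v0 f" "closed_ball v0 (val v0 e) c = {c. vrel v (const f) (y - const c)}"
    unfolding closed_at_def appr_mem_iff by blast
  have "c \<in> closed_ball v0 (val v0 e) c" by (simp add: closed_ball_eq K.zero)
  then show "vrel v (const e) (y - const c)" using f val_eq_vrel(1)[OF f(1)] by simp
next
  assume a: "vrel v (const e) (y - const c)"
  have "c \<in> closed_ball v0 (val v0 e) c" by (simp add: closed_ball_eq K.zero)
  then show "closed_at v0 (appr v0 v y) e c"
    unfolding closed_at_def appr_mem_iff using appr_closed_ball[OF a] by blast
qed

lemma open_at_appr: "open_at v0 (appr v0 v y) e c \<longleftrightarrow> e \<noteq> 0 \<and> \<not> vrel v (y - const c) (const e)"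
proof
  assume "open_at v0 (appr v0 v y) e c"
  then obtain f where f: "f \<noteq> 0" "val v0 e = val v0 f" "open_ball v0 (val v0 e) c = {c. \<not> vrel v (y - const c) (const f)}"
    unfolding open_at_def appr_mem_iff by blast
  have e0: "e \<noteq> 0" using f(1,2) is_valuationD(2)[OF v0] by metis
  then have "c \<in> open_ball v0 (val v0 e) c" by (simp add: open_ball_eq[OF v0])
  then show "e \<noteq> 0 \<and> \<not> vrel v (y - const c) (const e)" using e0 f val_eq_vrel(2)[OF f(2)] by simp
next
  assume a: "e \<noteq> 0 \<and> \<not> vrel v (y - const c) (const e)"
  then have "c \<in> open_ball v0 (val v0 e) c" by (simp add: open_ball_eq[OF v0])
  then show "open_at v0 (appr v0 v y) e c"
    unfolding open_at_def appr_mem_iff using appr_open_ball[OF conjunct2[OF a]] a by blast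
qed

lemma approx_appr: "approx v0 (appr v0 v y)"
proof
  show "is_valuation v0" by (rule v0)
  let ?A = "appr v0 v y"
  have sets: "\<exists>e c. \<gamma> = val v0 e \<and> B = closed_ball v0 \<gamma> c \<and> B = {c. vrel v (const e) (y - const c)}"
    if "(Closed, \<gamma>, B) \<in> ?A" for \<gamma> B
    using that appr_closed_ball unfolding appr_mem_iff by blast
  have sets': "\<exists>e c. e \<noteq> 0 \<and> \<gamma> = val v0 e \<and> B = open_ball v0 \<gamma> c \<and> B = {c. \<not> vrel v (y - const c) (const e)}"
    if "(Open, \<gamma>, B) \<in> ?A" for \<gamma> B
    using that appr_open_ball unfolding appr_mem_iff by blast
  have sub: "?A \<subseteq> closed_balls v0 \<union> open_balls v0"
  proof
    fix Z assume Z: "Z \<in> ?A"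
    obtain k \<gamma> B where Y: "Z = (k, \<gamma>, B)" by (metis surj_pair)
    show "Z \<in> closed_balls v0 \<union> open_balls v0"
    proof (cases k)
      case Closed
      then obtain e c where "\<gamma> = val v0 e" "B = closed_ball v0 \<gamma> c" using sets Z Y by blast
      then show ?thesis unfolding Y Closed closed_balls_def radii_eq[OF v0] by blast
    next
      case Open
      then obtain e c where "e \<noteq> 0" "\<gamma> = val v0 e" "B = open_ball v0 \<gamma> c" using sets' Z Y by blast
      then show ?thesis unfolding Y Open open_balls_def Some_carrier_eq[OF v0] by blast
    qed
  qed
  have up: "\<exists>S. B = {c. S (y - const c)} \<and> ((\<forall>u w. S u \<longrightarrow> vrel v u w \<longrightarrow> S w))"
    if mem: "(k, \<gamma>, B) \<in> ?A" for k \<gamma> B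
  proof (cases k)
    case Closed
    then obtain e where "B = {c. vrel v (const e) (y - const c)}" using sets mem by blast
    then show ?thesis using L.trans by (intro exI[of _ "vrel v (const e)"]) blast
  next
    case Open
    then obtain e where "B = {c. \<not> vrel v (y - const c) (const e)}" using sets' mem by blast
    then show ?thesis using L.trans by (intro exI[of _ "\<lambda>u. \<not> vrel v u (const e)"]) blast
  qed
  have comp: "B \<subseteq> B' \<or> B' \<subseteq> B" if BA: "(k, \<gamma>, B) \<in> ?A" and B'A: "(k', \<gamma>', B') \<in> ?A" for k \<gamma> B k' \<gamma>' B'
  proof -
    obtain S where B: "B = {c. S (y - const c)}" and S: "\<And>u w. S u \<Longrightarrow> vrel v u w \<Longrightarrow> S w" using up[OF BA] by blast
    obtain S' where B': "B' = {c. S' (y - const c)}" and S': "\<And>u w. S' u \<Longrightarrow> vrel v u w \<Longrightarrow> S' w" using up[OF B'A] by blast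
    show ?thesis
    proof (rule ccontr)
      assume "\<not> (B \<subseteq> B' \<or> B' \<subseteq> B)"
      then obtain c c' where "S (y - const c)" "\<not> S' (y - const c)" "S' (y - const c')" "\<not> S (y - const c')"
        unfolding B B' by blast
      then show False using S S' L.total by blast
    qed
  qed
  have down: "(Closed, \<beta>, closed_ball v0 \<beta> c) \<in> ?A \<and> (Open, \<beta>, open_ball v0 \<beta> c) \<in> ?A"
    if 1: "(Closed, \<gamma>, closed_ball v0 \<gamma> c) \<in> ?A \<or> (Open, \<gamma>, open_ball v0 \<gamma> c) \<in> ?A"
      and 2: "\<beta> \<in> Some ` carrier (vgroup v0)" and 3: "vless v0 \<beta> \<gamma>" for \<gamma> c \<beta>
  proof -
    obtain e where e: "\<gamma> = val v0 e" using 1 unfolding appr_mem_iff by (elim disjE exE conjE) simp_all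
    obtain f where f: "\<beta> = val v0 f" "f \<noteq> 0" using 2 unfolding Some_carrier_eq[OF v0] by blast
    have fe: "\<not> vrel v0 e f" using 3 e f vless_iff[OF v0] by simp
    have "closed_at v0 ?A e c \<or> open_at v0 ?A e c" using 1 by (simp add: e closed_at_def open_at_def)
    then have "vrel v (const e) (y - const c)"
      unfolding closed_at_appr open_at_appr using L.lt_imp_le by blast
    moreover have "\<not> vrel v (const e) (const f)" using fe by simp
    ultimately have "\<not> vrel v (y - const c) (const f)" using L.trans by blast
    then have "closed_at v0 ?A f c \<and> open_at v0 ?A f c"
      unfolding closed_at_appr open_at_appr using L.lt_imp_le f(2) by blast
    then show ?thesis by (simp add: f closed_at_def open_at_def)
  qed
  have oc: "(Closed, \<gamma>, closed_ball v0 \<gamma> c) \<in> ?A" if 1: "(Open, \<gamma>, open_ball v0 \<gamma> c) \<in> ?A" for \<gamma> c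
  proof -
    obtain e where e: "\<gamma> = val v0 e" using 1 unfolding appr_mem_iff by (elim exE conjE) simp_all
    have "open_at v0 ?A e c" using 1 by (simp add: e open_at_def)
    then have "closed_at v0 ?A e c"
      unfolding closed_at_appr open_at_appr using L.lt_imp_le by blast
    then show ?thesis by (simp add: e closed_at_def)
  qed
  show "approximation_type v0 ?A"
    unfolding approximation_type_def
  proof (intro conjI sub)
    show "\<forall>(k, \<gamma>, B)\<in>?A. \<forall>(k', \<gamma>', B')\<in>?A. B \<subseteq> B' \<or> B' \<subseteq> B"
      by (intro ballI case_prodI2) (rule comp, simp_all)
    show "\<forall>\<gamma> c \<beta>. ((Closed, \<gamma>, closed_ball v0 \<gamma> c) \<in> ?A \<or> (Open, \<gamma>, open_ball v0 \<gamma> c) \<in> ?A) \<and>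
        \<beta> \<in> Some ` carrier (vgroup v0) \<and> vless v0 \<beta> \<gamma> \<longrightarrow>
        (Closed, \<beta>, closed_ball v0 \<beta> c) \<in> ?A \<and> (Open, \<beta>, open_ball v0 \<beta> c) \<in> ?A"
      by (intro allI impI, elim conjE, rule down)
    show "\<forall>\<gamma> c. (Open, \<gamma>, open_ball v0 \<gamma> c) \<in> ?A \<longrightarrow> (Closed, \<gamma>, closed_ball v0 \<gamma> c) \<in> ?A"
      by (intro allI impI, rule oc)
  qed
qed

end

section \<open>Immediate approximation types\<close>

text \<open>Polynomials are Lipschitz on balls, by Horner's scheme. The evaluation \<open>E\<close> and the embedding \<open>j\<close>
  are parameters because the lemma serves polynomials over \<open>K\<close> both on \<open>K\<close> and on \<open>K(x)\<close>. In the
  second case it matters that the Lipschitz constant \<open>m\<close> still lies in \<open>K\<close>.\<close>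

lemma (in field_valuation) poly_lipschitz:
  fixes E :: "'k::field poly \<Rightarrow> 'f \<Rightarrow> 'f" and j :: "'k \<Rightarrow> 'f"
  assumes E0: "\<And>y. E 0 y = 0" and Ep: "\<And>a p y. E (pCons a p) y = j a + y * E p y"
    and j_mult: "\<And>a b. j (a * b) = j a * j b" and j0: "\<And>a. j a = 0 \<longleftrightarrow> a = 0"
  shows "\<exists>m. m \<noteq> 0 \<and> (\<forall>y z. le (j b) y \<longrightarrow> le (j b) z \<longrightarrow>
    le (j m) (E p y) \<and> le (j m * (y - z)) (E p y - E p z))"
proof (induction p)
  case 0
  show ?case by (intro exI[of _ 1]) (simp add: E0 zero)
next
  case (pCons a p)
  have lower: "\<exists>m. m \<noteq> 0 \<and> le (j m) (j c) \<and> le (j m) (j d)" for c d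
  proof (cases "c = 0 \<or> d = 0")
    case True
    have "j 0 = 0" using j0 by blast
    then show ?thesis
      using True zero[of "j c"] zero[of "j d"] zero[of "j 1"] by (metis refl one_neq_zero)
  next
    case False
    then show ?thesis using total[of "j c" "j d"] refl by metis
  qed
  obtain m where m: "m \<noteq> 0" "\<And>y z. le (j b) y \<Longrightarrow> le (j b) z \<Longrightarrow> le (j m) (E p y) \<and> le (j m * (y - z)) (E p y - E p z)"
    using pCons.IH by blast
  obtain n where n: "n \<noteq> 0" "le (j n) (j a)" "le (j n) (j m)" using lower by blast
  obtain k where k: "k \<noteq> 0" "le (j k) (j n)" "le (j k) (j (b * m))" using lower by blast
  have km: "le (j k) (j m)" using k(2) n(3) trans by blast
  have ka: "le (j k) (j a)" using k(2) n(2) trans by blast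
  have "le (j k) (E (pCons a p) y) \<and> le (j k * (y - z)) (E (pCons a p) y - E (pCons a p) z)"
    if y: "le (j b) y" and z: "le (j b) z" for y z
  proof
    have "le (j b * j m) (y * E p y)" using m(2)[OF y y] y mult_mono by blast
    then have "le (j k) (y * E p y)" using k(3) trans unfolding j_mult by blast
    then show "le (j k) (E (pCons a p) y)" unfolding Ep using ka add by blast
    have eq: "E (pCons a p) y - E (pCons a p) z = y * (E p y - E p z) + (y - z) * E p z"
      by (simp add: Ep algebra_simps)
    have "le (j b * (j m * (y - z))) (y * (E p y - E p z))"
      using mult_mono[OF y conjunct2[OF m(2)[OF y z]]] .
    moreover have "le (j k * (y - z)) (j b * (j m * (y - z)))"
      using mult_mono[OF k(3)[unfolded j_mult] refl, of "y - z"] by (simp add: mult.assoc)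
    ultimately have 1: "le (j k * (y - z)) (y * (E p y - E p z))" using trans by blast
    have "le (j m) (E p z)" using m(2)[OF z z] by blast
    then have "le (j k) (E p z)" using km trans by blast
    from mult_mono[OF this refl, of "y - z"] have "le (j k * (y - z)) ((y - z) * E p z)"
      by (simp add: mult.commute)
    with 1 show "le (j k * (y - z)) (E (pCons a p) y - E (pCons a p) z)" unfolding eq by (rule add)
  qed
  then show ?case using k(1) by blast
qed

locale immediate_approx = approx +
  assumes imm: "immediate_type A"
begin

lemma cl_nonzero: "cl e c \<Longrightarrow> e \<noteq> 0"
  using imm trivial_type_iff unfolding immediate_type_def by blast

lemma cl_ex: "\<exists>e c. cl e c"
proof -
  have "A \<noteq> {}" using imm by (simp add: immediate_type_def)
  then obtain k \<gamma> B where *: "(k, \<gamma>, B) \<in> A" by (metis all_not_in_conv surj_pair)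
  show ?thesis
  proof (cases k)
    case Closed
    then show ?thesis using in_A(1)[of \<gamma> B] * unfolding closed_at_def by metis
  next
    case Open
    then show ?thesis using in_A(2)[of \<gamma> B] * open_imp_closed unfolding open_at_def by metis
  qed
qed

text \<open>An open ball of an immediate type contains a closed ball of the type, because the open ball
  is not the smallest one. So the closed balls alone already miss every point.\<close>

lemma missed: "\<exists>e c. cl e c \<and> \<not> cl e a"
proof (rule ccontr)
  assume neg: "\<not> (\<exists>e c. cl e c \<and> \<not> cl e a)"
  have no: "b \<notin> Inter_type A" for b using imm by (simp add: immediate_type_def)
  obtain e c where c: "op e c" "\<not> op e a" using no[of a] neg unfolding mem_Inter_type by blast
  have ea: "cl e a" using neg open_imp_closed[OF c(1)] by blast
  have *: False if f: "cl f c'" "K.lt e f" for f c'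
  proof -
    have "cl f a" using neg f(1) by blast
    then have "op e a" using smaller_radius(2)[OF disjI1 f(2)] by blast
    then show False using c(2) by blast
  qed
  consider f c' where "cl f c'" "\<not> cl f c" | f c' where "op f c'" "\<not> op f c"
    using no[of c] unfolding mem_Inter_type by blast
  then show False
  proof cases
    case 1
    then have "K.lt e f" using closed_at_mono[OF open_imp_closed[OF c(1)], of f] by blast
    then show False using * 1(1) by blast
  next
    case 2
    then have "K.lt e f" using open_at_mono[OF c(1), of f] by blast
    then show False using * open_imp_closed[OF 2(1)] by blast
  qed
qed

text \<open>The radii of an immediate type have no maximum, hence the value group is not trivial.\<close>

lemma larger: "a \<noteq> 0 \<Longrightarrow> \<exists>e. e \<noteq> 0 \<and> K.lt a e"
proof (rule ccontr)
  assume a: "a \<noteq> 0" and neg: "\<not> (\<exists>e. e \<noteq> 0 \<and> K.lt a e)"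
  obtain e0 c0 where 0: "cl e0 c0" using cl_ex by blast
  obtain e c where e: "cl e c" "\<not> cl e c0" using missed by blast
  have "K.lt e0 e" using closed_at_mono[OF 0, of e] e by blast
  then have "K.lt a (a * e / e0)" using a cl_nonzero[OF 0] by (simp add: K.divide_le_iff)
  moreover have "a * e / e0 \<noteq> 0" using a cl_nonzero[OF 0] cl_nonzero[OF e(1)] by simp
  ultimately show False using neg by blast
qed

definition Fil :: "'a filter" where
  "Fil = (INF e\<in>{e. \<exists>c. cl e c}. principal {c. cl e c})"

lemma eventually_Fil: "eventually P Fil \<longleftrightarrow> (\<exists>e c. cl e c \<and> (\<forall>c'. cl e c' \<longrightarrow> P c'))"
proof -
  have "eventually P Fil \<longleftrightarrow> (\<exists>e\<in>{e. \<exists>c. cl e c}. eventually P (principal {c. cl e c}))"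
    unfolding Fil_def
  proof (rule eventually_INF_base)
    show "{e. \<exists>c. cl e c} \<noteq> {}" using cl_ex by blast
    fix e f assume "e \<in> {e. \<exists>c. cl e c}" "f \<in> {e. \<exists>c. cl e c}"
    then have ef: "\<exists>c. cl e c" "\<exists>c. cl f c" by simp_all
    show "\<exists>d\<in>{e. \<exists>c. cl e c}. principal {c. cl d c} \<le> inf (principal {c. cl e c}) (principal {c. cl f c})"
    proof (cases "le0 e f")
      case True
      then have "{c. cl f c} \<subseteq> {c. cl e c}" using closed_at_mono by blast
      then show ?thesis using ef(2) by (intro bexI[of _ f]) auto
    next
      case False
      then have "le0 f e" using K.lt_imp_le by blast
      then have "{c. cl e c} \<subseteq> {c. cl f c}" using closed_at_mono by blast
      then show ?thesis using ef(1) by (intro bexI[of _ e]) auto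
    qed
  qed
  then show ?thesis by (auto simp: eventually_principal)
qed

lemma Fil_nontrivial [simp]: "Fil \<noteq> bot"
  using eventually_Fil[of "\<lambda>_. False"] by (auto simp: trivial_limit_def)

lemma eventually_ex: "eventually P Fil \<Longrightarrow> \<exists>c. P c"
  using eventually_happens[of P Fil] by auto

lemma eventually_cl: "cl e c \<Longrightarrow> eventually (cl e) Fil"
  unfolding eventually_Fil by blast

lemma eventually_neq: "eventually (\<lambda>c. c \<noteq> a) Fil"
  unfolding eventually_Fil using missed[of a] by blast

text \<open>As \<open>c\<close> runs through smaller and smaller balls, the values \<open>v\<^sub>0 (g c)\<close> may become constant and finite,
  or they may exceed every bound.\<close>

definition stable :: "'a poly \<Rightarrow> bool" where
  "stable g \<longleftrightarrow> (\<exists>a. a \<noteq> 0 \<and> eventually (\<lambda>c. K.eqv (poly g c) a) Fil)"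

definition null :: "'a poly \<Rightarrow> bool" where
  "null g \<longleftrightarrow> (\<forall>e. e \<noteq> 0 \<longrightarrow> eventually (\<lambda>c. le0 e (poly g c)) Fil)"

lemma stable_const: "a \<noteq> 0 \<Longrightarrow> stable [:a:]"
  unfolding stable_def by (intro exI[of _ a]) simp

lemma stable_mult: "stable g \<Longrightarrow> stable h \<Longrightarrow> stable (g * h)"
proof -
  assume "stable g" "stable h"
  then obtain a b where ab: "a \<noteq> 0" "b \<noteq> 0"
    "eventually (\<lambda>c. K.eqv (poly g c) a) Fil" "eventually (\<lambda>c. K.eqv (poly h c) b) Fil"
    unfolding stable_def by blast
  from ab(3,4) have "eventually (\<lambda>c. K.eqv (poly (g * h) c) (a * b)) Fil"
    by eventually_elim (simp add: K.mult_mono)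
  then show ?thesis unfolding stable_def using ab(1,2) by (intro exI[of _ "a * b"]) simp
qed

lemma stable_nonzero: "stable g \<Longrightarrow> g \<noteq> 0"
proof
  assume "stable g" "g = 0"
  then obtain a where a: "a \<noteq> 0" "eventually (\<lambda>c. K.eqv 0 a) Fil" unfolding stable_def by auto
  then have "K.eqv 0 a" using eventually_ex by blast
  then show False using a(1) by simp
qed

lemma stable_eventually_nonzero: "stable g \<Longrightarrow> eventually (\<lambda>c. poly g c \<noteq> 0) Fil"
proof -
  assume "stable g"
  then obtain a where a: "a \<noteq> 0" "eventually (\<lambda>c. K.eqv (poly g c) a) Fil" unfolding stable_def by blast
  from a(2) show ?thesis by eventually_elim (use a(1) in auto)
qed

lemma null_not_stable: "null g \<Longrightarrow> \<not> stable g"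
proof
  assume "null g" "stable g"
  then obtain a where a: "a \<noteq> 0" "eventually (\<lambda>c. K.eqv (poly g c) a) Fil" unfolding stable_def by blast
  obtain e where e: "e \<noteq> 0" "K.lt a e" using larger[OF a(1)] by blast
  have "eventually (\<lambda>c. le0 e (poly g c)) Fil" using \<open>null g\<close> e(1) unfolding null_def by blast
  with a(2) have "eventually (\<lambda>c. False) Fil"
    by eventually_elim (use e(2) K.trans in blast)
  then show False by simp
qed

lemma lipschitz_tail:
  "\<exists>m e c0. m \<noteq> 0 \<and> cl e c0 \<and> (\<forall>c c'. cl e c \<longrightarrow> cl e c' \<longrightarrow>
     le0 m (poly h c) \<and> le0 (m * (c - c')) (poly h c - poly h c'))"
proof -
  obtain e c0 where e: "cl e c0" using cl_ex by blast
  obtain b where b: "le0 b e" "le0 b c0" using K.total[of e c0] K.refl by blast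
  obtain m where m: "m \<noteq> 0" "\<And>y z. le0 b y \<Longrightarrow> le0 b z \<Longrightarrow> le0 m (poly h y) \<and> le0 (m * (y - z)) (poly h y - poly h z)"
    using K.poly_lipschitz[of poly "\<lambda>x. x" b h] by (auto simp: algebra_simps)
  have "le0 b c" if "cl e c" for c
  proof -
    have "le0 e (c - c0)" using closed_at_iff[OF e] that by blast
    then have "le0 b (c - c0 + c0)" using b K.trans K.add by blast
    then show ?thesis by simp
  qed
  then show ?thesis using e m by blast
qed

lemma bounded_tail: "\<exists>m. m \<noteq> 0 \<and> eventually (\<lambda>c. le0 m (poly h c)) Fil"
proof -
  obtain m e c0 where m: "m \<noteq> 0" "cl e c0" "\<And>c. cl e c \<Longrightarrow> le0 m (poly h c)"
    using lipschitz_tail[of h] by blast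
  then show ?thesis unfolding eventually_Fil by blast
qed

lemma null_mult: "null g \<Longrightarrow> null (h * g)"
  unfolding null_def
proof (intro allI impI)
  fix e :: 'a assume g: "\<forall>e. e \<noteq> 0 \<longrightarrow> eventually (\<lambda>c. le0 e (poly g c)) Fil" and e: "e \<noteq> 0"
  obtain m where m: "m \<noteq> 0" "eventually (\<lambda>c. le0 m (poly h c)) Fil" using bounded_tail by blast
  have "eventually (\<lambda>c. le0 (e / m) (poly g c)) Fil" using g e m(1) by simp
  with m(2) show "eventually (\<lambda>c. le0 e (poly (h * g) c)) Fil"
  proof eventually_elim
    case (elim c)
    from K.mult_mono[OF elim] show ?case using m(1) by simp
  qed
qed

lemma null_diff: "null g \<Longrightarrow> null h \<Longrightarrow> null (g - h)"
  unfolding null_def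
proof (intro allI impI)
  fix e :: 'a assume g: "\<forall>e. e \<noteq> 0 \<longrightarrow> eventually (\<lambda>c. le0 e (poly g c)) Fil"
    and h: "\<forall>e. e \<noteq> 0 \<longrightarrow> eventually (\<lambda>c. le0 e (poly h c)) Fil" and e: "e \<noteq> 0"
  from g[rule_format, OF e] h[rule_format, OF e]
  show "eventually (\<lambda>c. le0 e (poly (g - h) c)) Fil"
    by eventually_elim (simp add: K.diff)
qed

text \<open>If \<open>g\<close> does not tend to \<open>0\<close>, every small ball contains a centre \<open>c0\<close> at which the value of \<open>g\<close> stays
  below a fixed bound. On a sufficiently small ball the Lipschitz estimate pushes the value of
  \<open>g(c) - g(c0)\<close> above that bound, so \<open>g\<close> has constant value there.\<close>

lemma unstable_null:
  assumes full: "\<And>e. e \<noteq> 0 \<Longrightarrow> \<exists>c. cl e c" and g: "\<not> stable g"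
  shows "null g"
  unfolding null_def
proof (intro allI impI, rule ccontr)
  fix e :: 'a assume e: "e \<noteq> 0" and neg: "\<not> eventually (\<lambda>c. le0 e (poly g c)) Fil"
  obtain m e1 c1 where m: "m \<noteq> 0" "cl e1 c1"
    "\<And>c c'. cl e1 c \<Longrightarrow> cl e1 c' \<Longrightarrow> le0 (m * (c - c')) (poly g c - poly g c')"
    using lipschitz_tail[of g] by blast
  obtain e2 where e2: "e2 \<noteq> 0" "le0 e1 e2" "le0 (e / m) e2"
    using K.total[of e1 "e / m"] K.refl cl_nonzero[OF m(2)] e m(1) by (metis divide_eq_0_iff)
  obtain c2 where c2: "cl e2 c2" using full e2(1) by blast
  obtain c0 where c0: "cl e2 c0" "K.lt (poly g c0) e" using neg c2 unfolding eventually_Fil by blast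
  have "K.eqv (poly g c) (poly g c0)" if c: "cl e2 c" for c
  proof -
    have "le0 e2 (c - c0)" using closed_at_iff[OF c0(1)] c by blast
    then have "le0 (e / m) (c - c0)" using e2(3) K.trans by blast
    then have "le0 e (m * (c - c0))" using K.mult[of "e / m" "c - c0" m] m(1) by simp
    moreover have "le0 (m * (c - c0)) (poly g c - poly g c0)"
      using m(3) closed_at_mono[OF c e2(2)] closed_at_mono[OF c0(1) e2(2)] by blast
    ultimately have "K.lt (poly g c0) (poly g c - poly g c0)" using c0(2) K.trans by blast
    then show ?thesis using K.diff_eqv by blast
  qed
  then have "eventually (\<lambda>c. K.eqv (poly g c) (poly g c0)) Fil"
    unfolding eventually_Fil using c0(1) by blast
  moreover have "poly g c0 \<noteq> 0" using K.lt_nonzero[OF c0(2)] .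
  ultimately show False using g unfolding stable_def by blast
qed

text \<open>The value \<open>\<infinity>\<close> cannot be the constant one: the balls avoid the finitely many zeros of \<open>g\<close>.\<close>

lemma transcendental_stable:
  assumes tr: "transcendental_immediate_type v0 A" and g: "g \<noteq> 0"
  shows "stable g"
proof -
  obtain e c where ec: "cl e c" "\<And>c'. cl e c' \<Longrightarrow> K.eqv (poly g c') (poly g c)"
    using tr unfolding transcendental_immediate_iff by blast
  have ev: "eventually (\<lambda>c'. K.eqv (poly g c') (poly g c)) Fil"
    unfolding eventually_Fil using ec by blast
  have "poly g c \<noteq> 0"
  proof
    assume 0: "poly g c = 0"
    have "finite {r. poly g r = 0}" using poly_roots_finite[OF g] .
    then have "eventually (\<lambda>c'. \<forall>r\<in>{r. poly g r = 0}. c' \<noteq> r) Fil"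
      using eventually_neq by (intro eventually_ball_finite) auto
    with ev have "eventually (\<lambda>c'. False) Fil"
      by eventually_elim (auto simp: 0)
    then show False by simp
  qed
  then show ?thesis unfolding stable_def using ev by blast
qed

lemma stable_transcendental:
  assumes "\<And>g. g \<noteq> 0 \<Longrightarrow> stable g"
  shows "transcendental_immediate_type v0 A"
  unfolding transcendental_immediate_iff
proof (intro conjI imm allI)
  fix f
  show "\<exists>e c. cl e c \<and> (\<forall>c'. cl e c' \<longrightarrow> K.eqv (poly f c') (poly f c))"
  proof (cases "f = 0")
    case True
    then show ?thesis using cl_ex by simp
  next
    case False
    then obtain a where "eventually (\<lambda>c. K.eqv (poly f c) a) Fil" using assms unfolding stable_def by blast
    then show ?thesis unfolding eventually_Fil using K.trans by blast
  qed
qed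

end

lemma fract_cases:
  obtains r s :: "'a::idom" where "s \<noteq> 0" "u = to_fract r / to_fract s"
  by (cases u) (auto simp: Fract_conv_to_fract)

text \<open>Transcendental immediate types satisfy the first alternative, completion types the second. In
  both cases a polynomial is either stable or null, which is all that the construction of the
  extension uses.\<close>

locale dense_approx = immediate_approx +
  assumes dense: "(\<forall>g. g \<noteq> 0 \<longrightarrow> stable g) \<or> (\<forall>e. e \<noteq> 0 \<longrightarrow> (\<exists>c. cl e c))"
begin

lemma not_stable_iff: "\<not> stable g \<longleftrightarrow> null g"
proof
  assume "\<not> stable g"
  from dense show "null g"
  proof
    assume "\<forall>g. g \<noteq> 0 \<longrightarrow> stable g"
    with \<open>\<not> stable g\<close> have "g = 0" by blast
    then show ?thesis by (simp add: null_def K.zero)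
  qed (use unstable_null \<open>\<not> stable g\<close> in blast)
qed (rule null_not_stable)

text \<open>The polynomials tending to \<open>0\<close> form an ideal of \<open>K[X]\<close>, so one of least degree divides the others.
  For a completion type it is the minimal polynomial of the limit in the completion.\<close>

lemma null_generator:
  assumes "f0 \<noteq> 0" "null f0"
  obtains f where "f \<noteq> 0" "null f" "degree f > 0" "\<And>g. null g \<Longrightarrow> f dvd g"
proof -
  define f where "f = (ARG_MIN degree f. f \<noteq> 0 \<and> null f)"
  have f: "f \<noteq> 0" "null f" and f_min: "\<And>g. g \<noteq> 0 \<Longrightarrow> null g \<Longrightarrow> degree f \<le> degree g"
    using arg_min_nat_lemma[of "\<lambda>f. f \<noteq> 0 \<and> null f" f0 degree] assms unfolding f_def by auto
  have "degree f > 0"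
  proof (rule ccontr)
    assume "\<not> degree f > 0"
    then obtain a where "f = [:a:]" by (metis degree_eq_zeroE gr_zeroI)
    then show False using f null_not_stable stable_const by auto
  qed
  moreover have "f dvd g" if "null g" for g
  proof (rule ccontr)
    assume "\<not> f dvd g"
    then have "g mod f \<noteq> 0" by (simp add: dvd_eq_mod_eq_0)
    moreover have "null (g mod f)"
      using null_diff[OF that null_mult[OF f(2), of "g div f"]] by (simp add: minus_div_mult_eq_mod)
    ultimately show False using f_min[of "g mod f"] degree_mod_less[OF f(1), of g] by linarith
  qed
  ultimately show thesis using that f by blast
qed

text \<open>When both polynomials tend to \<open>0\<close>, the generator of the ideal can be cancelled.\<close>

lemma reduce_fraction:
  assumes "r \<noteq> 0" "s \<noteq> 0"
  shows "\<exists>g r' s'. r = g * r' \<and> s = g * s' \<and> (stable r' \<or> stable s')"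
  using assms
proof (induction "degree r" arbitrary: r s rule: less_induct)
  case less
  show ?case
  proof (cases "stable r \<or> stable s")
    case True
    then show ?thesis by (intro exI[of _ 1] exI[of _ r] exI[of _ s]) simp
  next
    case False
    then have null: "null r" "null s" by (simp_all add: not_stable_iff[symmetric])
    obtain f where f: "f \<noteq> 0" "null f" "degree f > 0" "\<And>g. null g \<Longrightarrow> f dvd g"
      using null_generator[OF less.prems(1) null(1)] by blast
    obtain r1 where r1: "r = f * r1" using f(4)[OF null(1)] by (rule dvdE)
    obtain s1 where s1: "s = f * s1" using f(4)[OF null(2)] by (rule dvdE)
    have "r1 \<noteq> 0" "s1 \<noteq> 0" using less.prems r1 s1 by auto
    moreover from this have "degree r1 < degree r" unfolding r1 using f(1,3) by (simp add: degree_mult_eq)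
    ultimately obtain g r' s' where "r1 = g * r'" "s1 = g * s'" "stable r' \<or> stable s'"
      using less.hyps by blast
    then have "r = f * g * r' \<and> s = f * g * s' \<and> (stable r' \<or> stable s')"
      using r1 s1 by (simp add: mult.assoc)
    then show ?thesis by blast
  qed
qed

lemma reduced_fraction:
  assumes "u \<noteq> 0"
  obtains r s where "u = to_fract r / to_fract s" "r \<noteq> 0" "s \<noteq> 0" "stable r \<or> stable s"
proof -
  obtain r s where rs: "s \<noteq> 0" "u = to_fract r / to_fract s" by (rule fract_cases)
  have r0: "r \<noteq> 0" using rs assms by auto
  obtain g r' s' where g: "r = g * r'" "s = g * s'" "stable r' \<or> stable s'"
    using reduce_fraction[OF r0 rs(1)] by blast
  have nz: "g \<noteq> 0" "r' \<noteq> 0" "s' \<noteq> 0" using r0 rs(1) g by auto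
  have "u = to_fract r' / to_fract s'" using rs(2) g nz by simp
  then show thesis using that nz g(3) by blast
qed

lemma stable_le_null:
  assumes "stable h" "null k"
  shows "eventually (\<lambda>c. le0 (poly h c) (poly k c)) Fil"
proof -
  obtain a where a: "a \<noteq> 0" "eventually (\<lambda>c. K.eqv (poly h c) a) Fil" using assms(1) unfolding stable_def by blast
  have "eventually (\<lambda>c. le0 a (poly k c)) Fil" using assms(2) a(1) unfolding null_def by blast
  with a(2) show ?thesis by eventually_elim (use K.trans in blast)
qed

lemma power_decomposition:
  assumes f: "degree f > 0" "\<And>g. null g \<Longrightarrow> f dvd g" and g: "g \<noteq> 0"
  shows "\<exists>k g'. g = f ^ k * g' \<and> stable g'"
  using g
proof (induction "degree g" arbitrary: g rule: less_induct)
  case less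
  show ?case
  proof (cases "stable g")
    case True
    then show ?thesis by (intro exI[of _ 0] exI[of _ g]) simp
  next
    case False
    then obtain g1 where g1: "g = f * g1" using f(2) not_stable_iff by (auto elim: dvdE)
    then have nz: "f \<noteq> 0" "g1 \<noteq> 0" using less.prems by auto
    then have "degree g1 < degree g" unfolding g1 using f(1) by (simp add: degree_mult_eq)
    then obtain k g' where "g1 = f ^ k * g'" "stable g'" using less.hyps nz by blast
    then have "g = f ^ Suc k * g' \<and> stable g'" using g1 by (simp add: mult.assoc)
    then show ?thesis by blast
  qed
qed

text \<open>This is the order of values on \<open>K(x)\<close> that the balls prescribe: \<open>v (r / s) \<ge> 0\<close> is tested on the centres
  \<open>c\<close>. Only the denominator has to be stable, as a numerator that tends to \<open>0\<close> is eventually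
  divisible by it.\<close>

definition dense_le :: "'a poly fract \<Rightarrow> 'a poly fract \<Rightarrow> bool" where
  "dense_le u w \<longleftrightarrow> w = 0 \<or> (\<exists>r s. stable s \<and> eventually (\<lambda>c. le0 (poly s c) (poly r c)) Fil
      \<and> w = u * (to_fract r / to_fract s))"

end

locale dense_ext = dense_approx v0 A + valuation_extension "vrel v0" le
  for v0 :: "('a::field, 'g) valuation" and A le +
  assumes cl_iff: "closed_at v0 A e c \<longleftrightarrow> le (const e) (var_x - const c)"
begin

lemma eventually_closer: "eventually (\<lambda>c. L.lt (var_x - const a) (var_x - const c)) Fil"
proof -
  obtain e c where e: "cl e c" "\<not> cl e a" using missed by blast
  from eventually_cl[OF e(1)] show ?thesis
  proof eventually_elim
    case (elim c)
    show ?case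
    proof
      assume "le (var_x - const c) (var_x - const a)"
      moreover have "le (const e) (var_x - const c)" using elim cl_iff by blast
      ultimately have "le (const e) (var_x - const a)" using L.trans by blast
      then show False using e(2) cl_iff by blast
    qed
  qed
qed

text \<open>Kaplansky's theorem, by induction on the degree. Fix one centre \<open>c1\<close> and write
  \<open>g - g(c1) = (X - c1) q\<close>. By induction \<open>q(x)\<close> has the leading term \<open>q(c)\<close> for all closer centres
  \<open>c\<close>, and \<open>x - c1\<close> has the leading term \<open>c - c1\<close>. So \<open>g(x) - g(c1)\<close> has the leading term
  \<open>g(c) - g(c1)\<close>, and their difference \<open>g(x) - g(c)\<close> has larger value than
  \<open>g(c) - g(c1)\<close>, which in turn is not smaller than the constant value of \<open>g\<close> on the centres.\<close>

lemma near_if_all_stable: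
  assumes st: "\<And>g. g \<noteq> 0 \<Longrightarrow> stable g" and "g \<noteq> 0"
  shows "eventually (\<lambda>c. L.near (to_fract g) (const (poly g c))) Fil"
  using assms(2)
proof (induction "degree g" arbitrary: g rule: less_induct)
  case less
  obtain a where a: "a \<noteq> 0" "eventually (\<lambda>c. K.eqv (poly g c) a) Fil"
    using st[OF less.prems] unfolding stable_def by blast
  obtain c1 where c1: "K.eqv (poly g c1) a" using eventually_ex[OF a(2)] by blast
  define h where "h = g - [:poly g c1:]"
  have "poly h c1 = 0" by (simp add: h_def)
  then have "[:- c1, 1:] dvd h" by (simp only: poly_eq_0_iff_dvd)
  then obtain q where q: "h = [:- c1, 1:] * q" by (rule dvdE)
  show ?case
  proof (cases "q = 0")
    case True
    then have g: "g = [:poly g c1:]" using q by (simp add: h_def)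
    have "L.near (to_fract g) (const (poly g c))" for c
    proof -
      obtain k where k: "g = [:k:]" using g by blast
      then have "to_fract g = const k" "poly g c = k" "k \<noteq> 0"
        using less.prems by (auto simp: const_def)
      then show ?thesis using L.near_refl[of "const k"] by simp
    qed
    then show ?thesis by simp
  next
    case False
    have "[:- c1, 1:] \<noteq> 0" by simp
    then have dh: "degree h = Suc (degree q)" unfolding q using False by (subst degree_mult_eq) auto
    have "degree h \<le> degree g" unfolding h_def by (rule degree_diff_le) auto
    then have "degree q < degree g" using dh by simp
    from less.hyps[OF this False]
    have IH: "eventually (\<lambda>c. L.near (to_fract q) (const (poly q c))) Fil" .
    have eq: "to_fract h = (var_x - const c1) * to_fract q"
    proof -
      have "to_fract [:- c1, 1:] = var_x - const c1"
        by (simp add: var_x_def const_def flip: to_fract_diff)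
      then show ?thesis unfolding q to_fract_mult by simp
    qed
    from a(2) IH eventually_closer[of c1] show ?thesis
    proof eventually_elim
      case (elim c)
      have "L.eqv (var_x - const c1 - (var_x - const c)) (var_x - const c1)"
        using L.diff_eqv'[OF elim(3)] by blast
      then have "L.eqv (const (c - c1)) (var_x - const c1)" by simp
      then have "L.lt (const (c - c1)) (var_x - const c)" using elim(3) L.trans by blast
      moreover have "var_x - const c1 - const (c - c1) = var_x - const c" by simp
      ultimately have "L.near (var_x - const c1) (const (c - c1))" by simp
      from L.near_mult[OF this elim(2)]
      have nr: "L.lt (const (poly h c)) (to_fract h - const (poly h c))"
        unfolding eq unfolding q poly_mult by simp
      have hc: "to_fract h - const (poly h c) = to_fract g - const (poly g c)"
        by (simp add: h_def flip: const_def)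
      have "le0 a (poly h c)"
        using elim(1) c1 K.diff[of a "poly g c" "poly g c1"] by (simp add: h_def)
      then have "le0 (poly g c) (poly h c)" using elim(1) K.trans by blast
      then have "le (const (poly g c)) (const (poly h c))" by simp
      then show ?case using nr L.trans unfolding hc by blast
    qed
  qed
qed

text \<open>With the full value group as support, \<open>x\<close> is the limit of the centres, and polynomials are
  continuous.\<close>

lemma continuity:
  assumes full: "\<forall>e. e \<noteq> 0 \<longrightarrow> (\<exists>c. cl e c)" and e: "e \<noteq> 0"
  shows "eventually (\<lambda>c. le (const e) (to_fract g - const (poly g c))) Fil"
proof -
  obtain e1 c1 where e1: "cl e1 c1" using cl_ex by blast
  obtain b where b: "le0 b e1" "le0 b c1" using K.total[of e1 c1] K.refl by blast
  then have cb: "le (const b) (const e1)" "le (const b) (const c1)" by simp_all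
  obtain m where m: "m \<noteq> 0" "\<And>y z. le (const b) y \<Longrightarrow> le (const b) z \<Longrightarrow>
      le (const m * (y - z)) (peval g y - peval g z)"
    using L.poly_lipschitz[of peval const b g] by auto
  have "le (const b) (var_x - const c1 + const c1)"
    using e1 cb L.trans unfolding cl_iff by (blast intro: L.add)
  then have x: "le (const b) var_x" by simp
  obtain c2 where c2: "cl (e / m) c2" using full[rule_format, of "e / m"] e m(1) by auto
  from eventually_cl[OF e1] eventually_cl[OF c2] show ?thesis
  proof eventually_elim
    case (elim c)
    have "le (const b) (var_x - const c)" using elim(1) cb L.trans unfolding cl_iff by blast
    from L.diff[OF x this] have "le (const b) (const c)" by simp
    from m(2)[OF x this] have "le (const m * (var_x - const c)) (to_fract g - const (poly g c))"
      by (simp add: peval_var_x)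
    moreover have "le (const m * const (e / m)) (const m * (var_x - const c))"
      using elim(2) unfolding cl_iff by (rule L.mult)
    moreover have "const m * const (e / m) = const e" using m(1) by simp
    ultimately show ?case using L.trans by metis
  qed
qed

lemma stable_near:
  assumes "stable g"
  shows "eventually (\<lambda>c. L.near (to_fract g) (const (poly g c))) Fil"
  using dense
proof
  assume "\<forall>g. g \<noteq> 0 \<longrightarrow> stable g"
  then show ?thesis using near_if_all_stable stable_nonzero[OF assms] by blast
next
  assume full: "\<forall>e. e \<noteq> 0 \<longrightarrow> (\<exists>c. cl e c)"
  obtain a where a: "a \<noteq> 0" "eventually (\<lambda>c. K.eqv (poly g c) a) Fil"
    using assms unfolding stable_def by blast
  obtain e where e: "e \<noteq> 0" "K.lt a e" using larger[OF a(1)] by blast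
  from a(2) continuity[OF full e(1), of g] show ?thesis
  proof eventually_elim
    case (elim c)
    have "L.lt (const (poly g c)) (const e)" using elim(1) e(2) K.trans by (simp) blast
    then show ?case using elim(2) L.trans by blast
  qed
qed

lemma null_above:
  assumes "null g" "e \<noteq> 0"
  shows "L.lt (const e) (to_fract g)"
  using dense
proof
  assume "\<forall>g. g \<noteq> 0 \<longrightarrow> stable g"
  then have "g = 0" using null_not_stable[OF assms(1)] by blast
  then show ?thesis using assms(2) by simp
next
  assume full: "\<forall>e. e \<noteq> 0 \<longrightarrow> (\<exists>c. cl e c)"
  obtain f where f: "f \<noteq> 0" "K.lt e f" using larger[OF assms(2)] by blast
  have "eventually (\<lambda>c. le0 f (poly g c)) Fil" using assms(1) f(1) unfolding null_def by blast
  with continuity[OF full f(1), of g]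
  have "eventually (\<lambda>c. le (const f) (to_fract g)) Fil"
  proof eventually_elim
    case (elim c)
    have "le (const f) (const (poly g c))" using elim(2) by simp
    from L.add[OF elim(1) this] show ?case by simp
  qed
  then have "le (const f) (to_fract g)" by simp
  moreover have "L.lt (const e) (const f)" using f(2) by simp
  ultimately show ?thesis using L.trans by blast
qed

lemma stable_eqv:
  assumes "stable g"
  obtains a where "a \<noteq> 0" "L.eqv (to_fract g) (const a)" "L.near (to_fract g) (const a)"
proof -
  from stable_near[OF assms] stable_eventually_nonzero[OF assms]
  have "eventually (\<lambda>c. poly g c \<noteq> 0 \<and> L.near (to_fract g) (const (poly g c))) Fil"
    by eventually_elim blast
  then obtain c where "poly g c \<noteq> 0" "L.near (to_fract g) (const (poly g c))" using eventually_ex by blast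
  then show thesis using that L.diff_eqv by blast
qed

text \<open>The right-hand side depends on the approximation type only. This gives uniqueness of the
  extension.\<close>

lemma le_eq_dense_le: "le = dense_le"
proof (intro ext iffI)
  fix u w assume uw: "le u w"
  show "dense_le u w"
  proof (cases "w = 0")
    case False
    then have u0: "u \<noteq> 0" using uw by auto
    obtain r' s' where q: "w / u = to_fract r' / to_fract s'" and nz: "r' \<noteq> 0" "s' \<noteq> 0"
      and g: "stable r' \<or> stable s'" using reduced_fraction[of "w / u"] False u0 by auto
    have "le 1 (w / u)" using uw u0 L.le_divide_iff[of u 1 w] by simp
    then have sr: "le (to_fract s') (to_fract r')"
      unfolding q using nz L.le_divide_iff[of "to_fract s'" 1 "to_fract r'"] by simp
    have s': "stable s'"
    proof (rule ccontr)
      assume "\<not> stable s'"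
      then have "null s'" "stable r'" using g not_stable_iff by auto
      obtain a where a: "a \<noteq> 0" "L.eqv (to_fract r') (const a)" using stable_eqv[OF \<open>stable r'\<close>] by blast
      have "L.lt (const a) (to_fract s')" using null_above[OF \<open>null s'\<close> a(1)] .
      then show False using a(2) sr L.trans by blast
    qed
    have "eventually (\<lambda>c. le0 (poly s' c) (poly r' c)) Fil"
    proof (cases "stable r'")
      case True
      from stable_near[OF True] stable_near[OF s'] show ?thesis
      proof eventually_elim
        case (elim c)
        have "le (const (poly s' c)) (const (poly r' c))"
          using L.diff_eqv[OF elim(1)] L.diff_eqv[OF elim(2)] sr L.trans by blast
        then show ?case by simp
      qed
    next
      case False
      then show ?thesis using stable_le_null[OF s'] not_stable_iff by blast
    qed
    moreover have "w = u * (to_fract r' / to_fract s')" using q u0 by (simp add: field_simps)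
    ultimately show ?thesis unfolding dense_le_def using s' by blast
  qed (simp add: dense_le_def)
next
  fix u w assume "dense_le u w"
  then consider "w = 0" | r s where "stable s" "eventually (\<lambda>c. le0 (poly s c) (poly r c)) Fil"
    "w = u * (to_fract r / to_fract s)" unfolding dense_le_def by blast
  then show "le u w"
  proof cases
    case 2
    have sr: "le (to_fract s) (to_fract r)"
    proof (cases "stable r")
      case True
      from stable_near[OF True] stable_near[OF 2(1)] 2(2)
      have "eventually (\<lambda>c. le (to_fract s) (to_fract r)) Fil"
      proof eventually_elim
        case (elim c)
        have "le (const (poly s c)) (const (poly r c))" using elim(3) by simp
        then show ?case using L.diff_eqv[OF elim(1)] L.diff_eqv[OF elim(2)] L.trans by blast
      qed
      then show ?thesis by simp
    next
      case False
      then have n: "null r" using not_stable_iff by blast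
      obtain a where a: "a \<noteq> 0" "L.eqv (to_fract s) (const a)" using stable_eqv[OF 2(1)] by blast
      have "L.lt (const a) (to_fract r)" using null_above[OF n a(1)] .
      then show ?thesis using a(2) L.trans L.lt_imp_le by blast
    qed
    have "to_fract s \<noteq> 0" using stable_nonzero[OF 2(1)] by simp
    then have "le 1 (to_fract r / to_fract s)" using sr L.le_divide_iff[of "to_fract s" 1] by simp
    from L.mult[OF this, of u] show ?thesis using 2(3) by simp
  qed (simp add: L.zero)
qed

lemma unit_near_const:
  assumes "L.eqv u 1"
  shows "\<exists>c. L.near u (const c)"
proof -
  have u0: "u \<noteq> 0" using assms by auto
  obtain r' s' where q: "u = to_fract r' / to_fract s'" and nz: "r' \<noteq> 0" "s' \<noteq> 0"
    and g: "stable r' \<or> stable s'" using reduced_fraction[OF u0] by blast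
  have eqv: "L.eqv (to_fract r') (to_fract s')"
    using assms nz L.le_divide_iff[of "to_fract s'" 1 "to_fract r'"] L.divide_le_iff[of "to_fract s'" "to_fract r'" 1]
    unfolding q by simp
  have *: False if h: "null h" and k: "stable k" and hk: "L.eqv (to_fract k) (to_fract h)" for h k
  proof -
    obtain a where a: "a \<noteq> 0" "L.eqv (to_fract k) (const a)" using stable_eqv[OF k] by blast
    show False using null_above[OF h a(1)] hk a(2) L.trans by blast
  qed
  have "stable r'" "stable s'" using * g eqv not_stable_iff by blast+
  then obtain a b where "L.near (to_fract r') (const a)" "L.near (to_fract s') (const b)"
    using stable_eqv by metis
  from L.near_divide[OF this] have "L.near u (const (a / b))" unfolding q by simp
  then show ?thesis by blast
qed

lemma near_const_if_all_stable:
  assumes st: "\<And>g. g \<noteq> 0 \<Longrightarrow> stable g" and u: "u \<noteq> 0"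
  shows "\<exists>c. L.eqv u (const c)"
proof -
  obtain r s where rs: "s \<noteq> 0" "u = to_fract r / to_fract s" by (rule fract_cases)
  have r0: "r \<noteq> 0" using rs u by auto
  obtain a b where "L.near (to_fract r) (const a)" "L.near (to_fract s) (const b)"
    using stable_eqv st rs(1) r0 by metis
  from L.diff_eqv[OF L.near_divide[OF this]] have "L.eqv u (const (a / b))" unfolding rs(2) by simp
  then show ?thesis by blast
qed

text \<open>For a completion type of an algebraic element, \<open>F\<close> is the value of its minimal polynomial at
  \<open>x\<close>. Its valuation exceeds all of \<open>v\<^sub>0K\<close> and generates the value group over it.\<close>

lemma unstable_generator:
  assumes "\<not> (\<forall>g. g \<noteq> 0 \<longrightarrow> stable g)"
  obtains F where "\<And>e. e \<noteq> 0 \<Longrightarrow> L.lt (const e) F" "F \<noteq> 0"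
    "\<And>u. u \<noteq> 0 \<Longrightarrow> \<exists>c m n. L.eqv (u * F ^ n) (const c * F ^ m)"
proof -
  obtain f0 where "f0 \<noteq> 0" "null f0" using assms not_stable_iff by blast
  then obtain f where f: "f \<noteq> 0" "null f" "degree f > 0" "\<And>g. null g \<Longrightarrow> f dvd g"
    using null_generator by blast
  show thesis
  proof (rule that[of "to_fract f"])
    show "L.lt (const e) (to_fract f)" if "e \<noteq> 0" for e using null_above[OF f(2) that] .
    show "to_fract f \<noteq> 0" using f(1) by simp
    fix u :: "'a poly fract" assume u: "u \<noteq> 0"
    obtain r s where rs: "s \<noteq> 0" "u = to_fract r / to_fract s" by (rule fract_cases)
    have r0: "r \<noteq> 0" using rs u by auto
    obtain k r' where r': "r = f ^ k * r'" "stable r'" using power_decomposition[OF f(3,4) r0] by blast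
    obtain l s' where s': "s = f ^ l * s'" "stable s'" using power_decomposition[OF f(3,4) rs(1)] by blast
    obtain a b where ab: "L.near (to_fract r') (const a)" "L.near (to_fract s') (const b)"
      using stable_eqv r'(2) s'(2) by metis
    have pw: "to_fract (f ^ n) = to_fract f ^ n" for n by (induction n) simp_all
    have "u * to_fract f ^ l = (to_fract r' / to_fract s') * to_fract f ^ k"
      unfolding rs(2) r'(1) s'(1) using f(1) by (simp add: pw)
    moreover have "L.eqv (to_fract r' / to_fract s') (const (a / b))"
      using L.diff_eqv[OF L.near_divide[OF ab]] by simp
    ultimately have "L.eqv (u * to_fract f ^ l) (const (a / b) * to_fract f ^ k)"
      using L.mult_mono[OF _ L.refl] by metis
    then show "\<exists>c m n. L.eqv (u * to_fract f ^ n) (const c * to_fract f ^ m)" by blast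
  qed
qed

end

section \<open>Monomial valuations\<close>

lemma (in field_valuation) near_sum:
  assumes "finite S" "i \<in> S" "\<And>j. j \<in> S - {i} \<Longrightarrow> lt (f i) (f j)" "f i \<noteq> 0"
  shows "near (sum f S) (f i)"
proof -
  have "lt (f i) (sum f (S - {i}))" using assms by (intro sum_lt) auto
  then show ?thesis using sum.remove[OF assms(1,2), of f] by simp
qed

lemma to_fract_affine:
  assumes "d \<noteq> 0"
  shows "to_fract g = peval (pcompose g [:b, inverse d:]) (const d * (var_x - const b))"
proof -
  have "const b + const d * (var_x - const b) * inverse (const d) = var_x"
    using assms by (simp add: field_simps)
  then show ?thesis by (simp add: peval_pcompose flip: peval_var_x)
qed

context valuation_extension
begin

text \<open>The value of a polynomial in \<open>t\<close> is the least value of its terms. Only \<open>\<le>\<close> is required, since \<open>\<ge>\<close> is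
  the ultrametric inequality.\<close>

definition monomial_at :: "'a poly fract \<Rightarrow> bool" where
  "monomial_at t \<longleftrightarrow> (\<forall>p i. le (peval p t) (const (coeff p i) * t ^ i))"

lemma least_term:
  "\<exists>i\<le>degree p. (\<forall>j. le (const (coeff p i) * t ^ i) (const (coeff p j) * t ^ j)) \<and>
    le (const (coeff p i) * t ^ i) (peval p t)"
proof -
  obtain i where i: "i \<le> degree p" "\<And>j. j \<le> degree p \<Longrightarrow> le (const (coeff p i) * t ^ i) (const (coeff p j) * t ^ j)"
    using L.finite_min[of "{..degree p}" "\<lambda>i. const (coeff p i) * t ^ i"] by auto
  have "le (const (coeff p i) * t ^ i) (const (coeff p j) * t ^ j)" for j
    using i(2)[of j] by (cases "j \<le> degree p") (simp_all add: coeff_eq_0 L.zero)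
  moreover from this have "le (const (coeff p i) * t ^ i) (peval p t)"
    unfolding peval_altdef by (intro L.sum_le)
  ultimately show ?thesis using i(1) by blast
qed

lemma least_term_nonzero:
  assumes "p \<noteq> 0" "t \<noteq> 0" "\<And>j. le (const (coeff p i) * t ^ i) (const (coeff p j) * t ^ j)"
  shows "coeff p i \<noteq> 0"
proof
  assume "coeff p i = 0"
  then have "const (coeff p (degree p)) * t ^ degree p = 0" using assms(3)[of "degree p"] by simp
  then show False using assms(1,2) by simp
qed

lemma monomial_attained:
  assumes "monomial_at t" "t \<noteq> 0" "p \<noteq> 0"
  obtains i where "coeff p i \<noteq> 0" "L.eqv (peval p t) (const (coeff p i) * t ^ i)"
proof -
  obtain i where "\<And>j. le (const (coeff p i) * t ^ i) (const (coeff p j) * t ^ j)"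
    "le (const (coeff p i) * t ^ i) (peval p t)" using least_term by blast
  then show thesis
    using that least_term_nonzero[OF assms(3,2)] assms(1) unfolding monomial_at_def by blast
qed

lemma monomial_le_iff:
  assumes "monomial_at t"
  shows "le (peval p t) (peval q t) \<longleftrightarrow>
    (\<exists>i. \<forall>j. le (const (coeff p i) * t ^ i) (const (coeff q j) * t ^ j))"
proof
  assume pq: "le (peval p t) (peval q t)"
  obtain i where "le (const (coeff p i) * t ^ i) (peval p t)" using least_term by blast
  moreover have "le (peval q t) (const (coeff q j) * t ^ j)" for j
    using assms by (simp add: monomial_at_def)
  ultimately show "\<exists>i. \<forall>j. le (const (coeff p i) * t ^ i) (const (coeff q j) * t ^ j)"
    using pq L.trans by blast
next
  assume "\<exists>i. \<forall>j. le (const (coeff p i) * t ^ i) (const (coeff q j) * t ^ j)"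
  then obtain i where i: "\<And>j. le (const (coeff p i) * t ^ i) (const (coeff q j) * t ^ j)" by blast
  then have "le (const (coeff p i) * t ^ i) (peval q t)"
    unfolding peval_altdef by (intro L.sum_le)
  moreover have "le (peval p t) (const (coeff p i) * t ^ i)"
    using assms by (simp add: monomial_at_def)
  ultimately show "le (peval p t) (peval q t)" using L.trans by blast
qed

lemma monomial_scale:
  assumes "monomial_at s"
  shows "monomial_at (const d * s)"
  unfolding monomial_at_def
proof (intro allI)
  fix p i
  have "peval p (const d * s) = peval (pcompose p [:0, d:]) s"
    by (simp add: peval_pcompose mult.commute)
  moreover have "const (coeff (pcompose p [:0, d:]) i) * s ^ i = const (coeff p i) * (const d * s) ^ i"
    by (simp add: coeff_pcompose_linear power_mult_distrib)
  ultimately show "le (peval p (const d * s)) (const (coeff p i) * (const d * s) ^ i)"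
    using assms unfolding monomial_at_def by metis
qed

text \<open>By Horner's scheme, the coefficients of \<open>g(X + c)\<close> satisfy the same bounds as those of
  \<open>g\<close> if \<open>c\<close> has at least the value of \<open>t\<close>.\<close>

lemma shift_coefficients:
  assumes c: "le t (const c)" and t: "t \<noteq> 0"
    and m: "\<And>i. le m (const (coeff g i) * t ^ i)"
  shows "le m (const (coeff (pcompose g [:c, 1:]) k) * t ^ k)"
  using m
proof (induction g arbitrary: m k)
  case (pCons a g)
  let ?g = "pcompose g [:c, 1:]"
  have "le m (t * (const (coeff g i) * t ^ i))" for i
    using pCons.prems[of "Suc i"] by (simp add: mult_ac)
  then have "le (m / t) (const (coeff g i) * t ^ i)" for i
    using t by (simp add: L.divide_le_iff mult.commute)
  then have IH: "le (m / t) (const (coeff ?g k) * t ^ k)" for k by (rule pCons.IH)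
  have 1: "le m (const (if k = 0 then a else 0) * t ^ k)"
    using pCons.prems[of 0] by (simp add: L.zero)
  have 2: "le m (const c * (const (coeff ?g k) * t ^ k))"
    using L.mult_mono[OF c IH] t by simp
  have 3: "le m (const (if k = 0 then 0 else coeff ?g (k - 1)) * t ^ k)"
  proof (cases k)
    case (Suc l)
    have "le m (t * (const (coeff ?g l) * t ^ l))" using L.mult_mono[OF L.refl IH, of t l] t by simp
    then show ?thesis by (simp add: Suc mult_ac)
  qed (simp add: L.zero)
  have "coeff (pcompose (pCons a g) [:c, 1:]) k =
      (if k = 0 then a else 0) + c * coeff ?g k + (if k = 0 then 0 else coeff ?g (k - 1))"
    by (cases k) (simp_all add: pcompose_pCons)
  then have "const (coeff (pcompose (pCons a g) [:c, 1:]) k) * t ^ k =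
      const (if k = 0 then a else 0) * t ^ k + const c * (const (coeff ?g k) * t ^ k) +
      const (if k = 0 then 0 else coeff ?g (k - 1)) * t ^ k"
    by (simp only: const_simps ring_distribs mult.assoc)
  then show ?case using L.add[OF L.add[OF 1 2] 3] by simp
qed (simp add: L.zero)

lemma monomial_shift:
  assumes t: "monomial_at t" "t \<noteq> 0" and c: "le t (const c)"
  shows "monomial_at (t + const c)"
  unfolding monomial_at_def
proof (intro allI)
  fix p i
  define q where "q = pcompose p [:c, 1:]"
  have "peval p (t + const c) = peval q t" by (simp add: q_def peval_pcompose add.commute)
  then have m: "le (peval p (t + const c)) (const (coeff q i) * t ^ i)" for i
    using t(1) unfolding monomial_at_def by metis
  have "le t (const (- c))" using c by simp
  from shift_coefficients[OF this t(2) m]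
  have 1: "le (peval p (t + const c)) (const (coeff (pcompose q [:- c, 1:]) i) * t ^ i)" .
  have 2: "pcompose q [:- c, 1:] = p"
    by (simp add: q_def pcompose_pCons flip: pcompose_assoc)
  have "le t (t + const c)" using c by (simp add: L.add)
  then have "le (t ^ i) ((t + const c) ^ i)" by (rule L.power_mono)
  then have "le (const (coeff p i) * t ^ i) (const (coeff p i) * (t + const c) ^ i)" by (rule L.mult)
  with 1[unfolded 2] show "le (peval p (t + const c)) (const (coeff p i) * (t + const c) ^ i)"
    by (rule L.trans)
qed

subsection \<open>Value-transcendental elements\<close>

lemma value_transcendental_terms:
  assumes t: "\<And>n c. n > 0 \<Longrightarrow> \<not> L.eqv (t ^ n) (const c)" and "i < j" "a \<noteq> 0" "b \<noteq> 0" "t \<noteq> 0"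
  shows "\<not> L.eqv (const a * t ^ i) (const b * t ^ j)"
proof
  assume eqv: "L.eqv (const a * t ^ i) (const b * t ^ j)"
  have "t ^ j = t ^ i * t ^ (j - i)" using assms(2) by (simp flip: power_add)
  then have "L.eqv (const a * t ^ i) ((const b * t ^ (j - i)) * t ^ i)" using eqv by (simp add: mult_ac)
  then have "L.eqv (const a) (const b * t ^ (j - i))" using assms(5) by simp
  then have "L.eqv (t ^ (j - i)) (const a / const b)"
    using assms(4) by (simp add: L.le_divide_iff L.divide_le_iff mult.commute)
  then have "L.eqv (t ^ (j - i)) (const (a / b))" by simp
  then show False using t[of "j - i" "a / b"] assms(2) by simp
qed

lemma value_transcendental_near:
  assumes t: "\<And>n c. n > 0 \<Longrightarrow> \<not> L.eqv (t ^ n) (const c)" "t \<noteq> 0" and p: "p \<noteq> 0"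
  obtains i where "coeff p i \<noteq> 0" "L.near (peval p t) (const (coeff p i) * t ^ i)"
    "\<And>j. le (const (coeff p i) * t ^ i) (const (coeff p j) * t ^ j)"
proof -
  obtain i where i: "i \<le> degree p" "\<And>j. le (const (coeff p i) * t ^ i) (const (coeff p j) * t ^ j)"
    using least_term by blast
  have nz: "coeff p i \<noteq> 0" using least_term_nonzero[OF p t(2) i(2)] .
  have "L.near (peval p t) (const (coeff p i) * t ^ i)"
    unfolding peval_altdef
  proof (rule L.near_sum)
    fix j assume j: "j \<in> {..degree p} - {i}"
    show "L.lt (const (coeff p i) * t ^ i) (const (coeff p j) * t ^ j)"
    proof (cases "coeff p j = 0")
      case False
      then have "\<not> L.eqv (const (coeff p i) * t ^ i) (const (coeff p j) * t ^ j)"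
        using value_transcendental_terms[OF t(1) _ nz False t(2), of i j]
          value_transcendental_terms[OF t(1) _ False nz t(2), of j i] j by (cases "i < j") auto
      then show ?thesis using i(2) by blast
    qed (use nz t(2) in simp)
  qed (use i nz t(2) in auto)
  then show thesis using that nz i(2) by blast
qed

lemma value_transcendental_monomial:
  assumes t: "\<And>n c. n > 0 \<Longrightarrow> \<not> L.eqv (t ^ n) (const c)" "t \<noteq> 0"
  shows "monomial_at t"
  unfolding monomial_at_def
proof (intro allI)
  fix p i
  show "le (peval p t) (const (coeff p i) * t ^ i)"
  proof (cases "p = 0")
    case False
    then obtain k where "L.near (peval p t) (const (coeff p k) * t ^ k)"
      "\<And>j. le (const (coeff p k) * t ^ k) (const (coeff p j) * t ^ j)"
      using value_transcendental_near[OF t False] by blast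
    then show ?thesis using L.diff_eqv L.trans by blast
  qed simp
qed

lemma value_transcendental_fraction:
  assumes t: "\<And>n c. n > 0 \<Longrightarrow> \<not> L.eqv (t ^ n) (const c)" "t \<noteq> 0"
    and t_def: "t = var_x - const b" and u: "u \<noteq> 0"
  obtains a m n where "a \<noteq> 0" "L.near u (const a * t ^ m / t ^ n)"
proof -
  obtain r s where rs: "s \<noteq> 0" "u = to_fract r / to_fract s" by (rule fract_cases)
  have r0: "r \<noteq> 0" using rs u by auto
  let ?r = "pcompose r [:b, 1:]" and ?s = "pcompose s [:b, 1:]"
  have "?r \<noteq> 0" "?s \<noteq> 0" using r0 rs(1) by (simp_all add: pcompose_eq_0_iff)
  obtain i where i: "coeff ?r i \<noteq> 0" "L.near (peval ?r t) (const (coeff ?r i) * t ^ i)"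
    using value_transcendental_near[OF t \<open>?r \<noteq> 0\<close>] by blast
  obtain j where j: "coeff ?s j \<noteq> 0" "L.near (peval ?s t) (const (coeff ?s j) * t ^ j)"
    using value_transcendental_near[OF t \<open>?s \<noteq> 0\<close>] by blast
  have "u = peval ?r t / peval ?s t"
    unfolding rs(2) t_def using to_fract_shift[of r b] to_fract_shift[of s b] by simp
  moreover have "const (coeff ?r i) * t ^ i / (const (coeff ?s j) * t ^ j)
      = const (coeff ?r i / coeff ?s j) * t ^ i / t ^ j" by simp
  ultimately have "L.near u (const (coeff ?r i / coeff ?s j) * t ^ i / t ^ j)"
    using L.near_divide[OF i(2) j(2)] by metis
  then show thesis using that[of "coeff ?r i / coeff ?s j" i j] i j by simp
qed

subsection \<open>Residue-transcendental elements\<close>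

text \<open>Dividing \<open>p\<close> by a coefficient of least value makes it integral with one coefficient equal to \<open>1\<close>, so
  by hypothesis its value at \<open>s\<close> is not positive.\<close>

lemma residue_monomial:
  assumes s: "L.eqv s 1"
    and crit: "\<And>p i. (\<And>i. le0 1 (coeff p i)) \<Longrightarrow> L.lt 1 (peval p s) \<Longrightarrow> K.lt 1 (coeff p i)"
  shows "monomial_at s"
  unfolding monomial_at_def
proof (intro allI)
  fix p i
  have s_pow: "L.eqv (s ^ n) 1" for n
    using L.power_mono[of s 1 n] L.power_mono[of 1 s n] s by simp
  show "le (peval p s) (const (coeff p i) * s ^ i)"
  proof (cases "p = 0")
    case False
    have s0: "s \<noteq> 0" using s by auto
    have tm: "L.eqv (const (coeff p j) * s ^ j) (const (coeff p j))" for j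
      using L.mult[of "s ^ j" 1 "const (coeff p j)"] L.mult[of 1 "s ^ j" "const (coeff p j)"] s_pow[of j] by simp
    obtain k where "\<And>j. le (const (coeff p k) * s ^ k) (const (coeff p j) * s ^ j)"
      using least_term by blast
    moreover from this have k0: "coeff p k \<noteq> 0" by (rule least_term_nonzero[OF False s0])
    ultimately have k: "le (const (coeff p k)) (const (coeff p j))" for j
      using tm[of j] tm[of k] L.trans by blast
    define q where "q = smult (inverse (coeff p k)) p"
    have "le0 1 (coeff q j)" for j
      using k[of j] k0 K.le_divide_iff[OF k0, of 1 "coeff p j"] by (simp add: q_def divide_inverse mult.commute)
    moreover have "coeff q k = 1" using k0 by (simp add: q_def)
    ultimately have "le (peval q s) 1" using crit[of q k] by auto
    then have "le (const (coeff p k) * peval q s) (const (coeff p k))"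
      using L.mult[of "peval q s" 1 "const (coeff p k)"] by simp
    moreover have "const (coeff p k) * peval q s = peval p s" using k0 by (simp add: q_def)
    ultimately have "le (peval p s) (const (coeff p k))" by simp
    then show ?thesis using k[of i] tm[of i] L.trans by blast
  qed simp
qed

lemma monomial_residue:
  assumes s: "L.eqv s 1" and mono: "monomial_at s" and "L.lt 1 (peval p s)"
  shows "K.lt 1 (coeff p i)"
proof -
  have "L.eqv (s ^ i) 1" using L.power_mono[of s 1 i] L.power_mono[of 1 s i] s by simp
  then have "le (const (coeff p i) * s ^ i) (const (coeff p i))"
    using L.mult[of "s ^ i" 1 "const (coeff p i)"] by simp
  moreover have "le (peval p s) (const (coeff p i) * s ^ i)" using mono by (simp add: monomial_at_def)
  ultimately have "L.lt 1 (const (coeff p i))" using assms(3) L.trans by blast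
  then show ?thesis using const_le[of "coeff p i" 1] by simp
qed

lemma residue_attained:
  assumes s: "L.eqv s 1" and mono: "monomial_at s" and p: "p \<noteq> 0"
  obtains i where "coeff p i \<noteq> 0" "L.eqv (peval p s) (const (coeff p i))" "\<And>j. le0 (coeff p i) (coeff p j)"
proof -
  have s0: "s \<noteq> 0" using s by auto
  obtain i where i: "coeff p i \<noteq> 0" "L.eqv (peval p s) (const (coeff p i) * s ^ i)"
    using monomial_attained[OF mono s0 p] by blast
  have *: "L.eqv (const (coeff p j) * s ^ j) (const (coeff p j))" for j
  proof -
    have "L.eqv (s ^ j) 1" using L.power_mono[of s 1 j] L.power_mono[of 1 s j] s by simp
    then show ?thesis
      using L.mult[of "s ^ j" 1 "const (coeff p j)"] L.mult[of 1 "s ^ j" "const (coeff p j)"] by simp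
  qed
  have e: "L.eqv (peval p s) (const (coeff p i))" using i(2) *[of i] L.trans by blast
  have "le (const (coeff p i)) (const (coeff p j))" for j
    using mono e *[of j] L.trans unfolding monomial_at_def by blast
  then show thesis using that[OF i(1) e] by simp
qed

text \<open>The denominator is divided by its least coefficient, which makes its value at \<open>s\<close> a unit.\<close>

lemma residue_fraction:
  assumes s: "L.eqv s 1" and mono: "monomial_at s" and s_def: "s = const d * (var_x - const b)"
    and u: "u \<noteq> 0"
  shows "\<exists>p q. (\<forall>i. le0 1 (coeff q i)) \<and> L.eqv (peval q s) 1 \<and> u * peval q s = peval p s \<and> p \<noteq> 0"
proof -
  have d: "d \<noteq> 0" using s unfolding s_def by auto
  obtain r r' where r: "r' \<noteq> 0" "u = to_fract r / to_fract r'" by (rule fract_cases)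
  have r0: "r \<noteq> 0" using r u by auto
  define p where "p = pcompose r [:b, inverse d:]"
  define q where "q = pcompose r' [:b, inverse d:]"
  have pq: "to_fract r = peval p s" "to_fract r' = peval q s"
    unfolding p_def q_def s_def using to_fract_affine[OF d] by blast+
  then have nz: "p \<noteq> 0" "q \<noteq> 0" "peval q s \<noteq> 0" using r0 r(1) by auto
  obtain i where i: "coeff q i \<noteq> 0" "L.eqv (peval q s) (const (coeff q i))" "\<And>j. le0 (coeff q i) (coeff q j)"
    using residue_attained[OF s mono nz(2)] by blast
  define a where "a = inverse (coeff q i)"
  have a0: "a \<noteq> 0" using i(1) by (simp add: a_def)
  have "le0 1 (coeff (smult a q) j)" for j
    using i(3)[of j] K.le_divide_iff[OF i(1), of 1 "coeff q j"] by (simp add: a_def divide_inverse mult.commute)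
  moreover have "L.eqv (const a * peval q s) (const a * const (coeff q i))"
    using i(2) L.mult by blast
  then have "L.eqv (peval (smult a q) s) 1" using i(1) by (simp add: a_def)
  moreover have "u * peval (smult a q) s = peval (smult a p) s"
    using nz(3) unfolding r(2) pq by simp
  ultimately show ?thesis using nz(1) a0 by (metis smult_eq_0_iff)
qed

end

section \<open>Construction of monomial valuations\<close>

lemma fract_preorder:
  fixes P :: "'r::idom \<Rightarrow> 'r \<Rightarrow> bool"
  assumes total: "\<And>p q. P p q \<or> P q p" and trans: "\<And>p q r. P p q \<Longrightarrow> P q r \<Longrightarrow> P p r"
    and mult: "\<And>p q r. r \<noteq> 0 \<Longrightarrow> P (r * p) (r * q) \<longleftrightarrow> P p q"
    and add: "\<And>p q r. P r p \<Longrightarrow> P r q \<Longrightarrow> P r (p + q)"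
    and zero: "\<And>p. P p 0" and zero_D: "\<And>p. P 0 p \<Longrightarrow> p = 0"
  obtains le where "field_valuation le" "\<And>p q. le (to_fract p) (to_fract q) \<longleftrightarrow> P p q"
proof -
  define le where "le = (\<lambda>u w. \<exists>p q s. s \<noteq> 0 \<and> u = to_fract p / to_fract s \<and> w = to_fract q / to_fract s \<and> P p q)"
  have le_iff: "le (to_fract p / to_fract s) (to_fract q / to_fract s) \<longleftrightarrow> P p q" if s: "s \<noteq> 0" for p q s
  proof
    assume "le (to_fract p / to_fract s) (to_fract q / to_fract s)"
    then obtain p' q' s' where *: "s' \<noteq> 0" "to_fract p / to_fract s = to_fract p' / to_fract s'"
      "to_fract q / to_fract s = to_fract q' / to_fract s'" "P p' q'"
      unfolding le_def by blast
    then have "to_fract (s' * p) = to_fract (s * p')" "to_fract (s' * q) = to_fract (s * q')"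
      using s by (simp_all add: frac_eq_eq mult.commute)
    then have "s' * p = s * p'" "s' * q = s * q'" by (simp_all only: to_fract_eq_iff)
    then have "P (s' * p) (s' * q)" using *(4) mult[OF s] by simp
    then show "P p q" using mult[OF *(1)] by simp
  qed (use s in \<open>auto simp: le_def\<close>)
  have common2: "\<exists>p q s. s \<noteq> 0 \<and> u = to_fract p / to_fract s \<and> w = to_fract q / to_fract s" for u w :: "'r fract"
  proof -
    obtain p s where 1: "s \<noteq> 0" "u = to_fract p / to_fract s" by (rule fract_cases)
    obtain q s' where 2: "s' \<noteq> 0" "w = to_fract q / to_fract s'" by (rule fract_cases)
    have "u = to_fract (p * s') / to_fract (s * s')" "w = to_fract (q * s) / to_fract (s * s')" "s * s' \<noteq> 0"
      using 1 2 by simp_all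
    then show ?thesis by blast
  qed
  have common3: "\<exists>p q r s. s \<noteq> 0 \<and> u = to_fract p / to_fract s \<and> w = to_fract q / to_fract s \<and> z = to_fract r / to_fract s"
    for u w z :: "'r fract"
  proof -
    obtain p q s where 1: "s \<noteq> 0" "u = to_fract p / to_fract s" "w = to_fract q / to_fract s"
      using common2[of u w] by blast
    obtain r s' where 2: "s' \<noteq> 0" "z = to_fract r / to_fract s'" by (rule fract_cases)
    have "u = to_fract (p * s') / to_fract (s * s')" "w = to_fract (q * s') / to_fract (s * s')"
      "z = to_fract (r * s) / to_fract (s * s')" "s * s' \<noteq> 0"
      using 1 2 by simp_all
    then show ?thesis by blast
  qed
  have "field_valuation le"
  proof
    fix a b c :: "'r fract"
    obtain p q r s where s: "s \<noteq> 0" and abc: "a = to_fract p / to_fract s" "b = to_fract q / to_fract s" "c = to_fract r / to_fract s"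
      using common3[of a b c] by blast
    note le_s = le_iff[OF s]
    show "le a b \<or> le b a" unfolding abc le_s by (rule total)
    show "le a b \<Longrightarrow> le b c \<Longrightarrow> le a c" unfolding abc le_s by (rule trans)
    have ab: "a + b = to_fract (p + q) / to_fract s" using abc by (simp add: add_divide_distrib)
    show "le c a \<Longrightarrow> le c b \<Longrightarrow> le c (a + b)" unfolding ab unfolding abc le_s by (rule add)
    have 0: "0 = to_fract 0 / to_fract s" by simp
    show "le a 0" unfolding 0 unfolding abc le_s by (rule zero)
    show "a = 0" if "le 0 a"
      using that zero_D[of p] unfolding 0 unfolding abc le_s by simp
    show "le (c * a) (c * b)" if "le a b"
    proof (cases "c = 0")
      case True
      have "le 0 0" using le_s[of 0 0] zero[of 0] by simp
      then show ?thesis using True by simp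
    next
      case False
      then have r0: "r \<noteq> 0" using abc by auto
      have ss: "s * s \<noteq> 0" using s by simp
      have "c * a = to_fract (r * p) / to_fract (s * s)" "c * b = to_fract (r * q) / to_fract (s * s)"
        using abc by simp_all
      then show ?thesis using that mult[OF r0] unfolding abc by (simp only: le_iff[OF ss] le_s)
    qed
  qed
  moreover have "le (to_fract p) (to_fract q) \<longleftrightarrow> P p q" for p q
    using le_iff[of 1 p q] by simp
  ultimately show thesis using that by blast
qed

text \<open>A total preorder on the monomials \<open>a t^i\<close>, given by its cone of monomials of value
  at least \<open>0\<close>; the exponents may be negative. Such a preorder is an ordering of
  \<open>v\<^sub>0K \<times> \<int>\<close> that extends the one of \<open>v\<^sub>0K\<close>, possibly up to identifications.\<close>

locale monomial_cone = K: field_valuation le0 for le0 :: "'a::field \<Rightarrow> 'a \<Rightarrow> bool" +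
  fixes pos :: "'a \<Rightarrow> int \<Rightarrow> bool"
  assumes pos_mult: "a \<noteq> 0 \<Longrightarrow> b \<noteq> 0 \<Longrightarrow> pos a k \<Longrightarrow> pos b l \<Longrightarrow> pos (a * b) (k + l)"
    and pos_total: "a \<noteq> 0 \<Longrightarrow> pos a k \<or> pos (inverse a) (- k)"
    and pos_0: "a \<noteq> 0 \<Longrightarrow> pos a 0 \<longleftrightarrow> le0 1 a"
begin

text \<open>The monomial \<open>a t^i\<close> has at most the value of \<open>b t^j\<close>, where zero coefficients have value \<open>\<infinity>\<close>.\<close>

definition T :: "'a \<Rightarrow> nat \<Rightarrow> 'a \<Rightarrow> nat \<Rightarrow> bool" where
  "T a i b j \<longleftrightarrow> b = 0 \<or> a \<noteq> 0 \<and> pos (b / a) (int j - int i)"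

lemma T_0 [simp]: "T a i 0 j" "T 0 i b j \<longleftrightarrow> b = 0"
  by (simp_all add: T_def)

lemma T_total: "T a i b j \<or> T b j a i"
  using pos_total[of "b / a" "int j - int i"] by (cases "a = 0 \<or> b = 0") (auto simp: T_def)

lemma T_trans: "T a i b j \<Longrightarrow> T b j c k \<Longrightarrow> T a i c k"
  using pos_mult[of "b / a" "c / b" "int j - int i" "int k - int j"]
  by (cases "a = 0 \<or> b = 0 \<or> c = 0") (auto simp: T_def)

lemma T_mult: "T a i b j \<Longrightarrow> T c k d l \<Longrightarrow> T (a * c) (i + k) (b * d) (j + l)"
  using pos_mult[of "b / a" "d / c" "int j - int i" "int l - int k"]
  by (cases "a = 0 \<or> b = 0 \<or> c = 0 \<or> d = 0") (auto simp: T_def algebra_simps)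

lemma T_refl [simp]: "T a i a i"
  using T_total by blast

lemma T_cancel: "c \<noteq> 0 \<Longrightarrow> T (c * a) (k + i) (c * b) (k + j) \<longleftrightarrow> T a i b j"
  by (simp add: T_def)

lemma T_same: "T a i b i \<longleftrightarrow> le0 a b"
  using pos_0[of "b / a"] K.le_divide_iff[of a 1 b] by (cases "a = 0 \<or> b = 0") (auto simp: T_def K.zero)

lemma T_add: "T a i b j \<Longrightarrow> T a i c j \<Longrightarrow> T a i (b + c) j"
proof -
  assume a: "T a i b j" "T a i c j"
  have "le0 b (b + c) \<or> le0 c (b + c)"
    using K.total[of b c] K.add[of b b c] K.add[of c b c] by auto
  then have "T b j (b + c) j \<or> T c j (b + c) j" by (simp add: T_same)
  then show ?thesis using a T_trans by blast
qed

lemma T_sum: "(\<And>x. x \<in> S \<Longrightarrow> T a i (f x) j) \<Longrightarrow> T a i (sum f S) j"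
  by (induction S rule: infinite_finite_induct) (auto intro: T_add)

lemma T_add_strict: "\<not> T b j a i \<Longrightarrow> \<not> T c j a i \<Longrightarrow> \<not> T (b + c) j a i"
proof
  assume a: "\<not> T b j a i" "\<not> T c j a i" "T (b + c) j a i"
  have "le0 b (b + c) \<or> le0 c (b + c)"
    using K.total[of b c] K.add[of b b c] K.add[of c b c] by auto
  then have "T b j (b + c) j \<or> T c j (b + c) j" by (simp add: T_same)
  then show False using a T_trans by blast
qed

lemma T_sum_strict: "a \<noteq> 0 \<Longrightarrow> (\<And>x. x \<in> S \<Longrightarrow> \<not> T (f x) j a i) \<Longrightarrow> \<not> T (sum f S) j a i"
proof (induction S rule: infinite_finite_induct)
  case (insert x S)
  have "\<not> T (f x) j a i" "\<not> T (sum f S) j a i" using insert by auto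
  then show ?case using insert.hyps T_add_strict by simp
qed auto

lemma T_mult_strict:
  assumes "\<not> T b j a i" "T c k d l" "a \<noteq> 0" "c \<noteq> 0"
  shows "\<not> T (b * d) (j + l) (a * c) (i + k)"
proof
  assume "T (b * d) (j + l) (a * c) (i + k)"
  moreover have "T (a * c) (i + k) (a * d) (i + l)" using T_mult[OF T_refl assms(2)] .
  ultimately have *: "T (b * d) (j + l) (a * d) (i + l)" using T_trans by blast
  show False
  proof (cases "d = 0")
    case True
    then show ?thesis using \<open>T (b * d) (j + l) (a * c) (i + k)\<close> assms(3,4) by simp
  next
    case False
    then have "T (d * b) (l + j) (d * a) (l + i)" using * by (simp add: mult.commute add.commute)
    then show ?thesis using assms(1) T_cancel[OF False] by blast
  qed
qed

text \<open>The value of \<open>p\<close> is that of the monomial \<open>a t^i\<close>, which need not be a term of \<open>p\<close>. This freedom makes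
  the notion multiplicative.\<close>

definition least :: "'a poly \<Rightarrow> 'a \<Rightarrow> nat \<Rightarrow> bool" where
  "least p a i \<longleftrightarrow> a \<noteq> 0 \<and> (\<forall>j. T a i (coeff p j) j) \<and> (\<exists>j. T (coeff p j) j a i)"

lemma first_least:
  assumes "p \<noteq> 0"
  obtains i where "coeff p i \<noteq> 0" "\<And>j. T (coeff p i) i (coeff p j) j" "\<And>j. j < i \<Longrightarrow> \<not> T (coeff p j) j (coeff p i) i"
proof -
  have min: "\<exists>i\<in>S. \<forall>j\<in>S. T (coeff p i) i (coeff p j) j" if "finite S" "S \<noteq> {}" for S
    using that
  proof (induction S rule: finite_ne_induct)
    case (insert x S)
    then obtain i where "i \<in> S" "\<forall>j\<in>S. T (coeff p i) i (coeff p j) j" by blast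
    then show ?case using T_total[of "coeff p i" i "coeff p x" x] T_trans by (metis T_refl insert_iff)
  qed simp
  have "\<exists>i\<in>{..degree p}. \<forall>j\<in>{..degree p}. T (coeff p i) i (coeff p j) j"
    by (rule min) simp_all
  then obtain k where "\<forall>j\<le>degree p. T (coeff p k) k (coeff p j) j" by auto
  then have k: "T (coeff p k) k (coeff p j) j" for j
    by (cases "j \<le> degree p") (simp_all add: coeff_eq_0)
  define i where "i = (LEAST i. \<forall>j. T (coeff p i) i (coeff p j) j)"
  have i: "\<forall>j. T (coeff p i) i (coeff p j) j"
    unfolding i_def by (rule LeastI[of _ k]) (use k in blast)
  have "\<not> T (coeff p j) j (coeff p i) i" if "j < i" for j
  proof
    assume "T (coeff p j) j (coeff p i) i"
    then have "\<forall>l. T (coeff p j) j (coeff p l) l" using i T_trans by blast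
    then show False using not_less_Least that unfolding i_def by blast
  qed
  moreover have "coeff p i \<noteq> 0"
  proof
    assume "coeff p i = 0"
    then have "coeff p (degree p) = 0" using i[rule_format, of "degree p"] by simp
    then show False using assms by simp
  qed
  ultimately show thesis using that i by blast
qed

lemma least_ex: "p \<noteq> 0 \<Longrightarrow> \<exists>a i. least p a i"
  using first_least[of p] T_refl unfolding least_def by metis

lemma least_nonzero: "least p a i \<Longrightarrow> p \<noteq> 0"
  unfolding least_def by auto

text \<open>Gauss's lemma: if \<open>i0\<close> and \<open>k0\<close> are the first indices of terms of least value, then all
  other contributions to the coefficient at \<open>i0 + k0\<close> contain a factor from before one of these indices
  and are strictly larger.\<close>

lemma least_mult:
  assumes p: "least p a i" and q: "least q b k"
  shows "least (p * q) (a * b) (i + k)"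
proof -
  obtain i0 where i0: "coeff p i0 \<noteq> 0" "\<And>j. T (coeff p i0) i0 (coeff p j) j" "\<And>j. j < i0 \<Longrightarrow> \<not> T (coeff p j) j (coeff p i0) i0"
    using first_least[OF least_nonzero[OF p]] by blast
  obtain k0 where k0: "coeff q k0 \<noteq> 0" "\<And>j. T (coeff q k0) k0 (coeff q j) j" "\<And>j. j < k0 \<Longrightarrow> \<not> T (coeff q j) j (coeff q k0) k0"
    using first_least[OF least_nonzero[OF q]] by blast
  have ai: "T a i (coeff p i0) i0" "T (coeff p i0) i0 a i"
    using p i0(2) T_trans unfolding least_def by blast+
  have bk: "T b k (coeff q k0) k0" "T (coeff q k0) k0 b k"
    using q k0(2) T_trans unfolding least_def by blast+
  have "T (a * b) (i + k) (coeff (p * q) n) n" for n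
    unfolding coeff_mult
  proof (rule T_sum)
    fix j assume "j \<in> {..n}"
    have "T a i (coeff p j) j" "T b k (coeff q (n - j)) (n - j)" using p q unfolding least_def by blast+
    from T_mult[OF this] show "T (a * b) (i + k) (coeff p j * coeff q (n - j)) n"
      using \<open>j \<in> {..n}\<close> by simp
  qed
  moreover have "T (coeff (p * q) (i0 + k0)) (i0 + k0) (a * b) (i + k)"
  proof -
    let ?m = "coeff p i0 * coeff q k0" and ?f = "\<lambda>j. coeff p j * coeff q (i0 + k0 - j)"
    have m0: "?m \<noteq> 0" using i0(1) k0(1) by simp
    have "\<not> T (?f j) (i0 + k0) ?m (i0 + k0)" if "j \<in> {..i0 + k0} - {i0}" for j
    proof (cases "j < i0")
      case True
      from T_mult_strict[OF i0(3)[OF this] k0(2)[of "i0 + k0 - j"] i0(1) k0(1)]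
      show ?thesis using True by simp
    next
      case False
      then have "i0 + k0 - j < k0" using that by auto
      from T_mult_strict[OF k0(3)[OF this] i0(2)[of j] k0(1) i0(1)]
      show ?thesis using that False by (simp add: mult.commute add.commute)
    qed
    then have rest: "\<not> T (sum ?f ({..i0 + k0} - {i0})) (i0 + k0) ?m (i0 + k0)"
      using m0 by (intro T_sum_strict) auto
    have sum: "coeff (p * q) (i0 + k0) = ?m + sum ?f ({..i0 + k0} - {i0})"
      unfolding coeff_mult by (subst sum.remove[of _ i0]) simp_all
    have "T (coeff (p * q) (i0 + k0)) (i0 + k0) ?m (i0 + k0)"
      unfolding sum T_same using rest K.add_eqv unfolding T_same by blast
    then show ?thesis using T_mult[OF ai(2) bk(2)] T_trans by blast
  qed
  ultimately show ?thesis using p q unfolding least_def by auto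
qed

definition P :: "'a poly \<Rightarrow> 'a poly \<Rightarrow> bool" where
  "P p q \<longleftrightarrow> (\<exists>i. \<forall>j. T (coeff p i) i (coeff q j) j)"

lemma P_iff: "least p a i \<Longrightarrow> P p q \<longleftrightarrow> (\<forall>j. T a i (coeff q j) j)"
  unfolding P_def least_def using T_trans by blast

lemma P_iff2: "least p a i \<Longrightarrow> least q b k \<Longrightarrow> P p q \<longleftrightarrow> T a i b k"
  unfolding P_iff[of p a i q] unfolding least_def using T_trans by blast

lemma P_0: "P p 0" "P 0 p \<longleftrightarrow> p = 0"
  by (auto simp: P_def intro: poly_eqI)

lemma valuation_exists:
  obtains le where "valuation_extension le0 le"
    "\<And>p q. le (peval p (var_x - const b)) (peval q (var_x - const b)) \<longleftrightarrow> P p q"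
proof -
  define sh where "sh = (\<lambda>p. pcompose p [:b, 1:])"
  have sh: "sh (p + q) = sh p + sh q" "sh (p * q) = sh p * sh q" "sh 0 = 0" "sh p = 0 \<longleftrightarrow> p = 0" for p q
    by (simp_all add: sh_def pcompose_add pcompose_mult pcompose_eq_0_iff)
  have tot: "P p q \<or> P q p" for p q
  proof (cases "p = 0 \<or> q = 0")
    case False
    then obtain a i c k where "least p a i" "least q c k" using least_ex by blast
    then show ?thesis using P_iff2 T_total by blast
  qed (auto simp: P_0)
  have tr: "P p r" if "P p q" "P q r" for p q r
  proof (cases "q = 0 \<or> p = 0")
    case False
    then obtain a i c k where *: "least p a i" "least q c k" using least_ex by blast
    have "T a i c k" "\<forall>j. T c k (coeff r j) j" using that P_iff2[OF *] P_iff[OF *(2)] by blast+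
    then show ?thesis using P_iff[OF *(1)] T_trans by blast
  qed (use that in \<open>auto simp: P_0\<close>)
  have mu: "P (r * p) (r * q) \<longleftrightarrow> P p q" if "r \<noteq> 0" for p q r
  proof (cases "p = 0 \<or> q = 0")
    case False
    then obtain a i c k where *: "least p a i" "least q c k" using least_ex by blast
    obtain d l where d: "least r d l" using least_ex[OF \<open>r \<noteq> 0\<close>] by blast
    have "d \<noteq> 0" using d by (simp add: least_def)
    then show ?thesis
      using P_iff2[OF least_mult[OF d *(1)] least_mult[OF d *(2)]] P_iff2[OF *] T_cancel by blast
  qed (use that in \<open>auto simp: P_0\<close>)
  have ad: "P r (p + q)" if "P r p" "P r q" for p q r
  proof (cases "r = 0")
    case False
    then obtain a i where *: "least r a i" using least_ex by blast
    show ?thesis using that T_add unfolding P_iff[OF *] by simp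
  qed (use that in \<open>auto simp: P_0\<close>)
  obtain le where le: "field_valuation le"
    "\<And>p q. le (to_fract p) (to_fract q) \<longleftrightarrow> P (sh p) (sh q)"
  proof (rule fract_preorder[of "\<lambda>p q. P (sh p) (sh q)"])
    show "P (sh p) (sh r)" if "P (sh p) (sh q)" "P (sh q) (sh r)" for p q r using tr that by blast
    show "P (sh r) (sh (p + q))" if "P (sh r) (sh p)" "P (sh r) (sh q)" for p q r
      using ad that by (simp add: sh)
    show "P (sh p) (sh q) \<or> P (sh q) (sh p)" for p q by (rule tot)
    show "P (sh (r * p)) (sh (r * q)) \<longleftrightarrow> P (sh p) (sh q)" if "r \<noteq> 0" for p q r
      using that mu by (simp add: sh)
    show "P (sh p) (sh 0)" for p by (simp add: sh P_0)
    show "p = 0" if "P (sh 0) (sh p)" for p using that by (simp add: sh P_0)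
    fix le assume "field_valuation le" "\<And>p q. le (to_fract p) (to_fract q) \<longleftrightarrow> P (sh p) (sh q)"
    then show thesis by (rule that)
  qed
  have pe: "le (peval p (var_x - const b)) (peval q (var_x - const b)) \<longleftrightarrow> P p q" for p q
  proof -
    have "sh (pcompose g [:- b, 1:]) = g" for g
      by (simp add: sh_def pcompose_pCons flip: pcompose_assoc)
    then show ?thesis unfolding peval_shift le(2) by simp
  qed
  have "le (const a) (const c) \<longleftrightarrow> le0 a c" for a c
  proof -
    have "le (const a) (const c) \<longleftrightarrow> P [:a:] [:c:]" using pe[of "[:a:]" "[:c:]"] by simp
    also have "\<dots> \<longleftrightarrow> le0 a c"
    proof (cases "a = 0")
      case True
      then show ?thesis by (simp add: P_0)
    next
      case False
      have "T a 0 (coeff [:a:] j) j" for j by (cases j) simp_all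
      then have "least [:a:] a 0" using False by (auto simp: least_def intro: exI[of _ 0])
      moreover have "(\<forall>j. T a 0 (coeff [:c:] j) j) \<longleftrightarrow> T a 0 c 0"
      proof
        assume "\<forall>j. T a 0 (coeff [:c:] j) j"
        from this[rule_format, of 0] show "T a 0 c 0" by simp
      next
        assume "T a 0 c 0"
        then show "\<forall>j. T a 0 (coeff [:c:] j) j" by (auto simp: coeff_pCons split: nat.split)
      qed
      ultimately show ?thesis using P_iff[of "[:a:]" a 0 "[:c:]"] T_same by simp
    qed
    finally show ?thesis .
  qed
  then have "valuation_extension le0 le"
    using le(1) K.field_valuation_axioms by (simp add: valuation_extension_def valuation_extension_axioms_def)
  then show thesis using that pe by blast
qed

end

section \<open>Orders on monomials: a rational value and a cut\<close>

context field_valuation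
begin

lemma power_int_mono: "le e f \<Longrightarrow> k \<ge> 0 \<Longrightarrow> le (e powi k) (f powi k)"
  by (simp add: power_int_def power_mono)

lemma power_int_antimono:
  assumes "le e f" "e \<noteq> 0" "f \<noteq> 0" "k \<le> 0"
  shows "le (f powi k) (e powi k)"
proof -
  have "le (e ^ nat (- k)) (f ^ nat (- k))" using assms(1) by (rule power_mono)
  then have "le (inverse (f ^ nat (- k))) (inverse (e ^ nat (- k)))"
    using assms(2,3) by (simp add: inverse_eq_divide le_divide_iff divide_le_iff)
  then show ?thesis using assms(4) by (cases "k = 0") (simp_all add: power_int_def power_inverse)
qed

text \<open>Here \<open>t\<close> receives the value of \<open>e\<close>.\<close>

lemma gauss_cone:
  assumes e: "e \<noteq> 0"
  shows "monomial_cone le (\<lambda>a k. le 1 (a * e powi k))"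
proof
  fix a b :: 'f and k l :: int
  assume "a \<noteq> 0"
  show "le 1 (a * e powi k) \<or> le 1 (inverse a * e powi (- k))"
  proof -
    have nz: "a * e powi k \<noteq> 0" using \<open>a \<noteq> 0\<close> e by simp
    have "inverse a * e powi (- k) = 1 / (a * e powi k)"
      by (simp add: power_int_minus divide_inverse)
    then show ?thesis using total[of 1 "a * e powi k"] le_divide_iff[OF nz, of 1 1] by simp
  qed
  show "le 1 (a * e powi 0) \<longleftrightarrow> le 1 a" by simp
  assume "le 1 (a * e powi k)" "le 1 (b * e powi l)"
  from mult_mono[OF this] show "le 1 (a * b * e powi (k + l))"
    using e by (simp add: power_int_add mult_ac)
qed

text \<open>The order on \<open>vK \<times> \<int>\<close> in which the generator \<open>\<omega>\<close> of \<open>\<int>\<close> realises the cut of \<open>S\<close>: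
  \<open>\<alpha> + k\<omega> \<ge> 0\<close> for \<open>k > 0\<close> iff \<open>\<alpha> + k\<sigma> \<ge> 0\<close> for some \<open>\<sigma>\<close> in \<open>S\<close>. For negative \<open>k\<close> the inequality is strict,
  so that no multiple of \<open>\<omega>\<close> falls into \<open>v\<^sub>0K\<close>.\<close>

definition cut_pos :: "'f set \<Rightarrow> 'f \<Rightarrow> int \<Rightarrow> bool" where
  "cut_pos S a k \<longleftrightarrow> (if k > 0 then \<exists>e\<in>S. le 1 (a * e powi k)
     else if k = 0 then le 1 a else \<forall>e\<in>S. lt 1 (a * e powi k))"

text \<open>The element of \<open>S\<close> that witnesses the first factor can be enlarged, and the second factor is
  positive at every element of \<open>S\<close>. So both can be evaluated at the same element.\<close>

lemma cut_pos_mult_mixed: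
  assumes S: "0 \<notin> S" and k: "cut_pos S a k" "k > 0" and l: "cut_pos S b l" "l < 0"
    and a: "a \<noteq> 0" and b: "b \<noteq> 0"
  shows "cut_pos S (a * b) (k + l)"
proof -
  obtain e where e: "e \<in> S" "le 1 (a * e powi k)" using k by (auto simp: cut_pos_def)
  have lf: "lt 1 (b * f powi l)" if "f \<in> S" for f
    using l that by (auto simp: cut_pos_def)
  have split: "a * b * f powi (k + l) = a * f powi k * (b * f powi l)" if "f \<in> S" for f
    using that S by (subst power_int_add) auto
  have e_prod: "lt 1 (a * b * e powi (k + l))"
    unfolding split[OF e(1)] using mult_le_lt[OF e(2) lf[OF e(1)]] by simp
  consider "k + l > 0" | "k + l = 0" | "k + l < 0" by linarith
  then show ?thesis
  proof cases
    case 1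
    then show ?thesis using e(1) lt_imp_le[OF e_prod] by (auto simp: cut_pos_def)
  next
    case 2
    then show ?thesis using lt_imp_le[OF e_prod] by (simp add: cut_pos_def)
  next
    case 3
    have "lt 1 (a * b * f powi (k + l))" if f: "f \<in> S" for f
    proof -
      obtain g where g: "g \<in> S" "le e g" "le f g" using total[of e f] e(1) f refl by blast
      have "le (e powi k) (g powi k)" using g(2) k(2) by (intro power_int_mono) auto
      then have "le 1 (a * g powi k)" using mult e(2) trans by blast
      from mult_le_lt[OF this lf[OF g(1)]] have "lt 1 (a * b * g powi (k + l))"
        unfolding split[OF g(1)] by simp
      moreover have "le (g powi (k + l)) (f powi (k + l))"
        using g f S 3 by (intro power_int_antimono) auto
      ultimately show ?thesis using mult trans by blast
    qed
    then show ?thesis using 3 by (simp add: cut_pos_def)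
  qed
qed

lemma cut_pos_mult_zero:
  assumes a: "cut_pos S a 0" "a \<noteq> 0" and b: "cut_pos S b l"
  shows "cut_pos S (a * b) l"
proof -
  have a1: "le 1 a" using a by (simp add: cut_pos_def)
  have 1: "le 1 (a * b * e powi l)" if "le 1 (b * e powi l)" for e
    using mult_mono[OF a1 that] by (simp add: mult_ac)
  have 2: "lt 1 (a * b * e powi l)" if "lt 1 (b * e powi l)" for e
    using mult_le_lt[OF a1 that] by (simp add: mult_ac)
  show ?thesis
  proof (cases "l > 0")
    case True
    then show ?thesis using b 1 by (auto simp: cut_pos_def)
  next
    case False
    then show ?thesis using b 1[of 1] 2 by (auto simp: cut_pos_def)
  qed
qed

lemma cut_cone:
  assumes S: "0 \<notin> S"
  shows "monomial_cone le (cut_pos S)"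
proof
  fix a b :: 'f and k l :: int
  assume a: "a \<noteq> 0"
  show "cut_pos S a 0 \<longleftrightarrow> le 1 a" by (simp add: cut_pos_def)
  show "cut_pos S a k \<or> cut_pos S (inverse a) (- k)"
  proof -
    have inv: "inverse a * e powi (- k) = 1 / (a * e powi k)" for e
      by (simp add: power_int_minus divide_inverse)
    have *: "le 1 (a * e powi k) \<longleftrightarrow> le (inverse a * e powi (- k)) 1" "le (a * e powi k) 1 \<longleftrightarrow> le 1 (inverse a * e powi (- k))"
      if "e \<in> S" for e
    proof -
      have nz: "a * e powi k \<noteq> 0" using a that S by auto
      show "le 1 (a * e powi k) \<longleftrightarrow> le (inverse a * e powi (- k)) 1"
        "le (a * e powi k) 1 \<longleftrightarrow> le 1 (inverse a * e powi (- k))"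
        unfolding inv using divide_le_iff[OF nz, of 1 1] le_divide_iff[OF nz, of 1 1] by simp_all
    qed
    have "le 1 a \<or> le 1 (inverse a)"
      using total[of 1 a] le_divide_iff[OF a, of 1 1] by (simp add: inverse_eq_divide)
    then show ?thesis using * by (auto simp: cut_pos_def)
  qed
  assume b: "b \<noteq> 0" and k: "cut_pos S a k" and l: "cut_pos S b l"
  show "cut_pos S (a * b) (k + l)"
  proof (cases "k = 0 \<or> l = 0")
    case True
    then show ?thesis
      using cut_pos_mult_zero[of S a b l] cut_pos_mult_zero[of S b a k] k l a b by (auto simp: mult.commute)
  next
    case False
    then consider "k > 0" "l > 0" | "k < 0" "l < 0" | "k > 0" "l < 0" | "k < 0" "l > 0" by linarith
    then show ?thesis
    proof cases
      case 1
      obtain e where e: "e \<in> S" "le 1 (a * e powi k)" using k 1 by (auto simp: cut_pos_def)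
      obtain f where f: "f \<in> S" "le 1 (b * f powi l)" using l 1 by (auto simp: cut_pos_def)
      obtain g where g: "g \<in> S" "le e g" "le f g" using total[of e f] e(1) f(1) refl by blast
      have "le (e powi k) (g powi k)" "le (f powi l) (g powi l)"
        using g 1 by (auto intro: power_int_mono)
      then have "le 1 (a * g powi k)" "le 1 (b * g powi l)" using mult e(2) f(2) trans by blast+
      from mult_mono[OF this] have "le 1 (a * b * g powi (k + l))"
        using g(1) S by (subst power_int_add) (auto simp: mult_ac)
      then show ?thesis using 1 g(1) by (auto simp: cut_pos_def)
    next
      case 2
      have "lt 1 (a * b * e powi (k + l))" if e: "e \<in> S" for e
      proof -
        have "lt 1 (a * e powi k)" "lt 1 (b * e powi l)" using k l 2 e by (auto simp: cut_pos_def)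
        from mult_le_lt[OF lt_imp_le[OF this(1)] this(2)] have "lt 1 (a * e powi k * (b * e powi l))" by simp
        moreover have "a * e powi k * (b * e powi l) = a * b * e powi (k + l)"
          using e S by (subst power_int_add) (auto simp: mult_ac)
        ultimately show ?thesis by simp
      qed
      then show ?thesis using 2 by (simp add: cut_pos_def)
    next
      case 3
      then show ?thesis using cut_pos_mult_mixed[OF S] k l a b by blast
    next
      case 4
      then show ?thesis using cut_pos_mult_mixed[OF S l _ k] a b by (simp add: mult.commute add.commute)
    qed
  qed
qed

end

lemma (in monomial_cone) monomial_valuation_exists:
  obtains le where "valuation_extension le0 le"
    "valuation_extension.monomial_at le (var_x - const b)"
    "\<And>a i c j. le (const a * (var_x - const b) ^ i) (const c * (var_x - const b) ^ j) \<longleftrightarrow> T a i c j"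
proof -
  obtain le where le: "valuation_extension le0 le"
    "\<And>p q. le (peval p (var_x - const b)) (peval q (var_x - const b)) \<longleftrightarrow> P p q"
    using valuation_exists[of b] by blast
  interpret valuation_extension le0 le by fact
  have mon: "P (monom a i) (monom c j) \<longleftrightarrow> T a i c j" for a i c j
  proof (cases "a = 0")
    case True
    then show ?thesis by (simp add: P_0)
  next
    case False
    have "T a i (coeff (monom a i) k) k" for k by simp
    then have "least (monom a i) a i" using False by (auto simp: least_def intro!: exI[of _ i])
    moreover have "(\<forall>k. T a i (coeff (monom c j) k) k) \<longleftrightarrow> T a i c j"
    proof
      assume "\<forall>k. T a i (coeff (monom c j) k) k"
      from this[rule_format, of j] show "T a i c j" by simp
    qed simp
    ultimately show ?thesis using P_iff by blast
  qed
  have "P p (monom (coeff p i) i)" for p i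
  proof (cases "p = 0")
    case False
    then obtain a k where a: "least p a k" using least_ex by blast
    then have "T a k (coeff p i) i" unfolding least_def by blast
    then show ?thesis unfolding P_iff[OF a] by simp
  qed (simp add: P_0)
  then have "monomial_at (var_x - const b)"
    unfolding monomial_at_def using le(2) by (metis peval_monom)
  moreover have "le (const a * (var_x - const b) ^ i) (const c * (var_x - const b) ^ j) \<longleftrightarrow> T a i c j" for a i c j
    using le(2)[of "monom a i" "monom c j"] mon by simp
  ultimately show thesis using that[OF le(1)] by blast
qed

section \<open>Comparing monomial valuations\<close>

lemma fract_preorder_eqI:
  fixes le le' :: "'r::idom fract \<Rightarrow> 'r fract \<Rightarrow> bool"
  assumes "field_valuation le" "field_valuation le'"
    and eq: "\<And>p q. le (to_fract p) (to_fract q) \<longleftrightarrow> le' (to_fract p) (to_fract q)"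
  shows "le = le'"
proof (intro ext)
  interpret A: field_valuation le by fact
  interpret B: field_valuation le' by fact
  fix u w :: "'r fract"
  obtain p s where 1: "s \<noteq> 0" "u = to_fract p / to_fract s" by (rule fract_cases)
  obtain q s' where 2: "s' \<noteq> 0" "w = to_fract q / to_fract s'" by (rule fract_cases)
  have nz: "to_fract (s * s') \<noteq> 0" using 1 2 by simp
  have u: "u = to_fract (p * s') / to_fract (s * s')" and w: "w = to_fract (q * s) / to_fract (s * s')"
    using 1 2 by simp_all
  show "le u w \<longleftrightarrow> le' u w"
    unfolding u w A.divide_cancel[OF nz] B.divide_cancel[OF nz] by (rule eq)
qed

lemma monomial_unique:
  fixes le le' :: "'a::field poly fract \<Rightarrow> 'a poly fract \<Rightarrow> bool"
  assumes le: "valuation_extension le0 le" "valuation_extension.monomial_at le t"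
    and le': "valuation_extension le0 le'" "valuation_extension.monomial_at le' t"
    and t: "t = var_x - const b"
    and eq: "\<And>a i c j. le (const a * t ^ i) (const c * t ^ j) \<longleftrightarrow> le' (const a * t ^ i) (const c * t ^ j)"
  shows "le = le'"
proof -
  interpret A: valuation_extension le0 le by fact
  interpret B: valuation_extension le0 le' by fact
  show ?thesis
  proof (rule fract_preorder_eqI)
    show "le (to_fract p) (to_fract q) \<longleftrightarrow> le' (to_fract p) (to_fract q)" for p q
      unfolding to_fract_shift[of p b] to_fract_shift[of q b] t[symmetric]
        A.monomial_le_iff[OF le(2)] B.monomial_le_iff[OF le'(2)] eq by (rule HOL.refl)
  qed (rule A.L.field_valuation_axioms B.L.field_valuation_axioms)+
qed

context valuation_extension
begin

lemma monomial_add_const: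
  assumes "monomial_at t"
  shows "le (t + const k) t" "le (t + const k) (const k)"
    and "le m (t + const k) \<longleftrightarrow> le m t \<and> le m (const k)"
    and "L.lt m (t + const k) \<longleftrightarrow> L.lt m t \<and> L.lt m (const k)"
proof -
  have "peval [:k, 1:] t = t + const k" by simp
  then show 1: "le (t + const k) t" and 2: "le (t + const k) (const k)"
    using assms[unfolded monomial_at_def, rule_format, of "[:k, 1:]" 1]
      assms[unfolded monomial_at_def, rule_format, of "[:k, 1:]" 0]
    by (simp_all add: add.commute)
  show "le m (t + const k) \<longleftrightarrow> le m t \<and> le m (const k)"
    using 1 2 L.trans L.add by blast
  show "L.lt m (t + const k) \<longleftrightarrow> L.lt m t \<and> L.lt m (const k)"
    using 1 2 L.trans L.add_lt by blast
qed

lemma monomial_closest: "monomial_at (var_x - const b) \<Longrightarrow> le (var_x - const c) (var_x - const b)"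
  using monomial_add_const(1)[of "var_x - const b" "b - c"] by simp

text \<open>Comparing \<open>k\<close> with \<open>t^n\<close> is comparing an \<open>n\<close>-th root of \<open>k\<close>, up to units, with \<open>t\<close>. For \<open>t = x - b\<close>
  the latter is recorded in the approximation type. This is the place where divisibility of
  \<open>v\<^sub>0K\<close> makes the extension unique.\<close>

lemma torsion_free_power_le:
  assumes t: "\<And>n c. n > 0 \<Longrightarrow> \<not> L.eqv (t ^ n) (const c)"
    and div: "\<And>k n. k \<noteq> 0 \<Longrightarrow> n > 0 \<Longrightarrow> \<exists>e. K.eqv (e ^ n) k" and k: "k \<noteq> 0" "n > 0"
  shows "le (const k) (t ^ n) \<longleftrightarrow> (\<exists>e. K.eqv (e ^ n) k \<and> le (const e) t)"
    and "le (t ^ n) (const k) \<longleftrightarrow> \<not> (\<exists>e. K.eqv (e ^ n) k \<and> le (const e) t)"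
proof -
  have *: "le (const k) (t ^ n) \<longleftrightarrow> le (const e) t" if "K.eqv (e ^ n) k" for e
  proof -
    have "L.eqv (const (e ^ n)) (const k)" using that by (simp only: const_le)
    then have "le (const k) (t ^ n) \<longleftrightarrow> le (const e ^ n) (t ^ n)" using L.trans unfolding const_power by blast
    then show ?thesis using L.power_le_iff[OF k(2)] by simp
  qed
  show 1: "le (const k) (t ^ n) \<longleftrightarrow> (\<exists>e. K.eqv (e ^ n) k \<and> le (const e) t)"
    using * div[OF k] by blast
  show "le (t ^ n) (const k) \<longleftrightarrow> \<not> (\<exists>e. K.eqv (e ^ n) k \<and> le (const e) t)"
    unfolding 1[symmetric] using t[OF k(2), of k] L.total by blast
qed

lemma torsion_free_monomials:
  assumes t: "\<And>n c. n > 0 \<Longrightarrow> \<not> L.eqv (t ^ n) (const c)" "t \<noteq> 0"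
    and div: "\<And>k n. k \<noteq> 0 \<Longrightarrow> n > 0 \<Longrightarrow> \<exists>e. K.eqv (e ^ n) k"
  shows "le (const a * t ^ i) (const c * t ^ j) \<longleftrightarrow> c = 0 \<or> a \<noteq> 0 \<and>
    (if i = j then le0 a c
     else if i < j then \<exists>e. K.eqv (e ^ (j - i)) (a / c) \<and> le (const e) t
     else \<not> (\<exists>e. K.eqv (e ^ (i - j)) (c / a) \<and> le (const e) t))"
proof (cases "c = 0 \<or> a = 0")
  case True
  then show ?thesis using t(2) by (auto simp: L.zero K.zero)
next
  case False
  then have nz: "a \<noteq> 0" "c \<noteq> 0" by auto
  consider "i = j" | "i < j" | "j < i" by linarith
  then show ?thesis
  proof cases
    case 1
    then show ?thesis using nz t(2) by simp
  next
    case 2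
    then have "t ^ j = t ^ (j - i) * t ^ i" by (simp flip: power_add)
    then have "le (const a * t ^ i) (const c * t ^ j) \<longleftrightarrow> le (const a * t ^ i) ((t ^ (j - i) * const c) * t ^ i)"
      by (simp add: mult_ac)
    also have "\<dots> \<longleftrightarrow> le (const a) (t ^ (j - i) * const c)" using t(2) by simp
    also have "\<dots> \<longleftrightarrow> le (const (a / c)) (t ^ (j - i))" using nz by (simp add: L.divide_le_iff)
    finally show ?thesis using torsion_free_power_le(1)[OF t(1) div, of "a / c" "j - i"] nz 2 by simp
  next
    case 3
    then have "t ^ i = t ^ (i - j) * t ^ j" by (simp flip: power_add)
    then have "le (const a * t ^ i) (const c * t ^ j) \<longleftrightarrow> le ((t ^ (i - j) * const a) * t ^ j) (const c * t ^ j)"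
      by (simp add: mult_ac)
    also have "\<dots> \<longleftrightarrow> le (t ^ (i - j) * const a) (const c)" using t(2) by simp
    also have "\<dots> \<longleftrightarrow> le (t ^ (i - j)) (const (c / a))" using nz by (simp add: L.le_divide_iff)
    finally show ?thesis using torsion_free_power_le(2)[OF t(1) div, of "c / a" "i - j"] nz 3 by simp
  qed
qed

lemma rational_monomials:
  assumes t: "L.eqv t (const g)"
  shows "le (const a * t ^ i) (const c * t ^ j) \<longleftrightarrow> le0 (a * g ^ i) (c * g ^ j)"
proof -
  have *: "L.eqv (const a * t ^ i) (const (a * g ^ i))" for a i
  proof -
    have "L.eqv (t ^ i) (const g ^ i)" using t L.power_mono by blast
    then have "L.eqv (const a * t ^ i) (const a * const g ^ i)" using L.mult by blast
    then show ?thesis by simp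
  qed
  have "le (const a * t ^ i) (const c * t ^ j) \<longleftrightarrow> le (const (a * g ^ i)) (const (c * g ^ j))"
    using *[of a i] *[of c j] L.trans by blast
  then show ?thesis by (simp only: const_le)
qed

end

lemma divisible_elements:
  assumes v0: "is_valuation v0" and div: "divisible_group (vgroup v0)" and k: "k \<noteq> 0" "n > 0"
  shows "\<exists>e. vrel v0 (e ^ n) k \<and> vrel v0 k (e ^ n)"
proof -
  obtain \<gamma> where \<gamma>: "val v0 k = Some \<gamma>" "\<gamma> \<in> carrier (vgroup v0)" using val_SomeE[OF v0 k(1)] .
  then obtain \<delta> where \<delta>: "\<delta> \<in> carrier (vgroup v0)" "\<delta> [^]\<^bsub>vgroup v0\<^esub> n = \<gamma>"
    using div k(2) unfolding divisible_group_def by blast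
  obtain e where "val v0 e = Some \<delta>" using is_valuationD(6)[OF v0 \<delta>(1)] by blast
  then have "val v0 (e ^ n) = val v0 k" using val_power[OF v0] \<delta>(2) \<gamma>(1) by simp
  then show ?thesis unfolding vrel_eqv_iff[OF v0] by blast
qed

section \<open>The four kinds of almost pure extensions\<close>

lemma var_x_neq_const [simp]: "var_x \<noteq> const c"
proof
  assume "var_x = const c"
  then have "to_fract [:0, 1:] = to_fract [:c:]" by (simp add: var_x_def const_def)
  then show False by (simp only: to_fract_eq_iff) simp
qed

lemma var_x_minus_const: "var_x - const c \<noteq> 0"
  by simp

text \<open>In a residue-extending type, a point of the intersection lies outside the open ball of some radius
  in the support. In a value-extending type that open ball belongs to the type and contains the
  point.\<close>

lemma (in approx) not_value_and_residue_extending: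
  "value_extending_type A \<Longrightarrow> residue_extending_type A \<Longrightarrow> False"
  unfolding value_extending_iff residue_extending_iff mem_Inter_type by (metis ex_in_conv mem_Inter_type)

lemma (in valuation_extension) near_const_residue:
  assumes "L.near u (const c)" "le 1 u"
  shows "le0 1 c" "L.lt 1 (u - const c)"
proof -
  have "le 1 (const c)" using L.diff_eqv[OF assms(1)] assms(2) L.trans by blast
  then show "L.lt 1 (u - const c)" using assms(1) L.trans by blast
  show "le0 1 c" using \<open>le 1 (const c)\<close> const_le[of 1 c] by simp
qed

context
  fixes v0 :: "('a::field, 'g0) valuation" and v :: "('a poly fract, 'g) valuation"
  assumes v0: "is_valuation v0" and v: "extends v0 v"
begin

interpretation valuation_extension "vrel v0" "vrel v"
  using valuation_extensionI[OF v0 v] .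

interpretation A: approx v0 "appr v0 v var_x"
  using approx_appr[OF v0 v] .

lemma appr_nontrivial: "\<not> trivial_type (appr v0 v var_x)"
  unfolding A.trivial_type_iff closed_at_appr[OF v0 v] by simp

lemma base_residues_fullI:
  assumes "\<And>u. L.eqv u 1 \<Longrightarrow> \<exists>c. L.near u (const c)"
  shows "base_residues v0 v = carrier (residue_field v)"
  unfolding base_residues_eq_carrier_iff[OF v0 v]
proof (intro allI impI)
  fix u assume u: "vrel v 1 u"
  show "\<exists>c. vrel v0 1 c \<and> \<not> vrel v (u - const c) 1"
  proof (cases "vrel v u 1")
    case True
    then show ?thesis using assms near_const_residue u by metis
  next
    case False
    then show ?thesis by (intro exI[of _ 0]) (simp add: K.zero)
  qed
qed

lemma value_transcendental_scale:
  assumes "value_transcendental v0 v (const d * t)"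
  shows "value_transcendental v0 v t"
  unfolding value_transcendental_iff[OF v0 v]
proof (intro conjI allI impI notI)
  note dt = assms[unfolded value_transcendental_iff[OF v0 v]]
  show "t = 0 \<Longrightarrow> False" using dt by simp
  fix n :: nat and c assume n: "n > 0" and "L.eqv (t ^ n) (const c)"
  then have "L.eqv (const (d ^ n) * t ^ n) (const (d ^ n) * const c)" using L.mult by blast
  then have "L.eqv ((const d * t) ^ n) (const (d ^ n * c))" by (simp add: power_mult_distrib)
  then show False using dt n by blast
qed

lemma value_transcendental_elem:
  assumes "value_transcendental v0 v t"
  shows "n > 0 \<Longrightarrow> \<not> L.eqv (t ^ n) (const c)" "t \<noteq> 0"
  using assms unfolding value_transcendental_iff[OF v0 v] by blast+

text \<open>No element of \<open>K\<close> is closer to \<open>x\<close> than \<open>b\<close>, since \<open>x - c\<close> has the value of one of its terms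
  \<open>x - b\<close> and \<open>b - c\<close> that is least.\<close>

lemma center_in_Inter:
  assumes "monomial_at (var_x - const b)"
  shows "b \<in> Inter_type (appr v0 v var_x)"
  unfolding A.mem_Inter_type closed_at_appr[OF v0 v] open_at_appr[OF v0 v]
  using monomial_closest[OF assms] L.trans by blast

text \<open>By the unique least terms of numerator and denominator, every nonzero element has the leading term
  \<open>a t^m / t^n\<close>. A unit must have \<open>m = n\<close>, hence a residue in \<open>Kv\<^sub>0\<close>.\<close>

lemma value_transcendental_case:
  assumes b: "value_transcendental v0 v (var_x - const b)"
  shows "value_transcendental_ext v0 v" "\<not> immediate_ext v0 v" "\<not> residue_transcendental_ext v0 v"
    "value_extending_type (appr v0 v var_x)"
proof -
  define t where "t = var_x - const b"
  have t: "\<And>n c. n > 0 \<Longrightarrow> \<not> L.eqv (t ^ n) (const c)" "t \<noteq> 0"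
    using value_transcendental_elem[OF b] unfolding t_def by blast+
  have frac: "\<exists>a m n. a \<noteq> 0 \<and> L.near u (const a * t ^ m / t ^ n)" if "u \<noteq> 0" for u
    using value_transcendental_fraction[OF t t_def \<open>u \<noteq> 0\<close>] by blast
  show "value_transcendental_ext v0 v"
  proof (rule value_transcendental_extI[OF v0 v b])
    fix u :: "'a poly fract" assume "u \<noteq> 0"
    then obtain a m n where "L.near u (const a * t ^ m / t ^ n)" using frac by blast
    from L.diff_eqv[OF this] have "L.eqv (u * t ^ n) (const a * t ^ m)"
      using t(2) L.le_divide_iff[of "t ^ n"] L.divide_le_iff[of "t ^ n"] by simp
    then show "\<exists>c m n. L.eqv (u * (var_x - const b) ^ n) (const c * (var_x - const b) ^ m)"
      unfolding t_def by blast
  qed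
  have "base_group v0 v \<noteq> carrier (vgroup v)"
    unfolding base_group_eq_carrier_iff[OF v0 v] using t(1)[of 1] t(2) by auto
  then show "\<not> immediate_ext v0 v" by (simp add: immediate_ext_def)
  have "base_residues v0 v = carrier (residue_field v)"
  proof (rule base_residues_fullI)
    fix u :: "'a poly fract" assume u: "L.eqv u 1"
    then have "u \<noteq> 0" by auto
    then obtain a m n where a: "a \<noteq> 0" "L.near u (const a * t ^ m / t ^ n)" using frac by blast
    have "L.eqv (const a * t ^ m / t ^ n) 1" using L.diff_eqv[OF a(2)] u L.trans by blast
    then have eq: "L.eqv (const a * t ^ m) (const 1 * t ^ n)"
      using t(2) L.le_divide_iff[of "t ^ n" 1] L.divide_le_iff[of "t ^ n" _ 1] by simp
    have "m = n"
      using value_transcendental_terms[OF t(1) _ a(1) one_neq_zero t(2), of m n]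
        value_transcendental_terms[OF t(1) _ one_neq_zero a(1) t(2), of n m] eq by (cases m n rule: linorder_cases) auto
    then have "L.near u (const a)" using a(2) t(2) by simp
    then show "\<exists>c. L.near u (const c)" by blast
  qed
  then show "\<not> residue_transcendental_ext v0 v" by (rule not_residue_transcendental_ext[OF v0 v])
  have mono: "monomial_at t" using value_transcendental_monomial[OF t] by blast
  show "value_extending_type (appr v0 v var_x)"
    unfolding A.value_extending_iff
  proof (intro conjI allI impI)
    show "Inter_type (appr v0 v var_x) \<noteq> {}" using center_in_Inter mono unfolding t_def by blast
    fix e c assume "closed_at v0 (appr v0 v var_x) e c"
    then have "vrel v (const e) (var_x - const c)" by (simp add: closed_at_appr[OF v0 v])
    then have et: "vrel v (const e) t" using monomial_closest[OF mono[unfolded t_def]] L.trans unfolding t_def by blast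
    then have "e \<noteq> 0" using t(2) by auto
    moreover have "L.lt (const e) t" using et t(1)[of 1 e] by auto
    ultimately show "\<exists>a. open_at v0 (appr v0 v var_x) e a"
      unfolding open_at_appr[OF v0 v] t_def by blast
  qed (rule appr_nontrivial)
qed

lemma residue_transcendental_elem:
  assumes "residue_transcendental v0 v (const d * (var_x - const b))"
  shows "d \<noteq> 0" "L.eqv (const d * (var_x - const b)) 1" "monomial_at (const d * (var_x - const b))"
    "monomial_at (var_x - const b)" "L.eqv (var_x - const b) (const (inverse d))"
proof -
  let ?s = "const d * (var_x - const b)"
  note s = assms[unfolded residue_transcendental_iff[OF v0 v]]
  show e: "L.eqv ?s 1" using s by blast
  then show d: "d \<noteq> 0" by auto
  show m: "monomial_at ?s"
    by (rule residue_monomial[OF e]) (use s in blast)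
  have eq: "const (inverse d) * ?s = var_x - const b" using d by simp
  show "monomial_at (var_x - const b)" using monomial_scale[OF m, of "inverse d"] unfolding eq .
  have "L.eqv (const (inverse d) * ?s) (const (inverse d) * 1)" using e L.mult by blast
  then show "L.eqv (var_x - const b) (const (inverse d))" unfolding eq mult_1_right .
qed

text \<open>The valuation is a Gauss valuation in \<open>s\<close>, so its values are those of coefficients.\<close>

lemma residue_transcendental_case:
  assumes s: "residue_transcendental v0 v (const d * (var_x - const b))"
  shows "residue_transcendental_ext v0 v" "\<not> immediate_ext v0 v" "\<not> value_transcendental_ext v0 v"
    "residue_extending_type (appr v0 v var_x)"
proof -
  define s where "s = const d * (var_x - const b)"
  note el = residue_transcendental_elem[OF s]
  have s1: "L.eqv s 1" and mono: "monomial_at s" using el unfolding s_def by blast+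
  note frac = residue_fraction[OF s1 mono s_def]
  have group: "\<exists>c. L.eqv u (const c)" if u0: "u \<noteq> 0" for u
  proof -
    obtain p q where pq: "L.eqv (peval q s) 1" "u * peval q s = peval p s" "p \<noteq> 0" using frac[OF u0] by blast
    obtain i where i: "L.eqv (peval p s) (const (coeff p i))" using residue_attained[OF s1 mono pq(3)] by blast
    have "L.eqv (u * peval q s) (u * 1)" using pq(1) L.mult by blast
    then have "L.eqv u (peval p s)" using pq(2) by simp
    then show ?thesis using i L.trans by blast
  qed
  have bg: "base_group v0 v = carrier (vgroup v)"
    unfolding base_group_eq_carrier_iff[OF v0 v] using group by blast
  show "\<not> value_transcendental_ext v0 v" by (rule not_value_transcendental_ext[OF v0 v bg])
  show "\<not> immediate_ext v0 v"
    using residue_transcendental_not_base[OF v0 v s] by (simp add: immediate_ext_def)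
  show "residue_transcendental_ext v0 v"
  proof (rule residue_transcendental_extI[OF v0 v s], fold s_def)
    fix u assume u: "vrel v 1 u"
    show "\<exists>p q. (\<forall>i. vrel v0 1 (coeff p i)) \<and> (\<forall>i. vrel v0 1 (coeff q i)) \<and>
      vrel v (peval q s) 1 \<and> \<not> vrel v (u * peval q s - peval p s) 1"
    proof (cases "u = 0")
      case True
      then show ?thesis by (intro exI[of _ 0] exI[of _ 1]) (simp add: K.zero coeff_1)
    next
      case False
      then obtain p q where pq: "\<forall>i. vrel v0 1 (coeff q i)" "L.eqv (peval q s) 1"
        "u * peval q s = peval p s" "p \<noteq> 0" using frac by blast
      obtain i where i: "L.eqv (peval p s) (const (coeff p i))" "\<And>j. vrel v0 (coeff p i) (coeff p j)"
        using residue_attained[OF s1 mono pq(4)] by blast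
      have "vrel v (1 * 1) (u * peval q s)" using L.mult_mono[OF u] pq(2) by blast
      then have "vrel v 1 (const (coeff p i))" using i(1) pq(3) L.trans unfolding mult_1 by metis
      then have "vrel v0 1 (coeff p i)" using const_le[of 1 "coeff p i"] by simp
      then have "\<forall>j. vrel v0 1 (coeff p j)" using i(2) K.trans by blast
      moreover have "\<not> vrel v (u * peval q s - peval p s) 1" using pq(3) by simp
      ultimately show ?thesis using pq(1,2) by blast
    qed
  qed
  show "residue_extending_type (appr v0 v var_x)"
    unfolding A.residue_extending_iff
  proof (intro conjI allI)
    show "Inter_type (appr v0 v var_x) \<noteq> {}" using center_in_Inter el(4) by blast
    fix c
    obtain e where "L.eqv (var_x - const c) (const e)" using group[OF var_x_minus_const] by blast
    then show "\<exists>e. closed_at v0 (appr v0 v var_x) e c \<and> \<not> open_at v0 (appr v0 v var_x) e c"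
      unfolding closed_at_appr[OF v0 v] open_at_appr[OF v0 v] by blast
  qed (rule appr_nontrivial)
qed

lemma dense_extI:
  assumes "dense_approx v0 (appr v0 v var_x)"
  shows "dense_ext v0 (appr v0 v var_x) (vrel v)"
  using assms valuation_extensionI[OF v0 v] closed_at_appr[OF v0 v]
  by (simp add: dense_ext_def dense_ext_axioms_def)

end

lemma dense_approxI:
  assumes "approx v0 A" "transcendental_immediate_type v0 A \<or> algebraic_completion_type v0 A"
  shows "dense_approx v0 A"
proof -
  have imm: "immediate_type A"
    using assms(2) by (auto simp: transcendental_immediate_type_def algebraic_completion_type_def algebraic_immediate_type_def)
  interpret immediate_approx v0 A
    using assms(1) imm by (simp add: immediate_approx_def immediate_approx_axioms_def)
  show ?thesis
  proof
    from assms(2) show "(\<forall>g. g \<noteq> 0 \<longrightarrow> stable g) \<or> (\<forall>e. e \<noteq> 0 \<longrightarrow> (\<exists>c. cl e c))"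
      using transcendental_stable supp_full unfolding algebraic_completion_type_def by blast
  qed
qed

lemma transcendental_immediate_case:
  assumes v0: "is_valuation v0" and v: "extends v0 v"
    and tr: "transcendental_immediate_type v0 (appr v0 v var_x)"
  shows "immediate_ext v0 v" "\<not> value_transcendental_ext v0 v" "\<not> residue_transcendental_ext v0 v"
proof -
  interpret dense_ext v0 "appr v0 v var_x" "vrel v"
    using dense_extI[OF v0 v dense_approxI[OF approx_appr[OF v0 v]]] tr by blast
  have st: "stable g" if "g \<noteq> 0" for g using transcendental_stable[OF tr that] .
  have bg: "base_group v0 v = carrier (vgroup v)"
    unfolding base_group_eq_carrier_iff[OF v0 v] using near_const_if_all_stable[OF st] by blast
  have br: "base_residues v0 v = carrier (residue_field v)"
    by (rule base_residues_fullI[OF v0 v unit_near_const])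
  show "immediate_ext v0 v" using bg br by (simp add: immediate_ext_def)
  show "\<not> value_transcendental_ext v0 v" by (rule not_value_transcendental_ext[OF v0 v bg])
  show "\<not> residue_transcendental_ext v0 v" by (rule not_residue_transcendental_ext[OF v0 v br])
qed

text \<open>The value of \<open>F\<close> lies above \<open>v\<^sub>0K\<close>, so it is not torsion; yet units still have residues in \<open>Kv\<^sub>0\<close>,
  since a unit has a stable numerator and a stable denominator.\<close>

lemma algebraic_completion_case:
  assumes v0: "is_valuation v0" and v: "extends v0 v"
    and al: "algebraic_completion_type v0 (appr v0 v var_x)"
  shows "value_transcendental_ext v0 v" "\<not> immediate_ext v0 v" "\<not> residue_transcendental_ext v0 v"
proof -
  interpret dense_ext v0 "appr v0 v var_x" "vrel v"
    using dense_extI[OF v0 v dense_approxI[OF approx_appr[OF v0 v]]] al by blast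
  have "\<not> (\<forall>g. g \<noteq> 0 \<longrightarrow> stable g)"
    using al stable_transcendental by (auto simp: algebraic_completion_type_def algebraic_immediate_type_def)
  then obtain F where F: "\<And>e. e \<noteq> 0 \<Longrightarrow> L.lt (const e) F" "F \<noteq> 0"
    "\<And>u. u \<noteq> 0 \<Longrightarrow> \<exists>c m n. L.eqv (u * F ^ n) (const c * F ^ m)"
    using unstable_generator by blast
  have pw: "\<not> L.eqv (F ^ n) (const c)" if n: "n > 0" for n c
  proof
    assume eqv: "L.eqv (F ^ n) (const c)"
    then have c: "c \<noteq> 0" using F(2) by auto
    obtain k where k: "n = Suc k" using n gr0_implies_Suc by blast
    have "vrel v 1 F" using F(1)[of 1] L.lt_imp_le by simp
    then have "vrel v 1 (F ^ k)" using L.power_mono[of 1 F k] by simp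
    from L.mult[OF this, of F] have "vrel v F (F ^ n)" by (simp add: k)
    then show False using eqv F(1)[OF c] L.trans by blast
  qed
  have vt: "value_transcendental v0 v F"
    unfolding value_transcendental_iff[OF v0 v] using pw F(2) by blast
  show "value_transcendental_ext v0 v"
    by (rule value_transcendental_extI[OF v0 v vt]) (use F(3) in blast)
  have "base_group v0 v \<noteq> carrier (vgroup v)"
    unfolding base_group_eq_carrier_iff[OF v0 v] using pw[of 1] F(2) by auto
  then show "\<not> immediate_ext v0 v" by (simp add: immediate_ext_def)
  show "\<not> residue_transcendental_ext v0 v"
    by (rule not_residue_transcendental_ext[OF v0 v base_residues_fullI[OF v0 v unit_near_const]])
qed

section \<open>Extensions with the same approximation type\<close>

lemma appr_cong:
  assumes v0: "is_valuation v0" and v: "extends v0 v" and w: "extends v0 w" and eq: "vrel v = vrel w"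
  shows "appr v0 v y = appr v0 w y"
  by (rule approx_eqI[OF approx_appr[OF v0 v] approx_appr[OF v0 w]])
    (simp_all add: closed_at_appr[OF v0 v] closed_at_appr[OF v0 w] open_at_appr[OF v0 v] open_at_appr[OF v0 w] eq)

lemma dense_unique:
  assumes v0: "is_valuation v0" and v: "extends v0 v" and w: "extends v0 w"
    and eq: "appr v0 w var_x = appr v0 v var_x"
    and type: "transcendental_immediate_type v0 (appr v0 v var_x) \<or> algebraic_completion_type v0 (appr v0 v var_x)"
  shows "vrel v = vrel w"
proof -
  have d: "dense_approx v0 (appr v0 v var_x)" using dense_approxI[OF approx_appr[OF v0 v] type] .
  have "vrel v = dense_approx.dense_le v0 (appr v0 v var_x)"
    by (rule dense_ext.le_eq_dense_le[OF dense_extI[OF v0 v d]])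
  moreover have "vrel w = dense_approx.dense_le v0 (appr v0 w var_x)"
    by (rule dense_ext.le_eq_dense_le[OF dense_extI[OF v0 w]]) (simp add: eq d)
  ultimately show ?thesis by (simp add: eq)
qed

text \<open>If \<open>x - a\<close> had smaller value than \<open>x - b\<close>, this would be a radius of the support, and the open ball of
  that radius would miss \<open>a\<close>. So two extensions with the same approximation type can be
  compared at a common centre.\<close>

lemma value_transcendental_recenter:
  assumes v0: "is_valuation v0" and v: "extends v0 v" and b: "value_transcendental v0 v (var_x - const b)"
    and a: "a \<in> Inter_type (appr v0 v var_x)"
  shows "value_transcendental v0 v (var_x - const a)"
proof -
  interpret valuation_extension "vrel v0" "vrel v" using valuation_extensionI[OF v0 v] .
  interpret A: approx v0 "appr v0 v var_x" using approx_appr[OF v0 v] .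
  define t where "t = var_x - const b"
  have t: "\<And>n c. n > 0 \<Longrightarrow> \<not> L.eqv (t ^ n) (const c)"
    using value_transcendental_elem[OF v0 v b] unfolding t_def by blast
  have xa: "var_x - const a = t + const (b - a)" by (simp add: t_def)
  have "L.lt t (const (b - a))"
  proof (rule ccontr)
    assume "\<not> L.lt t (const (b - a))"
    then have lt: "L.lt (const (b - a)) t" using t[of 1 "b - a"] by auto
    then have "L.eqv (const (b - a) + t) (const (b - a))" by (rule L.add_eqv)
    then have eqv: "L.eqv (var_x - const a) (const (b - a))" by (simp only: xa add.commute)
    then have "closed_at v0 (appr v0 v var_x) (b - a) a" by (simp add: closed_at_appr[OF v0 v])
    then obtain c where "open_at v0 (appr v0 v var_x) (b - a) c"
      using value_transcendental_case(4)[OF v0 v b] unfolding A.value_extending_iff by blast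
    then have "open_at v0 (appr v0 v var_x) (b - a) a" using a unfolding A.mem_Inter_type by blast
    then show False using eqv by (simp add: open_at_appr[OF v0 v])
  qed
  then have "L.eqv (var_x - const a) t" unfolding xa by (rule L.add_eqv)
  then have pw: "L.eqv ((var_x - const a) ^ n) (t ^ n)" for n using L.power_mono by blast
  show ?thesis
    unfolding value_transcendental_iff[OF v0 v]
  proof (intro conjI allI impI notI)
    fix n :: nat and c assume "n > 0" "L.eqv ((var_x - const a) ^ n) (const c)"
    then show False using pw[of n] t[of n c] L.trans by blast
  qed simp
qed

lemma value_transcendental_unique:
  assumes v0: "is_valuation v0" and div: "divisible_group (vgroup v0)"
    and v: "extends v0 v" and w: "extends v0 w"
    and eq: "appr v0 w var_x = appr v0 v var_x"
    and b: "value_transcendental v0 v (var_x - const b)" and b': "value_transcendental v0 w (var_x - const b')"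
  shows "vrel v = vrel w"
proof -
  interpret V: valuation_extension "vrel v0" "vrel v" using valuation_extensionI[OF v0 v] .
  interpret W: valuation_extension "vrel v0" "vrel w" using valuation_extensionI[OF v0 w] .
  define t where "t = var_x - const b"
  have tv: "\<And>n c. n > 0 \<Longrightarrow> \<not> V.L.eqv (t ^ n) (const c)" "t \<noteq> 0"
    using value_transcendental_elem[OF v0 v b] unfolding t_def by blast+
  have mv: "V.monomial_at t" using V.value_transcendental_monomial[OF tv] by blast
  have "b \<in> Inter_type (appr v0 w var_x)"
    unfolding eq using center_in_Inter[OF v0 v] mv unfolding t_def by blast
  then have bw: "value_transcendental v0 w t"
    unfolding t_def using value_transcendental_recenter[OF v0 w b'] by blast
  have tw: "\<And>n c. n > 0 \<Longrightarrow> \<not> W.L.eqv (t ^ n) (const c)"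
    using value_transcendental_elem[OF v0 w bw] by blast
  have mw: "W.monomial_at t" using W.value_transcendental_monomial[OF tw tv(2)] by blast
  have dv: "\<exists>e. vrel v0 (e ^ n) k \<and> vrel v0 k (e ^ n)" if "k \<noteq> 0" "n > 0" for k :: 'a and n :: nat
    using divisible_elements[OF v0 div that] .
  have et: "vrel v (const e) t \<longleftrightarrow> vrel w (const e) t" for e
    using closed_at_appr[OF v0 v, of var_x e b] closed_at_appr[OF v0 w, of var_x e b] unfolding eq t_def by simp
  show ?thesis
  proof (rule monomial_unique[OF V.valuation_extension_axioms mv W.valuation_extension_axioms mw t_def])
    fix a i c j
    let ?\<Phi> = "c = 0 \<or> a \<noteq> 0 \<and>
      (if i = j then vrel v0 a c
       else if i < j then \<exists>e. (vrel v0 (e ^ (j - i)) (a / c) \<and> vrel v0 (a / c) (e ^ (j - i))) \<and> vrel w (const e) t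
       else \<not> (\<exists>e. (vrel v0 (e ^ (i - j)) (c / a) \<and> vrel v0 (c / a) (e ^ (i - j))) \<and> vrel w (const e) t))"
    have "vrel v (const a * t ^ i) (const c * t ^ j) \<longleftrightarrow> ?\<Phi>"
      unfolding et[symmetric] by (rule V.torsion_free_monomials) (fact tv dv)+
    moreover have "vrel w (const a * t ^ i) (const c * t ^ j) \<longleftrightarrow> ?\<Phi>"
      by (rule W.torsion_free_monomials) (fact tw tv dv)+
    ultimately show "vrel v (const a * t ^ i) (const c * t ^ j) \<longleftrightarrow> vrel w (const a * t ^ i) (const c * t ^ j)"
      by simp
  qed
qed

text \<open>Both extensions are Gauss valuations around the centre \<open>b\<close> of the first one, because
  \<open>b\<close> lies in every ball of the common approximation type. The value of \<open>x - b\<close> is the largest radius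
  of the support.\<close>

lemma residue_transcendental_unique:
  assumes v0: "is_valuation v0" and v: "extends v0 v" and w: "extends v0 w"
    and eq: "appr v0 w var_x = appr v0 v var_x"
    and s: "residue_transcendental v0 v (const d * (var_x - const b))"
    and s': "residue_transcendental v0 w (const d' * (var_x - const b'))"
  shows "vrel v = vrel w"
proof -
  interpret V: valuation_extension "vrel v0" "vrel v" using valuation_extensionI[OF v0 v] .
  interpret W: valuation_extension "vrel v0" "vrel w" using valuation_extensionI[OF v0 w] .
  interpret A: approx v0 "appr v0 v var_x" using approx_appr[OF v0 v] .
  note ev = residue_transcendental_elem[OF v0 v s] and ew = residue_transcendental_elem[OF v0 w s']
  note cv = closed_at_appr[OF v0 v] and cw = closed_at_appr[OF v0 w, of var_x, unfolded eq]
  note ov = open_at_appr[OF v0 v] and ow = open_at_appr[OF v0 w, of var_x, unfolded eq]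
  define t where "t = var_x - const b"
  have bI: "b \<in> Inter_type (appr v0 v var_x)" using center_in_Inter[OF v0 v ev(4)] .
  have "closed_at v0 (appr v0 v var_x) (inverse d') b'" unfolding cw using ew(5) by blast
  then have "closed_at v0 (appr v0 v var_x) (inverse d') b" using bI unfolding A.mem_Inter_type by blast
  then have "vrel w (const (inverse d')) t" unfolding cw t_def .
  then have "vrel w (var_x - const b') (t - (var_x - const b'))"
    using ew(5) W.L.trans W.L.diff W.L.refl by blast
  then have "vrel w (var_x - const b') (const (b' - b))" by (simp add: t_def)
  then have "W.monomial_at (var_x - const b' + const (b' - b))"
    by (rule W.monomial_shift[OF ew(4) var_x_minus_const])
  moreover have "var_x - const b' + const (b' - b) = t" by (simp add: t_def)
  ultimately have mw: "W.monomial_at t" by simp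
  have gv: "V.L.eqv t (const (inverse d))" using ev(5) by (simp add: t_def)
  then have "closed_at v0 (appr v0 v var_x) (inverse d) b" "\<not> open_at v0 (appr v0 v var_x) (inverse d) b"
    unfolding cv ov t_def by blast+
  then have gw: "W.L.eqv t (const (inverse d))"
    using ev(1) unfolding cw ow t_def by simp
  show ?thesis
  proof (rule monomial_unique[OF V.valuation_extension_axioms _ W.valuation_extension_axioms mw t_def])
    show "V.monomial_at t" using ev(4) by (simp add: t_def)
    fix a i c j
    show "vrel v (const a * t ^ i) (const c * t ^ j) \<longleftrightarrow> vrel w (const a * t ^ i) (const c * t ^ j)"
      unfolding V.rational_monomials[OF gv] W.rational_monomials[OF gw] by (rule HOL.refl)
  qed
qed

section \<open>Realising approximation types\<close>

context dense_approx
begin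

lemma dense_le_poly:
  assumes p: "stable p"
  shows "dense_le (to_fract p) (to_fract q) \<longleftrightarrow> eventually (\<lambda>c. le0 (poly p c) (poly q c)) Fil"
proof
  assume "eventually (\<lambda>c. le0 (poly p c) (poly q c)) Fil"
  moreover have "to_fract q = to_fract p * (to_fract q / to_fract p)" using stable_nonzero[OF p] by simp
  ultimately show "dense_le (to_fract p) (to_fract q)" unfolding dense_le_def using p by blast
next
  assume "dense_le (to_fract p) (to_fract q)"
  then consider "q = 0" | r s where "stable s" "eventually (\<lambda>c. le0 (poly s c) (poly r c)) Fil"
    "to_fract q = to_fract p * (to_fract r / to_fract s)" unfolding dense_le_def by auto
  then show "eventually (\<lambda>c. le0 (poly p c) (poly q c)) Fil"
  proof cases
    case 1
    then show ?thesis by (simp add: K.zero)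
  next
    case 2
    have "to_fract (q * s) = to_fract (p * r)" using 2(3) stable_nonzero[OF 2(1)] by (simp add: field_simps)
    then have qs: "q * s = p * r" by (simp only: to_fract_eq_iff)
    from 2(2) stable_eventually_nonzero[OF 2(1)] show ?thesis
    proof eventually_elim
      case (elim c)
      have "poly q c * poly s c = poly p c * poly r c" using arg_cong[OF qs, of "\<lambda>g. poly g c"] by simp
      moreover have "le0 (poly p c * poly s c) (poly p c * poly r c)" using elim(1) by (rule K.mult)
      ultimately have "le0 (poly p c * poly s c) (poly q c * poly s c)" by simp
      then show ?case using elim(2) by simp
    qed
  qed
qed

lemma dense_le_total:
  assumes u: "u \<noteq> 0" and w: "w \<noteq> 0"
  shows "dense_le u w \<or> dense_le w u"
proof -
  obtain r' s' where q: "w / u = to_fract r' / to_fract s'" and nz: "r' \<noteq> 0" "s' \<noteq> 0"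
    and g: "stable r' \<or> stable s'" using reduced_fraction[of "w / u"] u w by auto
  have 1: "w = u * (to_fract r' / to_fract s')" unfolding q[symmetric] using u by simp
  have 2: "u = w * (to_fract s' / to_fract r')" unfolding 1 using nz by simp
  have stable_le: "eventually (\<lambda>c. le0 (poly h c) (poly k c)) Fil \<or> eventually (\<lambda>c. le0 (poly k c) (poly h c)) Fil"
    if hk: "stable h" "stable k" for h k
  proof -
    obtain a where a: "eventually (\<lambda>c. K.eqv (poly h c) a) Fil" using hk(1) unfolding stable_def by blast
    obtain b where b: "eventually (\<lambda>c. K.eqv (poly k c) b) Fil" using hk(2) unfolding stable_def by blast
    show ?thesis
    proof (cases "le0 a b")
      case True
      from a b have "eventually (\<lambda>c. le0 (poly h c) (poly k c)) Fil"
        by eventually_elim (use True K.trans in blast)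
      then show ?thesis by blast
    next
      case False
      then have ba: "le0 b a" using K.total by blast
      from a b have "eventually (\<lambda>c. le0 (poly k c) (poly h c)) Fil"
        by eventually_elim (use ba K.trans in blast)
      then show ?thesis by blast
    qed
  qed
  have "stable s' \<and> eventually (\<lambda>c. le0 (poly s' c) (poly r' c)) Fil \<or>
        stable r' \<and> eventually (\<lambda>c. le0 (poly r' c) (poly s' c)) Fil"
    using stable_le_null[of s' r'] stable_le_null[of r' s'] stable_le[of s' r'] g not_stable_iff by blast
  then show ?thesis unfolding dense_le_def using 1 2 by blast
qed

lemma valuation_extension_dense_le: "valuation_extension le0 dense_le"
proof -
  have "field_valuation dense_le"
  proof
    fix a b c :: "'a poly fract"
    show "dense_le a 0" by (simp add: dense_le_def)
    then show "dense_le a b \<or> dense_le b a"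
      using dense_le_total by (cases "a = 0"; cases "b = 0") (auto simp: dense_le_def)
    show "dense_le 0 a \<Longrightarrow> a = 0" by (auto simp: dense_le_def)
    show "dense_le (c * a) (c * b)" if "dense_le a b"
      using that unfolding dense_le_def by (metis mult.assoc mult_zero_right)
    show "dense_le a c" if ab: "dense_le a b" and bc: "dense_le b c"
    proof (cases "b = 0 \<or> c = 0")
      case True
      then show ?thesis using bc by (auto simp: dense_le_def)
    next
      case False
      then obtain r s where rs: "stable s" "eventually (\<lambda>c. le0 (poly s c) (poly r c)) Fil"
        "b = a * (to_fract r / to_fract s)" using ab unfolding dense_le_def by blast
      obtain r' s' where rs': "stable s'" "eventually (\<lambda>c. le0 (poly s' c) (poly r' c)) Fil"
        "c = b * (to_fract r' / to_fract s')" using bc False unfolding dense_le_def by blast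
      have "c = a * (to_fract (r * r') / to_fract (s * s'))" using rs(3) rs'(3) by simp
      moreover from rs(2) rs'(2) have "eventually (\<lambda>c. le0 (poly (s * s') c) (poly (r * r') c)) Fil"
        by eventually_elim (simp add: K.mult_mono)
      ultimately show ?thesis unfolding dense_le_def using stable_mult[OF rs(1) rs'(1)] by blast
    qed
    show "dense_le c (a + b)" if a: "dense_le c a" and b: "dense_le c b"
    proof (cases "a = 0 \<or> b = 0")
      case True
      then show ?thesis using a b by auto
    next
      case False
      then obtain r s where rs: "stable s" "eventually (\<lambda>c. le0 (poly s c) (poly r c)) Fil"
        "a = c * (to_fract r / to_fract s)" using a unfolding dense_le_def by blast
      obtain r' s' where rs': "stable s'" "eventually (\<lambda>c. le0 (poly s' c) (poly r' c)) Fil"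
        "b = c * (to_fract r' / to_fract s')" using b False unfolding dense_le_def by blast
      have "a + b = c * (to_fract (r * s' + r' * s) / to_fract (s * s'))"
        unfolding rs(3) rs'(3) using stable_nonzero[OF rs(1)] stable_nonzero[OF rs'(1)] by (simp add: field_simps)
      moreover from rs(2) rs'(2) have "eventually (\<lambda>c. le0 (poly (s * s') c) (poly (r * s' + r' * s) c)) Fil"
      proof eventually_elim
        case (elim c)
        have "le0 (poly s c * poly s' c) (poly r c * poly s' c)" using elim(1) K.mult_mono K.refl by blast
        moreover have "le0 (poly s c * poly s' c) (poly r' c * poly s c)"
          using K.mult_mono[OF elim(2) K.refl, of "poly s c"] by (simp add: mult.commute)
        ultimately show ?case using K.add by simp
      qed
      ultimately show ?thesis unfolding dense_le_def using stable_mult[OF rs(1) rs'(1)] by blast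
    qed
  qed
  moreover have "dense_le (const a) (const c) \<longleftrightarrow> le0 a c" for a c
  proof (cases "a = 0")
    case True
    then show ?thesis by (auto simp: dense_le_def)
  next
    case False
    then show ?thesis using dense_le_poly[OF stable_const, of a "[:c:]"] by (simp add: const_def)
  qed
  ultimately show ?thesis
    using K.field_valuation_axioms by (simp add: valuation_extension_def valuation_extension_axioms_def)
qed

lemma var_x_const_fract: "var_x - const c = to_fract [:- c, 1:]"
  by (simp add: var_x_def const_def flip: to_fract_diff)

text \<open>A ball that misses \<open>c\<close> lies at a constant distance from \<open>c\<close>.\<close>

lemma stable_linear: "stable [:- c, 1:]"
proof -
  obtain e a where e: "cl e a" "\<not> cl e c" using missed by blast
  have "K.lt (a - c) e" using closed_at_iff[OF e(1)] e(2) K.minus_commute(1) by blast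
  have "eventually (\<lambda>y. K.eqv (poly [:- c, 1:] y) (a - c)) Fil"
    using eventually_cl[OF e(1)]
  proof eventually_elim
    case (elim y)
    have "le0 e (y - a)" using closed_at_iff[OF e(1)] elim by blast
    then have "K.lt (a - c) (y - a)" using \<open>K.lt (a - c) e\<close> K.trans by blast
    from K.add_eqv[OF this] show ?case by (simp add: algebra_simps)
  qed
  moreover have "a - c \<noteq> 0" using K.lt_nonzero \<open>K.lt (a - c) e\<close> by blast
  ultimately show ?thesis unfolding stable_def by blast
qed

lemma dense_le_closed: "dense_le (const e) (var_x - const c) \<longleftrightarrow> cl e c"
proof (cases "e = 0")
  case True
  have "\<not> dense_le (const 0) (var_x - const c)" by (simp add: dense_le_def)
  then show ?thesis using True cl_nonzero by blast
next
  case False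
  have "dense_le (const e) (var_x - const c) \<longleftrightarrow> eventually (\<lambda>y. le0 e (y - c)) Fil"
    unfolding var_x_const_fract unfolding const_def using dense_le_poly[OF stable_const[OF False], of "[:- c, 1:]"] by simp
  also have "\<dots> \<longleftrightarrow> cl e c"
  proof
    assume ev: "eventually (\<lambda>y. le0 e (y - c)) Fil"
    obtain f a where f: "cl f a" "\<not> cl f c" using missed by blast
    from eventually_ex[OF eventually_conj[OF ev eventually_cl[OF f(1)]]]
    obtain y where y: "le0 e (y - c)" "cl f y" by blast
    have "K.lt (c - y) f" using closed_at_iff[OF y(2)] f(2) by blast
    moreover have ec: "le0 e (c - y)" using y(1) K.minus_commute(1)[of e y c] by simp
    ultimately have "le0 e f" using K.trans[of e "c - y" f] K.lt_imp_le by blast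
    then have "cl e y" using closed_at_mono[OF y(2)] by blast
    then show "cl e c" using closed_at_iff[of e y c] ec by blast
  next
    assume c: "cl e c"
    show "eventually (\<lambda>y. le0 e (y - c)) Fil"
      using eventually_cl[OF c] by eventually_elim (use closed_at_iff[OF c] in blast)
  qed
  finally show ?thesis .
qed

lemma dense_le_open:
  assumes e: "e \<noteq> 0"
  shows "\<not> dense_le (var_x - const c) (const e) \<longleftrightarrow> op e c"
proof -
  have iff: "dense_le (var_x - const c) (const e) \<longleftrightarrow> eventually (\<lambda>y. le0 (y - c) e) Fil"
    unfolding var_x_const_fract unfolding const_def using dense_le_poly[OF stable_linear, of c "[:e:]"] by simp
  show ?thesis
    unfolding iff
  proof
    assume neg: "\<not> eventually (\<lambda>y. le0 (y - c) e) Fil"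
    obtain f a where f: "cl f a" "\<not> cl f c" using missed by blast
    from neg f(1) obtain y where y: "cl f y" "K.lt e (y - c)" unfolding eventually_Fil by blast
    have "K.lt (c - y) f" using closed_at_iff[OF y(1)] f(2) by blast
    moreover have "K.lt e (c - y)" using y(2) K.minus_commute(2)[of y c e] by simp
    ultimately have "K.lt e f" using K.trans[of "c - y" f e] K.lt_imp_le by blast
    then have "op e y" using smaller_radius(2) y(1) by blast
    then show "op e c" using open_at_iff[of e y c] \<open>K.lt e (c - y)\<close> by blast
  next
    assume c: "op e c"
    obtain f a where f: "cl f a" "\<not> cl f c" using missed by blast
    have "K.lt e f" using closed_at_mono[OF open_imp_closed[OF c], of f] f(2) by blast
    have *: "K.lt e (y - c)" if "cl f y" for y
      using smaller_radius(2)[OF disjI1[OF that] \<open>K.lt e f\<close>] open_at_iff[OF c] by blast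
    have lt: "eventually (\<lambda>y. K.lt e (y - c)) Fil"
      using eventually_cl[OF f(1)] by (rule eventually_mono) (rule *)
    show "\<not> eventually (\<lambda>y. le0 (y - c) e) Fil"
    proof
      assume "eventually (\<lambda>y. le0 (y - c) e) Fil"
      from eventually_ex[OF eventually_conj[OF lt this]] show False by blast
    qed
  qed
qed

end

lemma dense_exists:
  fixes v0 :: "('a::field, 'g0) valuation"
  assumes "dense_approx v0 A"
  obtains v :: "('a poly fract, 'a poly fract set) valuation"
  where "extends v0 v" "appr v0 v var_x = A"
proof -
  interpret dense_approx v0 A by fact
  obtain v :: "('a poly fract, 'a poly fract set) valuation" where v: "extends v0 v" "vrel v = dense_le"
    using extension_realised[OF v0 valuation_extension_dense_le] by blast
  have "appr v0 v var_x = A"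
    by (rule approx_eqI[OF approx_appr[OF v0 v(1)] approx_axioms])
      (simp_all add: closed_at_appr[OF v0 v(1)] open_at_appr[OF v0 v(1)] v(2) dense_le_closed dense_le_open)
  then show thesis using that v(1) by blast
qed

context approx
begin

text \<open>For a monomial valuation the value of \<open>x - c\<close> is the smaller one of \<open>v (x - b)\<close> and \<open>v (b - c)\<close>, so only the
  centre \<open>b\<close> has to be tested.\<close>

lemma realise_monomial:
  fixes le :: "'a poly fract \<Rightarrow> 'a poly fract \<Rightarrow> bool"
  assumes le: "valuation_extension le0 le" "valuation_extension.monomial_at le (var_x - const b)"
    and b: "b \<in> Inter_type A" and nt: "\<not> trivial_type A"
    and closed: "\<And>e. e \<noteq> 0 \<Longrightarrow> le (const e) (var_x - const b) \<longleftrightarrow> cl e b"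
    and opened: "\<And>e. e \<noteq> 0 \<Longrightarrow> \<not> le (var_x - const b) (const e) \<longleftrightarrow> op e b"
  obtains v :: "('a poly fract, 'a poly fract set) valuation"
  where "extends v0 v" "vrel v = le" "appr v0 v var_x = A"
proof -
  interpret valuation_extension le0 le by fact
  obtain v :: "('a poly fract, 'a poly fract set) valuation" where v: "extends v0 v" "vrel v = le"
    using extension_realised[OF v0 le(1)] by blast
  have xc: "var_x - const c = var_x - const b + const (b - c)" for c by simp
  have bI: "cl e c \<Longrightarrow> cl e b" "op e c \<Longrightarrow> op e b" for e c using b unfolding mem_Inter_type by blast+
  have "appr v0 v var_x = A"
  proof (rule approx_eqI[OF approx_appr[OF v0 v(1)] approx_axioms])
    fix e c
    show "closed_at v0 (appr v0 v var_x) e c \<longleftrightarrow> cl e c"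
    proof (cases "e = 0")
      case True
      then show ?thesis
        using nt unfolding trivial_type_iff closed_at_appr[OF v0 v(1)] v(2) by simp
    next
      case False
      have "closed_at v0 (appr v0 v var_x) e c \<longleftrightarrow> cl e b \<and> le0 e (b - c)"
        unfolding closed_at_appr[OF v0 v(1)] v(2) xc[of c] monomial_add_const(3)[OF le(2)] closed[OF False] const_le
        by (rule HOL.refl)
      then show ?thesis using closed_at_iff[of e b c] bI(1)[of e c] K.minus_commute(1)[of e b c] by blast
    qed
    assume e: "e \<noteq> 0"
    have "open_at v0 (appr v0 v var_x) e c \<longleftrightarrow> op e b \<and> K.lt e (b - c)"
      unfolding open_at_appr[OF v0 v(1)] v(2) xc[of c] monomial_add_const(4)[OF le(2)] opened[OF e] const_le
      using e by simp
    then show "open_at v0 (appr v0 v var_x) e c \<longleftrightarrow> op e c"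
      using open_at_iff[of e b c] bI(2)[of e c] K.minus_commute(2)[of b c e] by blast
  qed
  then show thesis using that v by blast
qed

text \<open>The support is an initial segment of \<open>v\<^sub>0K\<close>, and \<open>x - b\<close> receives a new value that realises this cut.\<close>

lemma value_extending_exists:
  assumes A: "value_extending_type A"
  obtains v :: "('a poly fract, 'a poly fract set) valuation" and b
  where "extends v0 v" "appr v0 v var_x = A" "value_transcendental v0 v (var_x - const b)"
proof -
  obtain b where b: "b \<in> Inter_type A" using A unfolding value_extending_iff by blast
  have nt: "\<not> trivial_type A" using A unfolding value_extending_iff by blast
  have bI: "cl e c \<Longrightarrow> cl e b" "op e c \<Longrightarrow> op e b" for e c using b unfolding mem_Inter_type by blast+
  define S where "S = {e. cl e b}"
  have S: "0 \<notin> S" using nt unfolding trivial_type_iff S_def by blast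
  interpret monomial_cone le0 "K.cut_pos S" using K.cut_cone[OF S] .
  define t where "t = var_x - const b"
  obtain le where le: "valuation_extension le0 le" "valuation_extension.monomial_at le t"
    "\<And>a i c j. le (const a * t ^ i) (const c * t ^ j) \<longleftrightarrow> T a i c j"
    using monomial_valuation_exists[of b] unfolding t_def by blast
  interpret E: valuation_extension le0 le by fact
  have vt: "\<not> E.L.eqv (t ^ n) (const c)" if n: "n > 0" for n c
  proof
    assume "E.L.eqv (t ^ n) (const c)"
    then have 1: "T 1 n c 0" "T c 0 1 n" using le(3)[of 1 n c 0] le(3)[of c 0 1 n] by simp_all
    then have c: "c \<noteq> 0" "K.cut_pos S (1 / c) (int n)" by (auto simp: T_def)
    moreover from 1(1) c(1) have "K.cut_pos S c (- int n)" by (simp add: T_def)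
    ultimately obtain e where e: "e \<in> S" "le0 1 (1 / c * e powi int n)" "K.lt 1 (c * e powi (- int n))"
      using n by (auto simp: K.cut_pos_def)
    from K.mult_le_lt[OF e(2,3)] have "K.lt (1 * 1) (1 / c * e powi int n * (c * e powi (- int n)))" by simp
    moreover have "e \<noteq> 0" using e(1) S by auto
    then have "1 / c * e powi int n * (c * e powi (- int n)) = 1" using c(1) by (simp add: power_int_minus)
    ultimately show False by simp
  qed
  have closed: "le (const e) t \<longleftrightarrow> cl e b" if e: "e \<noteq> 0" for e
  proof -
    have "le (const e) t \<longleftrightarrow> (\<exists>f\<in>S. le0 1 (1 / e * f))"
      using le(3)[of e 0 1 1] e by (simp add: T_def K.cut_pos_def)
    also have "\<dots> \<longleftrightarrow> (\<exists>f\<in>S. le0 e f)"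
      using e K.le_divide_iff[OF e, of 1] by simp
    finally show ?thesis unfolding S_def using closed_at_mono K.refl by blast
  qed
  have opened: "\<not> le t (const e) \<longleftrightarrow> op e b" if e: "e \<noteq> 0" for e
  proof -
    have "\<not> le t (const e) \<longleftrightarrow> cl e b"
      using closed[OF e] vt[of 1 e] E.L.total[of t "const e"] by auto
    then show ?thesis
      using A open_imp_closed bI(2) unfolding value_extending_iff by blast
  qed
  obtain v :: "('a poly fract, 'a poly fract set) valuation"
    where v: "extends v0 v" "vrel v = le" "appr v0 v var_x = A"
    using realise_monomial[OF le(1) le(2)[unfolded t_def] b nt closed[unfolded t_def] opened[unfolded t_def]] by blast
  have "value_transcendental v0 v t"
    unfolding value_transcendental_iff[OF v0 v(1)] v(2) using vt t_def by simp
  then show thesis using that[OF v(1,3)] unfolding t_def by blast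
qed

text \<open>The type has a smallest ball, which is closed. Its radius becomes the value of \<open>x - b\<close>.\<close>

lemma residue_extending_exists:
  assumes A: "residue_extending_type A"
  obtains v :: "('a poly fract, 'a poly fract set) valuation" and b d
  where "extends v0 v" "appr v0 v var_x = A" "residue_transcendental v0 v (const d * (var_x - const b))"
proof -
  obtain b where b: "b \<in> Inter_type A" using A unfolding residue_extending_iff by blast
  have nt: "\<not> trivial_type A" using A unfolding residue_extending_iff by blast
  obtain g where g: "cl g b" "\<not> op g b" using A unfolding residue_extending_iff by blast
  have g0: "g \<noteq> 0" using nt g(1) unfolding trivial_type_iff by blast
  interpret monomial_cone le0 "\<lambda>a k. le0 1 (a * g powi k)" using K.gauss_cone[OF g0] .
  define t where "t = var_x - const b"
  obtain le where le: "valuation_extension le0 le" "valuation_extension.monomial_at le t"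
    "\<And>a i c j. le (const a * t ^ i) (const c * t ^ j) \<longleftrightarrow> T a i c j"
    using monomial_valuation_exists[of b] unfolding t_def by blast
  interpret E: valuation_extension le0 le by fact
  have tg: "E.L.eqv t (const g)"
    using le(3)[of 1 1 g 0] le(3)[of g 0 1 1] g0 by (simp add: T_def power_int_minus)
  have closed: "le (const e) t \<longleftrightarrow> cl e b" if e: "e \<noteq> 0" for e
  proof -
    have "le (const e) t \<longleftrightarrow> le (const e) (const g)" using tg E.L.trans by blast
    also have "\<dots> \<longleftrightarrow> le0 e g" by simp
    also have "\<dots> \<longleftrightarrow> cl e b" using closed_at_mono[OF g(1)] smaller_radius(2)[of e b g] g(2) by blast
    finally show ?thesis .
  qed
  have opened: "\<not> le t (const e) \<longleftrightarrow> op e b" if e: "e \<noteq> 0" for e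
  proof -
    have "le t (const e) \<longleftrightarrow> le (const g) (const e)" using tg E.L.trans by blast
    also have "\<dots> \<longleftrightarrow> le0 g e" by simp
    also have "\<dots> \<longleftrightarrow> \<not> op e b" using open_at_mono[of e b g] smaller_radius(2)[of g b e] g by blast
    finally show ?thesis by blast
  qed
  obtain v :: "('a poly fract, 'a poly fract set) valuation"
    where v: "extends v0 v" "vrel v = le" "appr v0 v var_x = A"
    using realise_monomial[OF le(1) le(2)[unfolded t_def] b nt closed[unfolded t_def] opened[unfolded t_def]] by blast
  let ?s = "const (inverse g) * t"
  have s1: "E.L.eqv ?s 1"
    using tg E.L.mult[of t "const g" "const (inverse g)"] E.L.mult[of "const g" t "const (inverse g)"] g0 by simp
  have mono: "E.monomial_at ?s" using E.monomial_scale[OF le(2)] .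
  have "residue_transcendental v0 v ?s"
    unfolding residue_transcendental_iff[OF v0 v(1)] v(2)
    using s1 E.monomial_residue[OF s1 mono] by blast
  then show thesis using that[OF v(1,3)] unfolding t_def by blast
qed

end

section \<open>Almost pure extensions and almost pure approximation types\<close>

text \<open>The assertions of the theorem about a single extension are propositional consequences of these
  facts.\<close>

lemma almost_pure_summary:
  fixes v0 :: "('a::field, 'g0) valuation" and v :: "('a poly fract, 'g) valuation"
  assumes v0: "is_valuation v0" and v: "extends v0 v"
  defines "A \<equiv> appr v0 v var_x"
  shows "(\<exists>b. value_transcendental v0 v (var_x - const b)) \<Longrightarrow>
      value_transcendental_ext v0 v \<and> \<not> immediate_ext v0 v \<and> \<not> residue_transcendental_ext v0 v \<and>
      value_extending_type A"
    and "(\<exists>b d. residue_transcendental v0 v (const d * (var_x - const b))) \<Longrightarrow>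
      residue_transcendental_ext v0 v \<and> \<not> immediate_ext v0 v \<and> \<not> value_transcendental_ext v0 v \<and>
      residue_extending_type A"
    and "transcendental_immediate_type v0 A \<Longrightarrow>
      immediate_ext v0 v \<and> \<not> value_transcendental_ext v0 v \<and> \<not> residue_transcendental_ext v0 v"
    and "algebraic_completion_type v0 A \<Longrightarrow>
      value_transcendental_ext v0 v \<and> \<not> immediate_ext v0 v \<and> \<not> residue_transcendental_ext v0 v \<and>
      algebraic_immediate_type v0 A"
    and "\<not> (value_extending_type A \<and> residue_extending_type A)"
    and "immediate_type A \<Longrightarrow> \<not> value_extending_type A \<and> \<not> residue_extending_type A"
    and "transcendental_immediate_type v0 A \<Longrightarrow> immediate_type A \<and> \<not> algebraic_immediate_type v0 A"
    and "algebraic_immediate_type v0 A \<Longrightarrow> immediate_type A"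
    and "pure_ext v0 v \<longleftrightarrow> (\<exists>b. value_transcendental v0 v (var_x - const b)) \<or>
      (\<exists>b d. residue_transcendental v0 v (const d * (var_x - const b))) \<or> transcendental_immediate_type v0 A"
    and "almost_pure_ext v0 v \<longleftrightarrow> pure_ext v0 v \<or> algebraic_completion_type v0 A"
proof -
  show "(\<exists>b. value_transcendental v0 v (var_x - const b)) \<Longrightarrow>
      value_transcendental_ext v0 v \<and> \<not> immediate_ext v0 v \<and> \<not> residue_transcendental_ext v0 v \<and>
      value_extending_type A"
    using value_transcendental_case[OF v0 v] unfolding A_def by blast
  show "(\<exists>b d. residue_transcendental v0 v (const d * (var_x - const b))) \<Longrightarrow>
      residue_transcendental_ext v0 v \<and> \<not> immediate_ext v0 v \<and> \<not> value_transcendental_ext v0 v \<and>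
      residue_extending_type A"
    using residue_transcendental_case[OF v0 v] unfolding A_def by blast
  show "transcendental_immediate_type v0 A \<Longrightarrow>
      immediate_ext v0 v \<and> \<not> value_transcendental_ext v0 v \<and> \<not> residue_transcendental_ext v0 v"
    using transcendental_immediate_case[OF v0 v] unfolding A_def by blast
  show "algebraic_completion_type v0 A \<Longrightarrow>
      value_transcendental_ext v0 v \<and> \<not> immediate_ext v0 v \<and> \<not> residue_transcendental_ext v0 v \<and>
      algebraic_immediate_type v0 A"
    using algebraic_completion_case[OF v0 v] unfolding A_def algebraic_completion_type_def by blast
  show "\<not> (value_extending_type A \<and> residue_extending_type A)"
    using approx.not_value_and_residue_extending[OF approx_appr[OF v0 v]] unfolding A_def by blast
  show "immediate_type A \<Longrightarrow> \<not> value_extending_type A \<and> \<not> residue_extending_type A"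
    by (simp add: immediate_type_def value_extending_type_def residue_extending_type_def)
  show "transcendental_immediate_type v0 A \<Longrightarrow> immediate_type A \<and> \<not> algebraic_immediate_type v0 A"
    by (simp add: transcendental_immediate_type_def algebraic_immediate_type_def)
  show "algebraic_immediate_type v0 A \<Longrightarrow> immediate_type A"
    by (simp add: algebraic_immediate_type_def)
  have "(\<exists>b d. value_transcendental v0 v (const d * (var_x - const b))) \<longleftrightarrow>
      (\<exists>b. value_transcendental v0 v (var_x - const b))"
    using value_transcendental_scale[OF v0 v] by (metis const_1 mult_1)
  then show "pure_ext v0 v \<longleftrightarrow> (\<exists>b. value_transcendental v0 v (var_x - const b)) \<or>
      (\<exists>b d. residue_transcendental v0 v (const d * (var_x - const b))) \<or> transcendental_immediate_type v0 A"
    unfolding pure_ext_def valuation_transcendental_def A_def using v by blast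
  show "almost_pure_ext v0 v \<longleftrightarrow> pure_ext v0 v \<or> algebraic_completion_type v0 A"
    unfolding almost_pure_ext_def A_def using v by blast
qed

lemma almost_pure_extends: "almost_pure_ext v0 v \<Longrightarrow> extends v0 v" "pure_ext v0 v \<Longrightarrow> extends v0 v"
  by (auto simp: almost_pure_ext_def pure_ext_def)

lemma almost_pure_unique:
  fixes v :: "('a::field poly fract, 'g) valuation" and w :: "('a poly fract, 'h) valuation"
  assumes v0: "is_valuation v0" and v: "almost_pure_ext v0 v" and w: "almost_pure_ext v0 w"
    and eq: "appr v0 w var_x = appr v0 v var_x"
    and div: "divisible_group (vgroup v0) \<or> residue_extending_type (appr v0 v var_x)"
  shows "vrel v = vrel w"
proof -
  note ev = almost_pure_extends(1)[OF v] and ew = almost_pure_extends(1)[OF w]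
  note sv = almost_pure_summary[OF v0 ev] and sw = almost_pure_summary[OF v0 ew, unfolded eq]
  consider "transcendental_immediate_type v0 (appr v0 v var_x) \<or> algebraic_completion_type v0 (appr v0 v var_x)"
    | "\<exists>b. value_transcendental v0 v (var_x - const b)"
    | "\<exists>b d. residue_transcendental v0 v (const d * (var_x - const b))"
    using v sv(9,10) by blast
  then show ?thesis
  proof cases
    case 1
    then show ?thesis by (rule dense_unique[OF v0 ev ew eq])
  next
    case 2
    then have "value_extending_type (appr v0 v var_x)" using sv(1) by blast
    then have "\<exists>b. value_transcendental v0 w (var_x - const b)"
      using w sw(2,4,5,6,7,8,9,10) by blast
    moreover have "divisible_group (vgroup v0)" using div sv(1)[OF 2] sv(5) by blast
    ultimately show ?thesis using value_transcendental_unique[OF v0 _ ev ew eq] 2 by blast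
  next
    case 3
    then have "residue_extending_type (appr v0 v var_x)" using sv(2) by blast
    then have "\<exists>b d. residue_transcendental v0 w (const d * (var_x - const b))"
      using w sw(1,4,5,6,7,8,9,10) by blast
    then show ?thesis using residue_transcendental_unique[OF v0 ev ew eq] 3 by blast
  qed
qed

lemma almost_pure_type_appr:
  assumes v0: "is_valuation v0" and v: "almost_pure_ext v0 v"
  shows "appr v0 v var_x \<in> almost_pure_types v0"
proof -
  note ev = almost_pure_extends(1)[OF v]
  note sv = almost_pure_summary[OF v0 ev]
  have "almost_pure_type v0 (appr v0 v var_x)"
    unfolding almost_pure_type_def pure_type_def using v sv(1,2,9,10) by blast
  then show ?thesis
    using approx.A[OF approx_appr[OF v0 ev]] by (simp add: almost_pure_types_def)
qed

lemma almost_pure_type_realised: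
  fixes v0 :: "('a::field, 'g0) valuation"
  assumes v0: "is_valuation v0" and AP: "A \<in> almost_pure_types v0"
  obtains v :: "('a poly fract, 'a poly fract set) valuation"
  where "almost_pure_ext v0 v" "appr v0 v var_x = A"
proof -
  interpret approx v0 A using v0 AP by unfold_locales (simp_all add: almost_pure_types_def)
  consider "transcendental_immediate_type v0 A \<or> algebraic_completion_type v0 A"
    | "value_extending_type A" | "residue_extending_type A"
    using AP by (auto simp: almost_pure_types_def almost_pure_type_def pure_type_def)
  then show thesis
  proof cases
    case 1
    obtain v :: "('a poly fract, 'a poly fract set) valuation" where v: "extends v0 v" "appr v0 v var_x = A"
      using dense_exists[OF dense_approxI[OF approx_axioms 1]] by blast
    then have "almost_pure_ext v0 v" using almost_pure_summary(9,10)[OF v0 v(1)] 1 by simp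
    then show thesis using that v(2) by blast
  next
    case 2
    obtain v :: "('a poly fract, 'a poly fract set) valuation" and b
      where v: "extends v0 v" "appr v0 v var_x = A" "value_transcendental v0 v (var_x - const b)"
      using value_extending_exists[OF 2] by blast
    then have "almost_pure_ext v0 v" using almost_pure_summary(9,10)[OF v0 v(1)] by blast
    then show thesis using that v(2) by blast
  next
    case 3
    obtain v :: "('a poly fract, 'a poly fract set) valuation" and b d
      where v: "extends v0 v" "appr v0 v var_x = A" "residue_transcendental v0 v (const d * (var_x - const b))"
      using residue_extending_exists[OF 3] by blast
    then have "almost_pure_ext v0 v" using almost_pure_summary(9,10)[OF v0 v(1)] by blast
    then show thesis using that v(2) by blast
  qed
qed

lemma ext_equiv_class:
  assumes v0: "is_valuation v0" and v: "extends v0 v"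
  shows "ext_equiv v0 `` {v} = {w. extends v0 w \<and> vrel w = vrel v}"
  using v by (auto simp: ext_equiv_def equiv_over_iff[OF v0 v])

lemma almost_pure_bijection:
  fixes v0 :: "('a::field, 'g0) valuation"
  assumes v0: "is_valuation v0" and div: "divisible_group (vgroup v0)"
  shows "\<exists>F. (\<forall>v :: ('a poly fract, 'a poly fract set) valuation. almost_pure_ext v0 v \<longrightarrow>
                F (ext_equiv v0 `` {v}) = appr v0 v var_x) \<and>
             bij_betw F (almost_pure_extensions v0) (almost_pure_types v0)"
proof -
  define F where "F = (\<lambda>C :: ('a poly fract, 'a poly fract set) valuation set. appr v0 (SOME v. v \<in> C) var_x)"
  have F: "F (ext_equiv v0 `` {v}) = appr v0 v var_x" if "almost_pure_ext v0 v" for v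
  proof -
    note ev = almost_pure_extends(1)[OF that]
    have "v \<in> ext_equiv v0 `` {v}" unfolding ext_equiv_class[OF v0 ev] using ev by simp
    then have "(SOME w. w \<in> ext_equiv v0 `` {v}) \<in> ext_equiv v0 `` {v}" by (rule someI)
    then show ?thesis
      unfolding F_def ext_equiv_class[OF v0 ev] using appr_cong[OF v0 _ ev] by blast
  qed
  have "bij_betw F (almost_pure_extensions v0) (almost_pure_types v0)"
  proof (rule bij_betw_imageI)
    show "inj_on F (almost_pure_extensions v0)"
    proof (rule inj_onI)
      fix C D assume "C \<in> almost_pure_extensions v0" "D \<in> almost_pure_extensions v0" and FCD: "F C = F D"
      then obtain v w where v: "almost_pure_ext v0 v" "C = ext_equiv v0 `` {v}"
        and w: "almost_pure_ext v0 w" "D = ext_equiv v0 `` {w}"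
        unfolding almost_pure_extensions_def by (auto elim!: quotientE)
      have "appr v0 w var_x = appr v0 v var_x" using FCD F[OF v(1)] F[OF w(1)] v(2) w(2) by simp
      then have "vrel v = vrel w" using almost_pure_unique[OF v0 v(1) w(1)] div by blast
      then show "C = D"
        unfolding v(2) w(2) ext_equiv_class[OF v0 almost_pure_extends(1)[OF v(1)]]
          ext_equiv_class[OF v0 almost_pure_extends(1)[OF w(1)]] by simp
    qed
    show "F ` almost_pure_extensions v0 = almost_pure_types v0"
    proof (intro equalityI subsetI)
      fix A assume "A \<in> F ` almost_pure_extensions v0"
      then obtain v where "almost_pure_ext v0 v" "A = F (ext_equiv v0 `` {v})"
        unfolding almost_pure_extensions_def by (auto elim!: quotientE)
      then show "A \<in> almost_pure_types v0" using F almost_pure_type_appr[OF v0] by simp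
    next
      fix A assume "A \<in> almost_pure_types v0"
      then obtain v :: "('a poly fract, 'a poly fract set) valuation"
        where v: "almost_pure_ext v0 v" "appr v0 v var_x = A" using almost_pure_type_realised[OF v0] by blast
      then have "ext_equiv v0 `` {v} \<in> almost_pure_extensions v0"
        unfolding almost_pure_extensions_def by (intro quotientI) simp
      then show "A \<in> F ` almost_pure_extensions v0" using F[OF v(1)] v(2) by (intro image_eqI) simp_all
    qed
  qed
  then show ?thesis using F by blast
qed

theorem theorem5p7:
  fixes v0 :: "('a::field, 'g0) valuation"
  assumes "is_valuation v0"
  shows
    "(\<forall>v :: ('a poly fract, 'g) valuation. almost_pure_ext v0 v \<longrightarrow>
        (immediate_ext v0 v \<or> value_transcendental_ext v0 v \<or> residue_transcendental_ext v0 v) \<and>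
        \<not> (immediate_ext v0 v \<and> value_transcendental_ext v0 v) \<and>
        \<not> (immediate_ext v0 v \<and> residue_transcendental_ext v0 v) \<and>
        \<not> (value_transcendental_ext v0 v \<and> residue_transcendental_ext v0 v)) \<and>

     (\<forall>v :: ('a poly fract, 'g) valuation. almost_pure_ext v0 v \<longrightarrow>
        (immediate_ext v0 v \<longleftrightarrow> transcendental_immediate_type v0 (appr v0 v var_x)) \<and>
        (algebraic_immediate_type v0 (appr v0 v var_x) \<longrightarrow> value_transcendental_ext v0 v)) \<and>

     (\<forall>v :: ('a poly fract, 'g) valuation. almost_pure_ext v0 v \<longrightarrow>
        (pure_ext v0 v \<longrightarrow>
          (value_transcendental_ext v0 v \<longleftrightarrow> (\<exists>b. value_transcendental v0 v (var_x - const b)))) \<and>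
        ((\<exists>b. value_transcendental v0 v (var_x - const b)) \<longleftrightarrow> value_extending_type (appr v0 v var_x))) \<and>
     (divisible_group (vgroup v0) \<longrightarrow>
        (\<forall>(v :: ('a poly fract, 'g) valuation) (w :: ('a poly fract, 'h) valuation).
           pure_ext v0 v \<and> value_transcendental_ext v0 v \<and> pure_ext v0 w \<and>
           appr v0 w var_x = appr v0 v var_x \<longrightarrow> equiv_over v0 v w)) \<and>

     (\<forall>v :: ('a poly fract, 'g) valuation. almost_pure_ext v0 v \<longrightarrow>
        (residue_transcendental_ext v0 v \<longleftrightarrow>
          (\<exists>b d. residue_transcendental v0 v (const d * (var_x - const b)))) \<and>
        ((\<exists>b d. residue_transcendental v0 v (const d * (var_x - const b))) \<longleftrightarrow>
          residue_extending_type (appr v0 v var_x))) \<and>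
     (\<forall>(v :: ('a poly fract, 'g) valuation) (w :: ('a poly fract, 'h) valuation).
        pure_ext v0 v \<and> residue_transcendental_ext v0 v \<and> pure_ext v0 w \<and>
        appr v0 w var_x = appr v0 v var_x \<longrightarrow> equiv_over v0 v w) \<and>

     (divisible_group (vgroup v0) \<longrightarrow>
        (\<exists>F. (\<forall>v :: ('a poly fract, 'a poly fract set) valuation. almost_pure_ext v0 v \<longrightarrow>
                F (ext_equiv v0 `` {v}) = appr v0 v var_x) \<and>
             bij_betw F (almost_pure_extensions v0) (almost_pure_types v0)))"
proof -
  note v0 = assms
  have trichotomy: "(immediate_ext v0 v \<or> value_transcendental_ext v0 v \<or> residue_transcendental_ext v0 v) \<and>
      \<not> (immediate_ext v0 v \<and> value_transcendental_ext v0 v) \<and>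
      \<not> (immediate_ext v0 v \<and> residue_transcendental_ext v0 v) \<and>
      \<not> (value_transcendental_ext v0 v \<and> residue_transcendental_ext v0 v)"
    and immediate_iff: "(immediate_ext v0 v \<longleftrightarrow> transcendental_immediate_type v0 (appr v0 v var_x)) \<and>
      (algebraic_immediate_type v0 (appr v0 v var_x) \<longrightarrow> value_transcendental_ext v0 v)"
    and value_iff: "(pure_ext v0 v \<longrightarrow>
        (value_transcendental_ext v0 v \<longleftrightarrow> (\<exists>b. value_transcendental v0 v (var_x - const b)))) \<and>
      ((\<exists>b. value_transcendental v0 v (var_x - const b)) \<longleftrightarrow> value_extending_type (appr v0 v var_x))"
    and residue_iff: "(residue_transcendental_ext v0 v \<longleftrightarrow>
        (\<exists>b d. residue_transcendental v0 v (const d * (var_x - const b)))) \<and>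
      ((\<exists>b d. residue_transcendental v0 v (const d * (var_x - const b))) \<longleftrightarrow>
        residue_extending_type (appr v0 v var_x))"
    if "almost_pure_ext v0 v" for v :: "('a poly fract, 'g) valuation"
    using almost_pure_summary[OF v0 almost_pure_extends(1)[OF that]] that by argo+
  have unique: "equiv_over v0 v w"
    if v: "pure_ext v0 v" and w: "pure_ext v0 w" and eq: "appr v0 w var_x = appr v0 v var_x"
      and "divisible_group (vgroup v0) \<or> residue_transcendental_ext v0 v"
    for v :: "('a poly fract, 'g) valuation" and w :: "('a poly fract, 'h) valuation"
  proof -
    have "divisible_group (vgroup v0) \<or> residue_extending_type (appr v0 v var_x)"
      using that(4) residue_iff[of v] v by (auto simp: almost_pure_ext_def)
    then have "vrel v = vrel w"
      using almost_pure_unique[OF v0 _ _ eq] v w by (simp add: almost_pure_ext_def)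
    then show ?thesis
      using equiv_over_iff[OF v0 almost_pure_extends(2)[OF v] almost_pure_extends(2)[OF w]] by blast
  qed
  show ?thesis
    using trichotomy immediate_iff value_iff residue_iff unique almost_pure_bijection[OF v0]
    by (intro conjI allI impI) blast+
qed

end
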